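(* Let $n$ and $k$ be integers with $n\ge 2k+1$ and $k\ge 4$. Then $ex_{\mathcal{P}}(n,C_k\cup C_k^+)=ex_{\mathcal{P}}(n,2C_k)$.
   Context: All graphs are finite and simple. $C_k$ denotes the cycle on $k$ vertices, $C_k^+$ the graph obtained from $C_k$ by adding exactly one pendant edge (joining a new vertex) to a vertex of degree two, $2C_k$ the disjoint union of two copies of $C_k$, and $C_k\cup C_k^+$ the disjoint union of $C_k$ and $C_k^+$. For a graph $H$, $ex_{\mathcal{P}}(n,H)$ is the maximum number of edges in a planar graph on $n$ vertices that does not contain $H$ as a subgraph. *)

theory Defs
  imports "HOL-Analysis.Analysis"
begin

text \<open>A graph is a pair of a vertex set and a set of edges, an edge being the set of its two ends.\<close>

type_synonym 'a graph = "'a set \<times> 'a set set"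

abbreviation verts :: "'a graph \<Rightarrow> 'a set" where "verts G \<equiv> fst G"

abbreviation edges :: "'a graph \<Rightarrow> 'a set set" where "edges G \<equiv> snd G"

definition simple_graph :: "'a graph \<Rightarrow> bool" where
  "simple_graph G \<longleftrightarrow> finite (verts G) \<and> (\<forall>e\<in>edges G. e \<subseteq> verts G \<and> card e = 2)"

definition subgraph :: "'a graph \<Rightarrow> 'a graph \<Rightarrow> bool" where
  "subgraph H G \<longleftrightarrow> simple_graph H \<and> verts H \<subseteq> verts G \<and> edges H \<subseteq> edges G"

definition isomorphic :: "'a graph \<Rightarrow> 'b graph \<Rightarrow> bool" where
  "isomorphic G H \<longleftrightarrow> (\<exists>f. bij_betw f (verts G) (verts H) \<and> edges H = (\<lambda>e. f ` e) ` edges G)"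

text \<open>As usual, containing \<open>H\<close> as a (not necessarily induced) subgraph is meant up to isomorphism.\<close>

definition contains :: "'a graph \<Rightarrow> 'b graph \<Rightarrow> bool" where
  "contains G H \<longleftrightarrow> (\<exists>H'. subgraph H' G \<and> isomorphic H' H)"

text \<open>A plane drawing: vertices are distinct points of the plane (identified with \<open>complex\<close>), the
  edge \<open>e\<close> is an arc joining the points of its ends and passing through no other vertex, and two
  distinct edges meet at most in a common end.\<close>

definition plane_drawing :: "'a graph \<Rightarrow> ('a \<Rightarrow> complex) \<Rightarrow> ('a set \<Rightarrow> real \<Rightarrow> complex) \<Rightarrow> bool" where
  "plane_drawing G p \<gamma> \<longleftrightarrow>
     inj_on p (verts G) \<and>
     (\<forall>e\<in>edges G. arc (\<gamma> e) \<and> {pathstart (\<gamma> e), pathfinish (\<gamma> e)} = p ` e \<and>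
        path_image (\<gamma> e) \<inter> p ` verts G = p ` e) \<and>
     (\<forall>e\<in>edges G. \<forall>e'\<in>edges G. e \<noteq> e' \<longrightarrow>
        path_image (\<gamma> e) \<inter> path_image (\<gamma> e') = p ` (e \<inter> e'))"

definition planar :: "'a graph \<Rightarrow> bool" where
  "planar G \<longleftrightarrow> (\<exists>p \<gamma>. plane_drawing G p \<gamma>)"

definition cycle :: "nat \<Rightarrow> nat graph" where
  "cycle k = ({..<k}, {{i, (i + 1) mod k} | i. i < k})"

text \<open>The pendant edge joins the new vertex \<open>k\<close> to \<open>0\<close>; all choices of the vertex on the cycle
  give isomorphic graphs.\<close>

definition cycle_plus :: "nat \<Rightarrow> nat graph" where
  "cycle_plus k = (insert k (verts (cycle k)), insert {0, k} (edges (cycle k)))"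

definition disjoint_union :: "'a graph \<Rightarrow> 'b graph \<Rightarrow> ('a + 'b) graph" where
  "disjoint_union G H =
     (Inl ` verts G \<union> Inr ` verts H, (\<lambda>e. Inl ` e) ` edges G \<union> (\<lambda>e. Inr ` e) ` edges H)"

text \<open>Taking vertices in \<open>nat\<close> loses no generality, since every finite graph has an isomorphic copy
  there. The edge numbers form a finite set, nonempty as soon as \<open>H\<close> has an edge (shown below), so
  that \<open>Max\<close> is a genuine maximum.\<close>

definition planar_edge_numbers :: "nat \<Rightarrow> 'b graph \<Rightarrow> nat set" where
  "planar_edge_numbers n H =
     {card (edges G) | G :: nat graph.
        simple_graph G \<and> planar G \<and> card (verts G) = n \<and> \<not> contains G H}"

definition ex_planar :: "nat \<Rightarrow> 'b graph \<Rightarrow> nat" where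
  "ex_planar n H = Max (planar_edge_numbers n H)"

lemma finite_planar_edge_numbers: "finite (planar_edge_numbers n H)"
proof (rule finite_subset)
  show "planar_edge_numbers n H \<subseteq> {..2 ^ n}"
  proof
    fix m assume "m \<in> planar_edge_numbers n H"
    then obtain G :: "nat graph" where G: "simple_graph G" "card (verts G) = n" "m = card (edges G)"
      by (auto simp: planar_edge_numbers_def)
    then have "finite (verts G)" "edges G \<subseteq> Pow (verts G)"
      by (auto simp: simple_graph_def)
    then have "card (edges G) \<le> card (Pow (verts G))"
      by (intro card_mono) auto
    with G show "m \<in> {..2 ^ n}"
      using \<open>finite (verts G)\<close> by (simp add: card_Pow)
  qed
qed simp

lemma planar_edge_numbers_nonempty:
  assumes "edges H \<noteq> {}"
  shows "planar_edge_numbers n H \<noteq> {}"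
proof -
  let ?G = "({..<n}, {}) :: nat graph"
  have "plane_drawing ?G of_nat (\<lambda>_ _. 0)"
    by (simp add: plane_drawing_def inj_on_def)
  then have "planar ?G"
    by (auto simp: planar_def)
  moreover have "\<not> contains ?G H"
    using assms by (auto simp: contains_def subgraph_def isomorphic_def)
  ultimately have "card (edges ?G) \<in> planar_edge_numbers n H"
    unfolding planar_edge_numbers_def by (intro CollectI exI[of _ ?G]) (simp add: simple_graph_def)
  then show ?thesis by blast
qed

lemma simple_graph_cycle: "k \<ge> 3 \<Longrightarrow> simple_graph (cycle k)"
  by (auto simp: simple_graph_def cycle_def card_insert_if mod_Suc)

lemma simple_graph_cycle_plus: "k \<ge> 3 \<Longrightarrow> simple_graph (cycle_plus k)"
  using simple_graph_cycle[of k] by (auto simp: simple_graph_def cycle_plus_def cycle_def)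

end

theory Submission
  imports Defs
begin

text \<open>Since \<open>2C\<^sub>k\<close> is a subgraph of \<open>C\<^sub>k \<union> C\<^sub>k\<^sup>+\<close>, only one inequality needs an argument. Let \<open>G\<close> be a planar
  graph without \<open>C\<^sub>k \<union> C\<^sub>k\<^sup>+\<close> but with two disjoint \<open>k\<close>-cycles. No edge leaves their union \<open>X\<close>, as it
  would be a pendant edge of one of the cycles. If \<open>G - X\<close> has no \<open>k\<close>-cycle and \<open>k \<ge> 5\<close>, replace \<open>G[X]\<close>,
  which has at most \<open>6k - 6\<close> edges, by a triangulation on \<open>2k\<close> vertices without two disjoint
  \<open>k\<close>-cycles. If \<open>k = 4\<close>, then \<open>G - X\<close> is \<open>C\<^sub>4\<close>-free, hence sparse (at most \<open>12(r - 2)/5\<close> edges on \<open>r\<close>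
  vertices, up to trivial cases), and the whole of \<open>G\<close> can be replaced by the join of an edge with disjoint
  paths on \<open>k - 2\<close> vertices, in which every \<open>k\<close>-cycle uses both ends of that edge. If \<open>G - X\<close> does have
  a \<open>k\<close>-cycle, then the vertex set of each \<open>k\<close>-cycle is a union of components; their union has so few edges that
  a join of this kind has more.

  The edge bounds are Euler's inequality for drawings by arbitrary arcs, where faces are represented by
  finitely many points separated by the drawing, and Janiszewski's theorem replaces
  the usual polygonal arguments. The planar graphs constructed are subgraphs of stacked triangulations,
  which are drawn with straight segments.\<close>

subsection \<open>Arcs in the plane\<close>

text \<open>A replacement must not create a new pair of disjoint \<open>k\<close>-cycles. Exchanging
  a union of components is safe if the rest has no \<open>k\<close>-cycle, because all
  \<open>k\<close>-cycles of the new graph then lie in the exchanged part. Hence further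
  \<open>k\<close>-cycles outside \<open>X\<close> have to be exchanged together with
  \<open>X\<close>. The two constructions have different prices. Against a triangulation the join
  loses about one edge per \<open>k - 2\<close> vertices, too many to pay for a triangulated
  \<open>G[X]\<close> alone. The triangulation loses nothing, but its five independent vertices with
  only five neighbours take up ten vertices, which is why \<open>k = 4\<close> is separate. There
  the join gains 5/2 edges per vertex against 12/5 outside \<open>X\<close>, and this surplus,
  starting with the vertex provided by \<open>n \<ge> 2k + 1\<close>, makes up for
  \<open>G[X]\<close>. With many cycles the components pay: each of them falls short of
  \<open>3k\<close> edges by 6, the join by at most 2 per \<open>k\<close> vertices and 6 once. The
  topology only has to yield inequalities: enough separated points, at most two of them at each
  edge, and at least three edges at each of them. No face is described by a closed walk.\<close>

lemma interior_arc_image: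
  fixes g :: "real \<Rightarrow> complex"
  assumes "arc g"
  shows "interior (path_image g) = {}"
proof (rule ccontr)
  assume ne: "interior (path_image g) \<noteq> {}"
  obtain h where h: "homeomorphism {0..1} (path_image g) g h"
    using homeomorphism_arc[OF assms] by blast
  have "inj_on h (path_image g)"
    using h by (metis homeomorphism_def inj_on_inverseI)
  then have "inj_on h (interior (path_image g))"
    by (rule inj_on_subset) (rule interior_subset)
  moreover have "continuous_on (interior (path_image g)) h"
    using h interior_subset continuous_on_subset by (metis homeomorphism_def)
  ultimately have "DIM(complex) \<le> DIM(real)"
    using invariance_of_dimension[of "interior (path_image g)" h] ne by auto
  then show False by simp
qed

text \<open>An arc does not separate the plane, so Janiszewski's theorem applies with the arc as one
  of its two sets. The typical use is an arc that hangs on \<open>K\<close> at one point.\<close>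

lemma connected_component_Compl_arc_Un:
  fixes g :: "real \<Rightarrow> complex"
  assumes "closed K" "arc g" "connected (path_image g \<inter> K)"
    and "connected_component (- K) a b" "a \<notin> path_image g" "b \<notin> path_image g"
  shows "connected_component (- (path_image g \<union> K)) a b"
proof (rule Janiszewski)
  show "compact (path_image g)"
    using assms(2) by (simp add: arc_imp_path compact_path_image)
  have "connected (- path_image g)"
    using connected_arc_complement[OF assms(2)] by simp
  then show "connected_component (- path_image g) a b"
    using assms(5,6) by (simp add: connected_iff_connected_component)
qed (use assms in auto)

lemma arc_eqD:
  "arc g \<Longrightarrow> g u = g v \<Longrightarrow> 0 \<le> u \<Longrightarrow> u \<le> 1 \<Longrightarrow> 0 \<le> v \<Longrightarrow> v \<le> 1 \<Longrightarrow> u = v"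
  by (simp add: arc_def inj_on_def)

lemma arc_interior_notin_ends:
  assumes "arc g" "0 < t" "t < 1"
  shows "g t \<in> path_image g" "g t \<noteq> pathstart g" "g t \<noteq> pathfinish g"
proof -
  show "g t \<in> path_image g"
    using assms by (auto simp: path_image_def)
  show "g t \<noteq> pathstart g" "g t \<noteq> pathfinish g"
    using assms arc_eqD[OF assms(1), of t 0] arc_eqD[OF assms(1), of t 1]
    by (auto simp: pathstart_def pathfinish_def)
qed

lemma arc_inner_point:
  assumes "arc g" "z \<in> path_image g" "z \<noteq> pathstart g" "z \<noteq> pathfinish g"
  obtains t where "0 < t" "t < 1" "z = g t"
proof -
  obtain t where t: "t \<in> {0..1}" "z = g t"
    using assms(2) by (auto simp: path_image_def)
  then have "t \<noteq> 0" "t \<noteq> 1"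
    using assms(3,4) by (auto simp: pathstart_def pathfinish_def)
  then show thesis
    using t that by (metis atLeastAtMost_iff order_le_less)
qed

lemma connected_component_ball:
  assumes "ball m r \<subseteq> S" "x \<in> ball m r" "y \<in> ball m r"
  shows "connected_component S x (y::'a::real_normed_vector)"
  using assms connected_ball by (auto simp: connected_component_def)

text \<open>An arc inside \<open>K\<close> closes \<open>g\<close> to a Jordan curve. Both sides of
  the curve accumulate at the midpoint of \<open>g\<close>, and a disc around it that misses
  \<open>K\<close> supplies a point of each side.\<close>

lemma arc_crosscut_separates:
  fixes g :: "real \<Rightarrow> complex"
  assumes "closed K" "arc g" and ends: "path_image g \<inter> K = {pathstart g, pathfinish g}"
    and pc: "path_component K (pathstart g) (pathfinish g)"
  obtains a b where "a \<notin> K \<union> path_image g" "b \<notin> K \<union> path_image g"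
    "connected_component (- K) (g (1/2)) a" "connected_component (- K) (g (1/2)) b"
    "\<not> connected_component (- (K \<union> path_image g)) a b"
proof -
  have "path_component K (pathfinish g) (pathstart g)"
    using pc by (rule path_component_sym)
  then obtain f where f: "path f" "path_image f \<subseteq> K" "pathstart f = pathfinish g" "pathfinish f = pathstart g"
    by (auto simp: path_component_def)
  have "pathfinish g \<noteq> pathstart g"
    using assms(2) by (metis arc_distinct_ends)
  then obtain h where h: "arc h" "path_image h \<subseteq> path_image f" "pathstart h = pathfinish g" "pathfinish h = pathstart g"
    using path_contains_arc[OF f(1,3,4)] by blast
  have sp: "simple_path (g +++ h)"
    by (rule simple_path_join_loop) (use assms h f ends in auto)
  have loop: "pathfinish (g +++ h) = pathstart (g +++ h)"
    using h by simp
  have im: "path_image (g +++ h) = path_image g \<union> path_image h"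
    using h by (simp add: path_image_join)
  obtain I Q where IQ: "open I" "open Q" "I \<inter> Q = {}" "I \<union> Q = - path_image (g +++ h)"
    "frontier I = path_image (g +++ h)" "frontier Q = path_image (g +++ h)"
    using Jordan_curve[OF sp loop] by metis
  define m where "m = g (1/2)"
  have m: "m \<in> path_image g" "m \<noteq> pathstart g" "m \<noteq> pathfinish g"
    using arc_interior_notin_ends[OF assms(2), of "1/2"] by (auto simp: m_def)
  then have "m \<notin> K"
    using ends by blast
  then obtain r where r: "r > 0" "ball m r \<subseteq> - K"
    using assms(1) openE[of "- K" m] by blast
  have "m \<in> closure I" "m \<in> closure Q"
    using m(1) IQ(5,6) im by (auto simp: frontier_def)
  then have "I \<inter> ball m r \<noteq> {}" "Q \<inter> ball m r \<noteq> {}"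
    using r(1) by (metis centre_in_ball closure_iff_nhds_not_empty open_ball Int_commute order_refl)+
  then obtain a b where ab: "a \<in> I" "a \<in> ball m r" "b \<in> Q" "b \<in> ball m r"
    by blast
  have "\<not> connected_component (- (K \<union> path_image g)) a b"
  proof
    assume "connected_component (- (K \<union> path_image g)) a b"
    then obtain C where C: "connected C" "C \<subseteq> - (K \<union> path_image g)" "a \<in> C" "b \<in> C"
      by (auto simp: connected_component_def)
    have "C \<subseteq> I \<union> Q"
      using C(2) IQ(4) im h(2) f(2) by blast
    then show False
      using connectedD[OF C(1) IQ(1,2)] IQ(3) ab C by blast
  qed
  moreover have "connected_component (- K) m a" "connected_component (- K) m b"
    using connected_component_ball[OF r(2)] ab r(1) by auto
  moreover have "a \<notin> K \<union> path_image g" "b \<notin> K \<union> path_image g"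
    using ab r IQ(4) im by auto
  ultimately show thesis
    using that by (auto simp: m_def)
qed

lemma frontier_component_Compl:
  fixes K :: "'a::real_normed_vector set"
  assumes "closed K"
  shows "frontier (connected_component_set (- K) z) \<subseteq> K"
  using frontier_of_connected_component_subset[of "- K" z] frontier_complement[of K] assms
    frontier_subset_closed[of K] by auto

text \<open>A connected set that leaves a component meets its frontier, and the frontier lies in
  \<open>K\<close>.\<close>

lemma connected_inter_component_boundary:
  fixes K :: "'a::real_normed_vector set"
  assumes "closed K" "connected C" "z \<in> C" "z \<notin> K"
    and "C \<inter> K \<inter> closure (connected_component_set (- K) z) = {}"
  shows "C \<subseteq> connected_component_set (- K) z"
proof (rule ccontr)
  define W where "W = connected_component_set (- K) z"
  assume "\<not> C \<subseteq> connected_component_set (- K) z"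
  then have "C - W \<noteq> {}"
    unfolding W_def by blast
  moreover have "z \<in> W"
    using assms(4) by (simp add: W_def connected_component_refl)
  then have "C \<inter> W \<noteq> {}"
    using assms(3) by blast
  ultimately have "C \<inter> frontier W \<noteq> {}"
    using connected_Int_frontier[OF assms(2)] by metis
  moreover have "frontier W \<subseteq> K"
    unfolding W_def by (rule frontier_component_Compl[OF assms(1)])
  moreover have "C \<inter> K \<inter> closure W = {}"
    using assms(5) by (simp add: W_def)
  ultimately show False
    unfolding frontier_def by blast
qed

text \<open>Suppose the closure misses \<open>g t\<close>, hence a whole piece of the arc around it.
  The two remaining end pieces hang on \<open>K\<close> at one point each and do not separate
  \<open>z\<close> from \<open>z'\<close>. A connected set joining these points can then cross the
  drawing only in the missed piece, so it never leaves the component of \<open>z\<close>.\<close>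

lemma crosscut_in_closure:
  fixes g :: "real \<Rightarrow> complex"
  assumes K: "closed K" "arc g" and ends: "path_image g \<inter> K = {pathstart g, pathfinish g}"
    and zz: "connected_component (- K) z z'" "z \<notin> path_image g" "z' \<notin> path_image g"
      "\<not> connected_component (- (K \<union> path_image g)) z z'"
    and t: "0 < t" "t < 1"
  shows "g t \<in> closure (connected_component_set (- (K \<union> path_image g)) z)"
proof (rule ccontr)
  define W where "W = connected_component_set (- (K \<union> path_image g)) z"
  assume "g t \<notin> closure (connected_component_set (- (K \<union> path_image g)) z)"
  then have "open (- closure W)" "g t \<in> - closure W"
    by (auto simp: W_def)
  moreover have "continuous_on {0..1} g"
    using K(2) by (simp add: arc_def path_def)
  then have "isCont g t"
    using t by (intro continuous_on_interior[of "{0..1}"]) auto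
  ultimately have "\<forall>\<^sub>F x in at t. g x \<in> - closure W"
    using isContD topological_tendstoD by metis
  then obtain d where d: "d > 0" "\<And>x. x \<noteq> t \<Longrightarrow> dist x t < d \<Longrightarrow> g x \<notin> closure W"
    by (auto simp: eventually_at)
  \<comment> \<open>Halving keeps the interval from \<open>t - e\<close> to \<open>t + e\<close>
    strictly inside both (0, 1) and the neighbourhood of radius \<open>d\<close>.\<close>
  define e where "e = min (d/2) (min (t/2) ((1-t)/2))"
  have e: "e > 0" "e < d" "0 < t - e" "t + e < 1"
    using d(1) t by (auto simp: e_def min_def field_simps)
  define s1 s2 where "s1 = t - e" and "s2 = t + e"
  have s: "0 < s1" "s1 < s2" "s2 < 1"
    using e by (auto simp: s1_def s2_def)
  have mid: "g x \<notin> closure W" if "s1 \<le> x" "x \<le> s2" for x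
  proof (cases "x = t")
    case False
    then show ?thesis
      using that e d(2)[of x] by (auto simp: s1_def s2_def dist_real_def)
  qed (use \<open>g t \<in> - closure W\<close> in auto)
  define g1 g2 where "g1 = subpath 0 s1 g" and "g2 = subpath s2 1 g"
  have arcs: "arc g1" "arc g2"
    using K(2) s arc_eqD[OF K(2), of 0 s1] arc_eqD[OF K(2), of s2 1]
    by (auto simp: g1_def g2_def intro!: arc_subpath_arc)
  have im: "path_image g1 = g ` {0..s1}" "path_image g2 = g ` {s2..1}" "path_image g = g ` {0..1}"
    using s by (simp_all add: g1_def g2_def path_image_subpath) (simp add: path_image_def)
  have "path_image g1 \<inter> K = {g 0}"
  proof
    show "path_image g1 \<inter> K \<subseteq> {g 0}"
    proof
      fix x assume "x \<in> path_image g1 \<inter> K"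
      then obtain u where u: "u \<in> {0..s1}" "x = g u" "g u \<in> K"
        using im by auto
      then have "g u \<in> {g 0, g 1}"
        using ends s by (auto simp: im pathstart_def pathfinish_def)
      moreover have "g u \<noteq> g 1"
        using u s arc_eqD[OF K(2), of u 1] by auto
      ultimately show "x \<in> {g 0}" using u by auto
    qed
    show "{g 0} \<subseteq> path_image g1 \<inter> K"
      using ends s by (auto simp: im pathstart_def)
  qed
  moreover have "path_image g2 \<inter> (path_image g1 \<union> K) = {g 1}"
  proof
    show "path_image g2 \<inter> (path_image g1 \<union> K) \<subseteq> {g 1}"
    proof
      fix x assume x: "x \<in> path_image g2 \<inter> (path_image g1 \<union> K)"
      then obtain u where u: "u \<in> {s2..1}" "x = g u"
        using im by auto
      have "x \<notin> path_image g1"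
        using u s arc_eqD[OF K(2), of u] by (force simp: im)
      then have "g u \<in> {g 0, g 1}"
        using x u ends s by (auto simp: im pathstart_def pathfinish_def)
      moreover have "g u \<noteq> g 0"
        using u s arc_eqD[OF K(2), of u 0] by auto
      ultimately show "x \<in> {g 1}" using u by auto
    qed
    show "{g 1} \<subseteq> path_image g2 \<inter> (path_image g1 \<union> K)"
      using ends s by (auto simp: im pathfinish_def)
  qed
  ultimately have i: "connected (path_image g1 \<inter> K)" "connected (path_image g2 \<inter> (path_image g1 \<union> K))"
    by auto
  have sub: "path_image g1 \<subseteq> path_image g" "path_image g2 \<subseteq> path_image g"
    using s by (auto simp: im)
  have "connected_component (- (path_image g1 \<union> K)) z z'"
    by (rule connected_component_Compl_arc_Un) (use K arcs i zz sub in auto)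
  moreover have "closed (path_image g1 \<union> K)"
    using arcs K by (simp add: arc_imp_path closed_path_image closed_Un)
  ultimately have "connected_component (- (path_image g2 \<union> (path_image g1 \<union> K))) z z'"
    using connected_component_Compl_arc_Un[of "path_image g1 \<union> K" g2 z z'] arcs i(2) zz(2,3) sub by blast
  then obtain C where C: "connected C" "C \<subseteq> - (path_image g2 \<union> (path_image g1 \<union> K))" "z \<in> C" "z' \<in> C"
    by (auto simp: connected_component_def)
  have "C \<inter> (K \<union> path_image g) \<inter> closure W = {}"
  proof -
    have False if x: "x \<in> C" "x \<in> K \<union> path_image g" "x \<in> closure W" for x
    proof -
      have "x \<notin> K" using C x by auto
      then obtain u where u: "u \<in> {0..1}" "x = g u" using x im by auto
      then have "s1 \<le> u" "u \<le> s2"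
        using C(2) x(1) by (force simp: im)+
      then show False using mid x u by auto
    qed
    then show ?thesis by blast
  qed
  moreover have "z \<notin> K \<union> path_image g"
    using C zz by auto
  moreover have "closed (K \<union> path_image g)"
    using K by (simp add: arc_imp_path closed_path_image closed_Un)
  ultimately have "C \<subseteq> W"
    unfolding W_def using C by (intro connected_inter_component_boundary) auto
  then show False
    using C(4) zz(4) by (auto simp: W_def)
qed


text \<open>If \<open>a\<close>, \<open>b\<close>, \<open>c\<close> were in three different components, join two points of the arc by a crosscut \<open>k\<close>
  through the component of \<open>c\<close>. This gives a Jordan curve, and near an inner point of the arc there are
  points of all three components, two of them on the same side of the curve. Janiszewski's theorem
  connects these two.\<close>

lemma crosscut_two_sides:
  fixes g :: "real \<Rightarrow> complex"
  assumes K: "closed K" "arc g" and ends: "path_image g \<inter> K = {pathstart g, pathfinish g}"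
    and ab: "connected_component (- K) a b" and bc: "connected_component (- K) b c"
    and img: "a \<notin> path_image g" "b \<notin> path_image g" "c \<notin> path_image g"
  shows "connected_component (- (K \<union> path_image g)) a b \<or> connected_component (- (K \<union> path_image g)) b c
    \<or> connected_component (- (K \<union> path_image g)) a c"
proof (rule ccontr)
  define L where "L = K \<union> path_image g"
  define W where "W = (\<lambda>z. connected_component_set (- L) z)"
  assume "\<not> ?thesis"
  then have ns: "\<not> connected_component (- L) a b" "\<not> connected_component (- L) b c"
      "\<not> connected_component (- L) a c"
    by (auto simp: L_def)
  then have ns': "\<not> connected_component (- L) c b"
    using connected_component_sym by metis
  have cb: "connected_component (- K) c b"
    using bc by (rule connected_component_sym)
  have clL: "closed L"
    using K by (simp add: L_def arc_imp_path closed_path_image closed_Un)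
  have nK: "a \<notin> K" "b \<notin> K" "c \<notin> K"
    using ab cb connected_component_in by force+
  have ba: "connected_component (- K) b a" and nsba: "\<not> connected_component (- L) b a"
    using ab ns(1) connected_component_sym by metis+
  have clo: "g t \<in> closure (W a)" "g t \<in> closure (W b)" "g t \<in> closure (W c)" if "0 < t" "t < 1" for t
    using crosscut_in_closure[OF K ends ab img(1,2) ns(1)[unfolded L_def] that]
      crosscut_in_closure[OF K ends ba img(2,1) nsba[unfolded L_def] that]
      crosscut_in_closure[OF K ends cb img(3,2) ns'[unfolded L_def] that] by (auto simp: W_def L_def)
  have WL: "W z \<inter> L = {}" "open (W z)" "connected (W z)" for z
    using clL connected_component_subset[of "- L" z] open_connected_component[of "- L" z] open_Compl[OF clL]
    by (auto simp: W_def)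
  define p q where "p = g (1/3)" and "q = g (2/3)"
  have pq: "p \<noteq> q" "p \<notin> K" "q \<notin> K" "p \<in> path_image g" "q \<in> path_image g"
    using arc_eqD[OF K(2), of "1/3" "2/3"] arc_interior_notin_ends[OF K(2), of "1/3"]
      arc_interior_notin_ends[OF K(2), of "2/3"] ends by (auto simp: p_def q_def)
  have "open (- K)" using K by auto
  then obtain r1 r2 where r: "r1 > 0" "ball p r1 \<subseteq> - K" "r2 > 0" "ball q r2 \<subseteq> - K"
    using pq openE[of "- K"] by (metis ComplI)
  \<comment> \<open>Discs that miss \<open>K\<close> put the ends of the coming crosscut on the arc
    itself; disjoint discs cut out two different parts of the frontier.\<close>
  define r where "r = min (min r1 r2) (dist p q / 2)"
  have r0: "r > 0" "ball p r \<subseteq> - K" "ball q r \<subseteq> - K"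
    using r pq by (auto simp: r_def)
  have disj: "ball p r \<inter> ball q r = {}"
    by (rule disjoint_ballI) (simp add: r_def min_def field_simps)
  have fr: "p \<in> frontier (W c)" "q \<in> frontier (W c)"
    using clo(3)[of "1/3"] clo(3)[of "2/3"] WL(1)[of c] pq WL(2)[of c]
    by (auto simp: frontier_def interior_open p_def q_def L_def)
  \<comment> \<open>A given frontier point need not be reachable by an arc through
    \<open>W c\<close>. Reachable points are only dense in the frontier, so the ends are taken near
    \<open>p\<close> and \<open>q\<close> instead of at these points.\<close>
  obtain h where h: "arc h" "pathstart h \<in> frontier (W c) \<inter> ball p r"
      "pathfinish h \<in> frontier (W c) \<inter> ball q r" "h ` {0<..<1} \<subseteq> W c"
  proof (rule dense_accessible_frontier_point_pairs[OF WL(2,3)])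
    show "openin (top_of_set (frontier (W c))) (frontier (W c) \<inter> ball p r)"
      "openin (top_of_set (frontier (W c))) (frontier (W c) \<inter> ball q r)"
      by (auto intro: openin_open_Int)
    have "p \<in> frontier (W c) \<inter> ball p r" "q \<in> frontier (W c) \<inter> ball q r"
      using fr r0 by auto
    then show "frontier (W c) \<inter> ball p r \<noteq> {}" "frontier (W c) \<inter> ball q r \<noteq> {}"
      "frontier (W c) \<inter> ball p r \<noteq> frontier (W c) \<inter> ball q r"
      using disj by blast+
  qed
  have frL: "frontier (W c) \<subseteq> L"
    unfolding W_def by (rule frontier_component_Compl[OF clL])
  have "pathstart h \<in> path_image g - K" "pathfinish h \<in> path_image g - K"
    using frL h(2,3) r0 by (auto simp: L_def)
  then obtain s s' where s: "0 < s" "s < 1" "pathstart h = g s" "0 < s'" "s' < 1" "pathfinish h = g s'"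
    using arc_inner_point[OF K(2)] ends by (metis DiffD1 DiffD2 IntD2 insertI1 insertI2)
  have "s \<noteq> s'"
    using arc_distinct_ends[OF h(1)] s by auto
  have him: "path_image h \<subseteq> insert (g s) (insert (g s') (W c))"
  proof
    fix x assume "x \<in> path_image h"
    then obtain u where u: "u \<in> {0..1}" "x = h u" by (auto simp: path_image_def)
    then consider "u = 0" | "u = 1" | "u \<in> {0<..<1}" by force
    then show "x \<in> insert (g s) (insert (g s') (W c))"
      using u s h(4) by cases (auto simp: pathstart_def pathfinish_def image_subset_iff)
  qed
  \<comment> \<open>\<open>k\<close> is \<open>h\<close>, reversed if necessary so that it leads
    back from the later point of \<open>g\<close> to the earlier one and closes the piece of
    \<open>g\<close> between them.\<close>
  obtain u v k where uv: "0 < u" "u < v" "v < 1" and k: "arc k" "pathstart k = g v" "pathfinish k = g u"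
    "path_image k \<subseteq> insert (g u) (insert (g v) (W c))"
  proof (cases "s < s'")
    case True
    show ?thesis
      by (rule that[of s s' "reversepath h"]) (use True s h him in \<open>auto simp: arc_reversepath\<close>)
  next
    case False
    then show ?thesis
      by (intro that[of s' s h]) (use \<open>s \<noteq> s'\<close> s h him in auto)
  qed
  define M where "M = subpath u v g"
  have M: "arc M" "pathstart M = g u" "pathfinish M = g v" "path_image M = g ` {u..v}"
    using K(2) uv arc_eqD[OF K(2), of u v]
    by (auto simp: M_def path_image_subpath intro!: arc_subpath_arc)
  have gim: "path_image g = g ` {0..1}"
    by (simp add: path_image_def)
  have gW: "g x \<notin> W z" if "0 \<le> x" "x \<le> 1" for x z
    using WL(1)[of z] that by (auto simp: L_def gim)
  \<comment> \<open>\<open>E\<close> is the drawing together with \<open>k\<close> but without the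
    open piece of \<open>g\<close> between \<open>u\<close> and \<open>v\<close>. It shares exactly
    \<open>k\<close> with the Jordan curve, a connected set, which is what Janiszewski's theorem
    asks for.\<close>
  define E where "E = K \<union> g ` {0..u} \<union> g ` {v..1} \<union> path_image k"
  have guv: "g u \<in> path_image k" "g v \<in> path_image k"
    using k pathstart_in_path_image[of k] pathfinish_in_path_image[of k] by auto
  have gnK: "g x \<notin> K" if "0 < x" "x < 1" for x
    using arc_interior_notin_ends[OF K(2) that] ends by blast
  have MI: "g x \<notin> E" if "u < x" "x < v" for x
  proof -
    have "g x \<notin> K" using gnK that uv by auto
    moreover have "g x \<notin> g ` {0..u}" "g x \<notin> g ` {v..1}"
      using arc_eqD[OF K(2), of x] that uv by force+
    moreover have "g x \<noteq> g u" "g x \<noteq> g v"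
      using arc_eqD[OF K(2), of x u] arc_eqD[OF K(2), of x v] that uv by auto
    then have "g x \<notin> path_image k"
      using k(4) gW[of x] that uv by auto
    ultimately show ?thesis by (auto simp: E_def)
  qed
  have Mk: "path_image M \<inter> path_image k = {g u, g v}"
  proof
    show "path_image M \<inter> path_image k \<subseteq> {g u, g v}"
      using k(4) gW uv by (force simp: M(4))
    show "{g u, g v} \<subseteq> path_image M \<inter> path_image k"
      using guv uv by (auto simp: M(4))
  qed
  have sp: "simple_path (M +++ k)"
    by (rule simple_path_join_loop) (use M k Mk in auto)
  have loop: "pathfinish (M +++ k) = pathstart (M +++ k)"
    using M k by simp
  have im: "path_image (M +++ k) = path_image M \<union> path_image k"
    using M k by (simp add: path_image_join)
  obtain I Q where IQ: "connected I" "connected Q" "I \<union> Q = - path_image (M +++ k)"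
    using Jordan_curve[OF sp loop] by metis
  have clE: "closed E"
  proof -
    have "continuous_on {0..1} g"
      using K(2) by (simp add: arc_def path_def)
    then have "compact (g ` {0..u})" "compact (g ` {v..1})"
      using uv by (auto intro!: compact_continuous_image intro: continuous_on_subset)
    then have "closed (g ` {0..u})" "closed (g ` {v..1})" "closed (path_image k)"
      using k(1) by (auto intro: compact_imp_closed simp: arc_imp_path closed_path_image)
    then show ?thesis
      using K(1) by (simp add: E_def closed_Un)
  qed
  define m where "m = g ((u+v)/2)"
  have "m \<notin> E" using MI uv by (simp add: m_def)
  then obtain e where e: "e > 0" "ball m e \<subseteq> - E"
    using clE openE[of "- E" m] by blast
  have mc: "m \<in> closure (W a)" "m \<in> closure (W b)" "m \<in> closure (W c)"
    using clo[of "(u+v)/2"] uv by (auto simp: m_def)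
  have ne: "\<exists>x. x \<in> W z \<and> x \<in> ball m e" if "m \<in> closure (W z)" for z
    using that e(1) unfolding closure_approachable by (auto simp: dist_commute)
  obtain a1 b1 c1 where abc: "a1 \<in> W a" "a1 \<in> ball m e" "b1 \<in> W b" "b1 \<in> ball m e"
     "c1 \<in> W c" "c1 \<in> ball m e"
    using ne[OF mc(1)] ne[OF mc(2)] ne[OF mc(3)] by metis
  have nJ: "z \<notin> path_image (M +++ k)" if "z \<in> W x" "z \<in> ball m e" for z x
  proof -
    have "z \<notin> path_image k" using that e(2) by (auto simp: E_def)
    moreover have "z \<notin> path_image M" using that(1) gW uv by (auto simp: M(4))
    ultimately show ?thesis using im by auto
  qed
  have key: "connected_component (- L) x y" if "x \<in> ball m e" "y \<in> ball m e"
      "connected_component (- path_image (M +++ k)) x y" for x y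
  proof -
    have "path_image (M +++ k) \<inter> E = path_image k"
    proof
      show "path_image (M +++ k) \<inter> E \<subseteq> path_image k"
      proof
        fix z assume z: "z \<in> path_image (M +++ k) \<inter> E"
        show "z \<in> path_image k"
        proof (rule ccontr)
          assume "z \<notin> path_image k"
          then obtain x where "z = g x" "u \<le> x" "x \<le> v" using z im M(4) by auto
          then show False
            using MI[of x] z guv \<open>z \<notin> path_image k\<close> by (metis IntD2 order_le_less)
        qed
      qed
    qed (auto simp: im E_def)
    then have 1: "connected (path_image (M +++ k) \<inter> E)"
      using k(1) by (simp add: connected_arc_image)
    have 2: "compact (path_image (M +++ k))"
      using sp by (simp add: simple_path_imp_path compact_path_image)
    have 3: "connected_component (- E) x y"
      using connected_component_ball[OF e(2)] that by blast
    have "connected_component (- (path_image (M +++ k) \<union> E)) x y"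
      by (rule Janiszewski[OF 2 clE 1 that(3) 3])
    moreover have "L \<subseteq> path_image (M +++ k) \<union> E"
    proof -
      have "{0..1} \<subseteq> {0..u} \<union> {u..v} \<union> {v..1}"
        by auto
      then have "g ` {0..1} \<subseteq> g ` {0..u} \<union> g ` {u..v} \<union> g ` {v..1}"
        by blast
      then show ?thesis
        by (auto simp: L_def gim im M(4) E_def)
    qed
    ultimately show ?thesis
      by (meson Compl_subset_Compl_iff connected_component_of_subset)
  qed
  have same: "connected_component (- path_image (M +++ k)) x y"
    if "x \<in> I \<and> y \<in> I \<or> x \<in> Q \<and> y \<in> Q" for x y
    using that IQ unfolding connected_component_def by (metis Un_upper1 Un_upper2)
  \<comment> \<open>Three points and two sides of the Jordan curve: two of the points are on the
    same side.\<close>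
  have "a1 \<in> I \<union> Q" "b1 \<in> I \<union> Q" "c1 \<in> I \<union> Q"
    using nJ abc IQ(3) by auto
  then have "connected_component (- L) a1 b1 \<or> connected_component (- L) b1 c1 \<or> connected_component (- L) a1 c1"
    using key same abc by blast
  moreover have "connected_component (- L) a a1" "connected_component (- L) b b1" "connected_component (- L) c c1"
    using abc by (auto simp: W_def)
  ultimately show False
    using ns by (meson connected_component_sym connected_component_trans)
qed

subsection \<open>Faces of plane drawings\<close>

locale plane_graph =
  fixes V :: "'a set" and E :: "'a set set" and p :: "'a \<Rightarrow> complex" and \<gamma> :: "'a set \<Rightarrow> real \<Rightarrow> complex"
  assumes simple: "simple_graph (V, E)" and drawn: "plane_drawing (V, E) p \<gamma>"
begin

definition curves :: "'a set set \<Rightarrow> complex set" where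
  "curves F = (\<Union>e\<in>F. path_image (\<gamma> e))"

definition drawing :: "'a set set \<Rightarrow> complex set" where
  "drawing F = p ` V \<union> curves F"

lemma finite_V: "finite V" and edge_subset: "e \<in> E \<Longrightarrow> e \<subseteq> V" and card_edge: "e \<in> E \<Longrightarrow> card e = 2"
  using simple by (auto simp: simple_graph_def)

lemma finite_E: "finite E"
proof -
  have "E \<subseteq> Pow V"
    using edge_subset by blast
  then show ?thesis
    using finite_V finite_Pow_iff finite_subset by metis
qed

lemma inj_p: "inj_on p V"
  using drawn by (simp add: plane_drawing_def)

lemma arc_edge: "e \<in> E \<Longrightarrow> arc (\<gamma> e)"
  and edge_ends: "e \<in> E \<Longrightarrow> {pathstart (\<gamma> e), pathfinish (\<gamma> e)} = p ` e"
  and edge_Int_verts: "e \<in> E \<Longrightarrow> path_image (\<gamma> e) \<inter> p ` V = p ` e"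
  using drawn by (simp_all add: plane_drawing_def)

lemma edge_Int_edge: "e \<in> E \<Longrightarrow> f \<in> E \<Longrightarrow> e \<noteq> f \<Longrightarrow> path_image (\<gamma> e) \<inter> path_image (\<gamma> f) = p ` (e \<inter> f)"
  using drawn by (simp add: plane_drawing_def)

lemma edge_Int_curves:
  assumes "e \<in> E" "F \<subseteq> E" "e \<notin> F"
  shows "path_image (\<gamma> e) \<inter> curves F = p ` (e \<inter> \<Union>F)"
proof -
  have "path_image (\<gamma> e) \<inter> curves F = (\<Union>f\<in>F. path_image (\<gamma> e) \<inter> path_image (\<gamma> f))"
    by (auto simp: curves_def)
  also have "\<dots> = (\<Union>f\<in>F. p ` (e \<inter> f))"
    using edge_Int_edge[OF assms(1)] assms(2,3) by (intro SUP_cong) auto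
  also have "\<dots> = p ` (e \<inter> \<Union>F)"
    by auto
  finally show ?thesis .
qed

lemma edge_Int_drawing:
  assumes "e \<in> E" "F \<subseteq> E" "e \<notin> F"
  shows "path_image (\<gamma> e) \<inter> drawing F = {pathstart (\<gamma> e), pathfinish (\<gamma> e)}"
  using edge_Int_curves[OF assms] edge_Int_verts[OF assms(1)] edge_ends[OF assms(1)]
  by (auto simp: drawing_def)

lemma closed_edge: "e \<in> E \<Longrightarrow> closed (path_image (\<gamma> e))"
  using arc_edge by (simp add: arc_imp_path closed_path_image)

lemma closed_curves: "F \<subseteq> E \<Longrightarrow> closed (curves F)"
  using closed_edge finite_subset[OF _ finite_E] by (auto simp: curves_def intro!: closed_UN)

lemma closed_drawing: "F \<subseteq> E \<Longrightarrow> closed (drawing F)"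
  using closed_curves finite_V by (simp add: drawing_def closed_Un finite_imp_closed)

lemma drawing_insert: "drawing (insert e F) = drawing F \<union> path_image (\<gamma> e)"
  by (auto simp: drawing_def curves_def)

lemma drawing_mono: "F \<subseteq> F' \<Longrightarrow> drawing F \<subseteq> drawing F'"
  by (auto simp: drawing_def curves_def)

lemma edge_inner_notin:
  assumes "e \<in> E" "F \<subseteq> E" "e \<notin> F" "0 < t" "t < 1"
  shows "\<gamma> e t \<notin> drawing F"
  using arc_interior_notin_ends[OF arc_edge[OF assms(1)] assms(4,5)] edge_Int_drawing[OF assms(1-3)]
  by blast

lemma edge_inner_connected:
  assumes "e \<in> E" "F \<subseteq> E" "e \<notin> F" "0 < t" "t < 1" "0 < s" "s < 1"
  shows "connected_component (- drawing F) (\<gamma> e t) (\<gamma> e s)"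
proof -
  have "{0<..<1::real} \<subseteq> {0..1}"
    by auto
  then have "continuous_on {0<..<1} (\<gamma> e)"
    using arc_edge[OF assms(1)] continuous_on_subset unfolding arc_def path_def by blast
  then have "connected (\<gamma> e ` {0<..<1})"
    by (intro connected_continuous_image) auto
  moreover have "\<gamma> e ` {0<..<1} \<subseteq> - drawing F"
    using edge_inner_notin[OF assms(1-3)] by auto
  moreover have "\<gamma> e t \<in> \<gamma> e ` {0<..<1}" "\<gamma> e s \<in> \<gamma> e ` {0<..<1}"
    using assms(4-7) by auto
  ultimately show ?thesis
    unfolding connected_component_def by blast
qed

text \<open>The lower half of Euler's formula: adding an edge either merges two classes of the labelling
  \<open>l\<close> of connected pieces or splits a face.\<close>

lemma separated_points_step:
  fixes l :: "'a \<Rightarrow> 'a"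
  assumes "F \<subseteq> E" "e \<in> E" "e \<notin> F"
    and T: "finite T" "T \<inter> drawing F = {}" "pairwise (\<lambda>x y. \<not> connected_component (- drawing F) x y) T"
    and l: "\<And>u v. u \<in> V \<Longrightarrow> v \<in> V \<Longrightarrow> l u = l v \<Longrightarrow> path_component (drawing F) (p u) (p v)"
    and card: "1 + card F + card (l ` V) \<le> card T + card V"
  obtains T' and l' :: "'a \<Rightarrow> 'a" where "finite T'" "T' \<inter> drawing (insert e F) = {}"
    "pairwise (\<lambda>x y. \<not> connected_component (- drawing (insert e F)) x y) T'"
    "\<And>u v. u \<in> V \<Longrightarrow> v \<in> V \<Longrightarrow> l' u = l' v \<Longrightarrow> path_component (drawing (insert e F)) (p u) (p v)"
    "1 + card (insert e F) + card (l' ` V) \<le> card T' + card V"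
proof -
  let ?D = "drawing F" and ?D' = "drawing (insert e F)"
  define m where "m = \<gamma> e (1/2)"
  \<comment> \<open>\<open>U\<close> is the face of the old drawing that contains the interior of
    \<open>e\<close>. Only its representative, if there is one, has to be replaced.\<close>
  define U where "U = connected_component_set (- ?D) m"
  have D': "?D' = ?D \<union> path_image (\<gamma> e)"
    by (rule drawing_insert)
  have fF: "finite F"
    using assms(1) finite_E finite_subset by blast
  have clD: "closed ?D"
    using assms(1) by (rule closed_drawing)
  have mD: "m \<notin> ?D"
    using edge_inner_notin[OF assms(2,1,3)] by (simp add: m_def)
  have eU: "x \<in> ?D \<union> U" if x: "x \<in> path_image (\<gamma> e)" for x
  proof (cases "x = pathstart (\<gamma> e) \<or> x = pathfinish (\<gamma> e)")
    case True
    then show ?thesis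
      using edge_Int_drawing[OF assms(2,1,3)] by blast
  next
    case False
    then obtain t where "0 < t" "t < 1" "x = \<gamma> e t"
      using arc_inner_point[OF arc_edge[OF assms(2)] x] by blast
    then show ?thesis
      using edge_inner_connected[OF assms(2,1,3), of "1/2" t] by (simp add: U_def m_def)
  qed
  have Uc: "x \<in> U" if "y \<in> U" "connected_component (- ?D) x y" for x y
    using that unfolding U_def by (metis connected_component_sym connected_component_trans mem_Collect_eq)
  have Uc': "connected_component (- ?D) x y" if "x \<in> U" "y \<in> U" for x y
    using that unfolding U_def by (metis connected_component_sym connected_component_trans mem_Collect_eq)
  have fewer: "\<not> connected_component (- ?D') x y" if "\<not> connected_component (- ?D) x y" for x y
    using that D' connected_component_of_subset[of "- ?D'" x y "- ?D"] by blast
  have TU: "card T \<le> card (T - U) + 1"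
  proof -
    have "x = y" if "x \<in> T \<inter> U" "y \<in> T \<inter> U" for x y
      using that T(3) Uc' by (auto simp: pairwise_def)
    then have "card (T \<inter> U) \<le> 1"
      using T(1) by (simp add: card_le_Suc0_iff_eq)
    moreover have "card T = card (T - U) + card (T \<inter> U)"
      using T(1) by (metis card_Int_Diff add.commute)
    ultimately show ?thesis by simp
  qed
  have new: "finite (T - U \<union> N)" "(T - U \<union> N) \<inter> ?D' = {}"
      "pairwise (\<lambda>x y. \<not> connected_component (- ?D') x y) (T - U \<union> N)"
      "card (T - U \<union> N) = card (T - U) + card N"
    if N: "finite N" "N \<subseteq> U" "N \<inter> ?D' = {}" "pairwise (\<lambda>x y. \<not> connected_component (- ?D') x y) N" for N
  proof -
    show "finite (T - U \<union> N)" using T N by simp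
    show "(T - U \<union> N) \<inter> ?D' = {}"
      using N(3) T(2) eU D' by blast
    show "card (T - U \<union> N) = card (T - U) + card N"
      using N T by (intro card_Un_disjoint) auto
    show "pairwise (\<lambda>x y. \<not> connected_component (- ?D') x y) (T - U \<union> N)"
    proof (rule pairwiseI)
      fix x y assume xy: "x \<in> T - U \<union> N" "y \<in> T - U \<union> N" "x \<noteq> y"
      consider "x \<in> T - U" "y \<in> T - U" | "x \<in> T - U" "y \<in> U" | "x \<in> U" "y \<in> T - U" | "x \<in> N" "y \<in> N"
        using xy N(2) by blast
      then show "\<not> connected_component (- ?D') x y"
      proof cases
        case 1
        then show ?thesis using T(3) xy(3) fewer by (auto simp: pairwise_def)
      next
        case 2
        then show ?thesis using Uc fewer by blast
      next
        case 3
        then show ?thesis using Uc fewer connected_component_sym by (metis DiffD2)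
      next
        case 4
        then show ?thesis using N(4) xy(3) by (auto simp: pairwise_def)
      qed
    qed
  qed
  have pcmono: "path_component ?D' x y" if "path_component ?D x y" for x y
    using that D' path_component_of_subset[of ?D ?D'] by blast
  obtain u v where uv: "e = {u, v}" "u \<noteq> v"
    using card_edge[OF assms(2)] by (auto simp: card_2_iff)
  then have uvV: "u \<in> V" "v \<in> V"
    using edge_subset[OF assms(2)] by auto
  have ends: "pathstart (\<gamma> e) = p u \<and> pathfinish (\<gamma> e) = p v \<or> pathstart (\<gamma> e) = p v \<and> pathfinish (\<gamma> e) = p u"
    using edge_ends[OF assms(2)] uv by (auto simp: doubleton_eq_iff)
  show thesis
  proof (cases "l u = l v")
    \<comment> \<open>Both ends are already joined in the drawing, so \<open>e\<close> is a crosscut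
      of \<open>U\<close>: two representatives replace at most one, and the number of labels stays
      the same.\<close>
    case True
    then have "path_component ?D (pathstart (\<gamma> e)) (pathfinish (\<gamma> e))"
      using l uvV ends by metis
    then obtain a b where ab: "a \<notin> ?D \<union> path_image (\<gamma> e)" "b \<notin> ?D \<union> path_image (\<gamma> e)"
      "connected_component (- ?D) m a" "connected_component (- ?D) m b"
      "\<not> connected_component (- (?D \<union> path_image (\<gamma> e))) a b"
      using arc_crosscut_separates[OF clD arc_edge[OF assms(2)] edge_Int_drawing[OF assms(2,1,3)]]
      unfolding m_def by blast
    have "a \<noteq> b"
      using ab(1,5) by auto
    have "\<not> connected_component (- (?D \<union> path_image (\<gamma> e))) b a"
      using ab(5) connected_component_sym by metis
    then have N: "finite {a, b}" "{a, b} \<subseteq> U" "{a, b} \<inter> ?D' = {}"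
        "pairwise (\<lambda>x y. \<not> connected_component (- ?D') x y) {a, b}"
      using ab unfolding U_def D' by (auto simp: pairwise_insert)
    show ?thesis
    proof (rule that[OF new(1-3)[OF N], of l])
      show "1 + card (insert e F) + card (l ` V) \<le> card (T - U \<union> {a, b}) + card V"
        using new(4)[OF N] TU card \<open>a \<noteq> b\<close> assms(3) fF by simp
    qed (use l pcmono in blast)
  next
    case False
    \<comment> \<open>The ends carry different labels, and merging these pays for the new edge. One
      representative of \<open>U\<close> off \<open>e\<close> is enough; it exists because an arc
      has empty interior.\<close>
    have "open U" "m \<in> U"
      using clD mD by (auto simp: U_def open_connected_component open_Compl connected_component_refl)
    then have "\<not> U \<subseteq> path_image (\<gamma> e)"
      using interior_arc_image[OF arc_edge[OF assms(2)]] interior_maximal by blast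
    then obtain a where a: "a \<in> U" "a \<notin> path_image (\<gamma> e)"
      by blast
    then have "a \<notin> ?D"
      using connected_component_subset[of "- ?D" m] by (auto simp: U_def)
    with a have N: "finite {a}" "{a} \<subseteq> U" "{a} \<inter> ?D' = {}"
        "pairwise (\<lambda>x y. \<not> connected_component (- ?D') x y) {a}"
      by (auto simp: D')
    define l' where "l' = (\<lambda>x. if l x = l v then l u else l x)"
    have "l' ` V = l ` V - {l v}"
      using False uvV by (auto simp: l'_def)
    then have cl: "card (l' ` V) + 1 = card (l ` V)"
      using uvV finite_V by (metis Suc_eq_plus1 card_Suc_Diff1 finite_imageI imageI)
    show ?thesis
    proof (rule that[OF new(1-3)[OF N], of l'])
      show "1 + card (insert e F) + card (l' ` V) \<le> card (T - U \<union> {a}) + card V"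
        using new(4)[OF N] TU card cl assms(3) fF by simp
    next
      fix x y assume xy: "x \<in> V" "y \<in> V" "l' x = l' y"
      have e1: "path_component ?D' (pathstart (\<gamma> e)) (pathfinish (\<gamma> e))"
        unfolding path_component_def
        by (rule exI[of _ "\<gamma> e"]) (use D' arc_edge[OF assms(2)] in \<open>auto simp: arc_imp_path\<close>)
      then have uvc: "path_component ?D' (p u) (p v)" "path_component ?D' (p v) (p u)"
        using ends path_component_sym by metis+
      have L: "path_component ?D' (p x) (p y)" if "l x = l y" "x \<in> V" "y \<in> V" for x y
        using l that pcmono by blast
      consider "l x = l y" | "l x = l v" "l y = l u" | "l y = l v" "l x = l u"
        using xy(3) by (auto simp: l'_def split: if_splits)
      then show "path_component ?D' (p x) (p y)"
      proof cases
        case 1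
        then show ?thesis using L xy by blast
      next
        case 2
        then show ?thesis
          using L[of x v] L[of u y] uvc(2) xy uvV by (metis path_component_trans)
      next
        case 3
        then show ?thesis
          using L[of x u] L[of v y] uvc(1) xy uvV by (metis path_component_trans)
      qed
    qed
  qed
qed

text \<open>Induction over the edges, starting from one point off the finite vertex set with every
  vertex labelled by itself. At least one label remains at the end, which turns the 1 of the
  invariant into 2.\<close>

lemma separated_points:
  assumes "V \<noteq> {}"
  obtains T where "finite T" "T \<inter> drawing E = {}"
    "pairwise (\<lambda>x y. \<not> connected_component (- drawing E) x y) T" "2 + card E \<le> card T + card V"
proof -
  have ex: "\<exists>T (l :: 'a \<Rightarrow> 'a). finite T \<and> T \<inter> drawing F = {} \<and>
      pairwise (\<lambda>x y. \<not> connected_component (- drawing F) x y) T \<and>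
      (\<forall>u\<in>V. \<forall>v\<in>V. l u = l v \<longrightarrow> path_component (drawing F) (p u) (p v)) \<and>
      1 + card F + card (l ` V) \<le> card T + card V" if "F \<subseteq> E" for F
    using finite_subset[OF that finite_E] that
  proof (induction F rule: finite_induct)
    case empty
    have "finite (drawing {})"
      using finite_V by (simp add: drawing_def curves_def)
    then obtain z where "z \<notin> drawing {}"
      using infinite_UNIV_char_0[where 'a=complex] ex_new_if_finite by metis
    moreover have "path_component (drawing {}) (p u) (p u)" if "u \<in> V" for u
      using that by (auto simp: drawing_def intro: path_component_refl)
    ultimately show ?case
      by (intro exI[of _ "{z}"] exI[of _ id]) auto
  next
    case (insert e F)
    then obtain T and l :: "'a \<Rightarrow> 'a" where T: "finite T" "T \<inter> drawing F = {}"
      "pairwise (\<lambda>x y. \<not> connected_component (- drawing F) x y) T"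
      "\<forall>u\<in>V. \<forall>v\<in>V. l u = l v \<longrightarrow> path_component (drawing F) (p u) (p v)"
      "1 + card F + card (l ` V) \<le> card T + card V"
      by blast
    have FE: "F \<subseteq> E" "e \<in> E" using insert.prems by auto
    have l: "\<And>u v. u \<in> V \<Longrightarrow> v \<in> V \<Longrightarrow> l u = l v \<Longrightarrow> path_component (drawing F) (p u) (p v)"
      using T(4) by blast
    obtain T' and l' :: "'a \<Rightarrow> 'a" where "finite T'" "T' \<inter> drawing (insert e F) = {}"
      "pairwise (\<lambda>x y. \<not> connected_component (- drawing (insert e F)) x y) T'"
      "\<And>u v. u \<in> V \<Longrightarrow> v \<in> V \<Longrightarrow> l' u = l' v \<Longrightarrow> path_component (drawing (insert e F)) (p u) (p v)"
      "1 + card (insert e F) + card (l' ` V) \<le> card T' + card V"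
      using separated_points_step[OF FE insert.hyps(2) T(1-3) l T(5)] by blast
    then show ?case
      by (intro exI[of _ T'] exI[of _ l'] conjI ballI impI)
  qed
  obtain T and l :: "'a \<Rightarrow> 'a" where T: "finite T" "T \<inter> drawing E = {}"
      "pairwise (\<lambda>x y. \<not> connected_component (- drawing E) x y) T"
      "1 + card E + card (l ` V) \<le> card T + card V"
    using ex[OF order_refl] by (elim exE conjE) (rule that)
  moreover have "card (l ` V) > 0"
    using assms finite_V by (simp add: card_gt_0_iff)
  ultimately show thesis
    by (intro that[of T]) auto
qed

end

section \<open>Edges on the boundary of a face, and the edge bounds obtained by counting
  them\<close>

context plane_graph
begin

text \<open>The new edge meets the earlier curves in at most one point, hence in a connected set, so
  Janiszewski's theorem shows that it creates no new face.\<close>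

lemma connected_Compl_curves_insert:
  assumes "e \<in> E" "F \<subseteq> E" "e \<notin> F" "card (e \<inter> \<Union>F) \<le> 1" "connected (- curves F)"
  shows "connected (- curves (insert e F))"
proof -
  have "finite (e \<inter> \<Union>F)"
    using edge_subset[OF assms(1)] finite_V finite_subset by blast
  then have "e \<inter> \<Union>F = {} \<or> (\<exists>x. e \<inter> \<Union>F = {x})"
    using assms(4) by (metis card_0_eq card_1_singletonE le_neq_implies_less less_one)
  then have "connected (path_image (\<gamma> e) \<inter> curves F)"
    using edge_Int_curves[OF assms(1-3)] by auto
  moreover have "compact (path_image (\<gamma> e))"
    using arc_edge[OF assms(1)] by (simp add: arc_imp_path compact_path_image)
  moreover have "connected (- path_image (\<gamma> e))"
    using connected_arc_complement[OF arc_edge[OF assms(1)]] by simp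
  ultimately have "connected (- (path_image (\<gamma> e) \<union> curves F))"
    using Janiszewski_connected closed_curves[OF assms(2)] assms(5) by metis
  then show ?thesis
    by (simp add: curves_def)
qed

lemma connected_Compl_drawing:
  assumes "F \<subseteq> E" "connected (- curves F)"
  shows "connected (- drawing F)"
proof -
  have "connected (- curves F - p ` V)"
    using assms closed_curves finite_V by (intro connected_open_delete_finite) auto
  then show ?thesis
    by (simp add: drawing_def Diff_eq Int_commute)
qed

lemma card_Int_edges:
  assumes "e \<in> E" "f \<in> E" "e \<noteq> f"
  shows "card (e \<inter> f) \<le> 1"
proof (rule ccontr)
  assume "\<not> card (e \<inter> f) \<le> 1"
  then have "card e \<le> card (e \<inter> f)" "card f \<le> card (e \<inter> f)"
    using card_edge assms by auto
  moreover have "finite e" "finite f"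
    using assms card_edge by (metis card.infinite zero_neq_numeral)+
  ultimately have "e \<inter> f = e" "e \<inter> f = f"
    by (metis card_seteq inf_le1, metis card_seteq inf_le2)
  then show False using assms(3) by blast
qed

lemma connected_Compl_curves_empty: "connected (- curves {})"
  by (simp add: curves_def connected_UNIV)

lemma connected_Compl_curves_1:
  assumes "e \<in> E"
  shows "connected (- curves {e})"
  by (rule connected_Compl_curves_insert) (use assms connected_Compl_curves_empty in auto)

lemma connected_Compl_curves_2:
  assumes "e \<in> E" "f \<in> E"
  shows "connected (- curves {e, f})"
proof (cases "e = f")
  case False
  then show ?thesis
    using connected_Compl_curves_insert[of e "{f}"] card_Int_edges[OF assms] connected_Compl_curves_1[OF assms(2)]
      assms by simp
qed (use connected_Compl_curves_1 assms in simp)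

text \<open>Two edges share at most one end, so two edges never separate. Among three separating
  edges, one with an end on neither of the others could be added last without separating anything.
  So each end of each edge lies on another edge, which forces a triangle.\<close>

lemma separating_edges:
  assumes "F \<subseteq> E" "\<not> connected (- drawing F)"
  shows "3 \<le> card F"
    and "card F = 3 \<Longrightarrow> \<exists>x y z. x \<noteq> y \<and> y \<noteq> z \<and> x \<noteq> z \<and> F = {{x, y}, {y, z}, {x, z}}"
proof -
  have nc: "\<not> connected (- curves F)"
    using assms connected_Compl_drawing by blast
  have fF: "finite F"
    using assms(1) finite_E finite_subset by blast
  show "3 \<le> card F"
  proof (rule ccontr)
    assume "\<not> 3 \<le> card F"
    then consider "card F = 0" | "card F = 1" | "card F = 2" by linarith
    then show False
    proof cases
      case 1
      then show ?thesis using fF nc connected_Compl_curves_empty by simp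
    next
      case 2
      then show ?thesis
        using nc assms(1) connected_Compl_curves_1 by (metis card_1_singletonE insert_subset)
    next
      case 3
      then show ?thesis
        using nc assms(1) connected_Compl_curves_2 by (metis card_2_iff insert_subset)
    qed
  qed
  assume "card F = 3"
  then obtain e f g where efg: "F = {e, f, g}" "e \<noteq> f" "f \<noteq> g" "e \<noteq> g"
    by (auto simp: card_3_iff)
  then have in_E: "e \<in> E" "f \<in> E" "g \<in> E"
    using assms(1) by auto
  have sub: "a \<subseteq> b \<union> c" if abc: "F = {a, b, c}" "a \<noteq> b" "a \<noteq> c" "a \<in> E" "b \<in> E" "c \<in> E" for a b c
  proof -
    have "\<not> card (a \<inter> \<Union>{b, c}) \<le> 1"
      using connected_Compl_curves_insert[of a "{b, c}"] connected_Compl_curves_2[of b c] nc abc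
      by auto
    moreover have fa: "finite a"
      using abc card_edge by (metis card.infinite zero_neq_numeral)
    ultimately have "card a \<le> card (a \<inter> (b \<union> c))"
      using card_edge abc by simp
    then show ?thesis
      using fa by (metis card_seteq inf.orderI inf_le1)
  qed
  have s: "e \<subseteq> f \<union> g" "f \<subseteq> e \<union> g" "g \<subseteq> e \<union> f"
    using sub[of e f g] sub[of f e g] sub[of g e f] efg in_E by (auto simp: insert_commute)
  obtain x y where e: "e = {x, y}" "x \<noteq> y"
    using card_edge[OF in_E(1)] by (auto simp: card_2_iff)
  obtain x1 y1 where f: "f = {x1, y1}" "x1 \<noteq> y1"
    using card_edge[OF in_E(2)] by (auto simp: card_2_iff)
  obtain x2 y2 where g: "g = {x2, y2}" "x2 \<noteq> y2"
    using card_edge[OF in_E(3)] by (auto simp: card_2_iff)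
  have "\<not> g \<subseteq> e" "\<not> g \<subseteq> f"
    using efg(3,4) e f g by auto
  then obtain z where z: "z \<in> f" "z \<notin> e"
    using s(3) by blast
  then have zg: "z \<in> g"
    using s(2) by blast
  have zxy: "z \<noteq> x" "z \<noteq> y"
    using z(2) e(1) by auto
  obtain w1 where w1: "f = {w1, z}"
    using z(1) f(1) by (cases "z = x1") (auto simp: insert_commute)
  obtain w2 where w2: "g = {w2, z}"
    using zg g(1) by (cases "z = x2") (auto simp: insert_commute)
  note w = w1 w2
  have "w1 \<noteq> w2"
    using w efg(3) by auto
  moreover have "x \<in> {w1, w2}" "y \<in> {w1, w2}"
    using s(1) zxy unfolding e(1) w by auto
  ultimately have "w1 = x \<and> w2 = y \<or> w1 = y \<and> w2 = x"
    using e(2) by auto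
  then have "F = {{x, y}, {y, z}, {x, z}}"
    using efg(1) e(1) w by auto
  then show "\<exists>x y z. x \<noteq> y \<and> y \<noteq> z \<and> x \<noteq> z \<and> F = {{x, y}, {y, z}, {x, z}}"
    using zxy e(2) by metis
qed

text \<open>A face is represented by one of its points \<open>z\<close>; an edge belongs to its boundary if an inner point
  of the edge is in the closure of the face.\<close>

definition boundary :: "complex \<Rightarrow> 'a set set" where
  "boundary z = {e \<in> E. \<exists>t\<in>{0<..<1}. \<gamma> e t \<in> closure (connected_component_set (- drawing E) z)}"

lemma boundary_subset: "boundary z \<subseteq> E"
  by (auto simp: boundary_def)

text \<open>The boundary edges and the vertices alone fence in the face: at any other point, an edge
  touching the closure of the face would be a boundary edge by definition.\<close>

lemma connected_avoiding_boundary: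
  assumes "z \<notin> drawing E" "connected C" "z \<in> C" "C \<inter> drawing (boundary z) = {}"
  shows "C \<subseteq> connected_component_set (- drawing E) z"
proof (rule connected_inter_component_boundary)
  show "closed (drawing E)"
    by (simp add: closed_drawing)
  show "C \<inter> drawing E \<inter> closure (connected_component_set (- drawing E) z) = {}"
  proof -
    have False if y: "y \<in> C" "y \<in> drawing E" "y \<in> closure (connected_component_set (- drawing E) z)" for y
    proof -
      have yb: "y \<notin> drawing (boundary z)" using y assms(4) by blast
      then obtain e where e: "e \<in> E" "y \<in> path_image (\<gamma> e)"
        using y(2) by (auto simp: drawing_def curves_def)
      have "y \<noteq> pathstart (\<gamma> e)" "y \<noteq> pathfinish (\<gamma> e)"
        using edge_ends[OF e(1)] edge_subset[OF e(1)] yb by (auto simp: drawing_def)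
      then obtain t where "0 < t" "t < 1" "y = \<gamma> e t"
        using arc_inner_point[OF arc_edge[OF e(1)] e(2)] by blast
      then have "e \<in> boundary z"
        using e(1) y(3) by (auto simp: boundary_def)
      then show False
        using yb e(2) by (auto simp: drawing_def curves_def)
    qed
    then show ?thesis by blast
  qed
qed (use assms in auto)

text \<open>Otherwise the face contains the whole complement of its boundary edges and the vertices;
  but the midpoint of an omitted edge lies in that complement and also on the drawing.\<close>

lemma boundary_separates:
  assumes "z \<notin> drawing E" "boundary z \<noteq> E"
  shows "\<not> connected (- drawing (boundary z))"
proof
  assume c: "connected (- drawing (boundary z))"
  obtain e where e: "e \<in> E" "e \<notin> boundary z"
    using boundary_subset assms(2) by blast
  have "- drawing (boundary z) \<subseteq> connected_component_set (- drawing E) z"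
    using drawing_mono[OF boundary_subset] assms(1) by (intro connected_avoiding_boundary) (use c in auto)
  moreover have "\<gamma> e (1/2) \<notin> drawing (boundary z)"
    by (rule edge_inner_notin[OF e(1) boundary_subset e(2)]) auto
  ultimately have "\<gamma> e (1/2) \<notin> drawing E"
    using connected_component_subset[of "- drawing E" z] by blast
  moreover have "\<gamma> e (1/2) \<in> drawing E"
    using e(1) arc_interior_notin_ends(1)[OF arc_edge[OF e(1)], of "1/2"]
    by (auto simp: drawing_def curves_def)
  ultimately show False by blast
qed

lemma card_boundary:
  assumes "z \<notin> drawing E" "3 \<le> card E"
  shows "3 \<le> card (boundary z)"
  using separating_edges(1)[OF boundary_subset boundary_separates[OF assms(1)]] assms(2) by metis

lemma boundary_triangle:
  assumes "z \<notin> drawing E" "4 \<le> card E" "card (boundary z) = 3"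
  shows "\<exists>a b c. a \<noteq> b \<and> b \<noteq> c \<and> a \<noteq> c \<and> boundary z = {{a, b}, {b, c}, {a, c}}"
proof -
  have "boundary z \<noteq> E" using assms(2,3) by auto
  then show ?thesis
    using separating_edges(2)[OF boundary_subset boundary_separates[OF assms(1)]] assms(3) by metis
qed

text \<open>A small disc around an inner point of \<open>e\<close> meets nothing else of the
  drawing. Deleting \<open>e\<close> therefore merges the faces at \<open>e\<close> into one
  component, of which \<open>e\<close> is a crosscut.\<close>

lemma boundary_component:
  assumes "e \<in> boundary z" "z \<notin> drawing E"
  shows "connected_component (- drawing (E - {e})) z (\<gamma> e (1/2))"
proof -
  define K W where "K = drawing (E - {e})" and "W = connected_component_set (- drawing E) z"
  obtain t where t: "0 < t" "t < 1" "\<gamma> e t \<in> closure W" and e: "e \<in> E"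
    using assms(1) by (auto simp: boundary_def W_def)
  have "\<gamma> e t \<notin> K"
    unfolding K_def by (rule edge_inner_notin[OF e _ _ t(1,2)]) auto
  moreover have "open (- K)"
    unfolding K_def by (simp add: closed_drawing open_Compl)
  ultimately obtain r where r: "r > 0" "ball (\<gamma> e t) r \<subseteq> - K"
    using openE[of "- K" "\<gamma> e t"] by blast
  obtain y where y: "y \<in> W" "y \<in> ball (\<gamma> e t) r"
    using t(3) r(1) unfolding closure_approachable by (auto simp: dist_commute)
  have "connected_component (- drawing E) z y"
    using y(1) by (simp add: W_def)
  moreover have "- drawing E \<subseteq> - K"
    unfolding K_def using drawing_mono[of "E - {e}" E] by auto
  ultimately have "connected_component (- K) z y"
    using connected_component_of_subset by metis
  moreover have "connected_component (- K) y (\<gamma> e t)"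
    using connected_component_ball[OF r(2) y(2)] r(1) by simp
  moreover have "connected_component (- K) (\<gamma> e t) (\<gamma> e (1/2))"
    unfolding K_def by (rule edge_inner_connected[OF e]) (use t in auto)
  ultimately show ?thesis
    unfolding K_def by (metis connected_component_trans)
qed

text \<open>Three representatives at \<open>e\<close> would share a component once \<open>e\<close>
  is deleted. Since a crosscut has only two sides, two of them would remain connected in the full
  drawing.\<close>

lemma card_boundary_incidences:
  assumes "finite T" "T \<inter> drawing E = {}" "e \<in> E"
    and sep: "pairwise (\<lambda>x y. \<not> connected_component (- drawing E) x y) T"
  shows "card {z\<in>T. e \<in> boundary z} \<le> 2"
proof (rule ccontr)
  assume "\<not> ?thesis"
  then have "3 \<le> card {z\<in>T. e \<in> boundary z}" by simp
  then obtain S where "S \<subseteq> {z\<in>T. e \<in> boundary z}" "card S = 3"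
    using obtain_subset_with_card_n by metis
  then obtain a b c where abc: "a \<in> T" "b \<in> T" "c \<in> T" "a \<noteq> b" "b \<noteq> c" "a \<noteq> c"
    "e \<in> boundary a" "e \<in> boundary b" "e \<in> boundary c"
    by (auto simp: card_3_iff)
  define K where "K = drawing (E - {e})"
  have D: "drawing E = K \<union> path_image (\<gamma> e)"
    using drawing_insert[of e "E - {e}"] assms(3) by (simp add: K_def insert_absorb)
  have nD: "a \<notin> drawing E" "b \<notin> drawing E" "c \<notin> drawing E"
    using abc assms(2) by auto
  have "connected_component (- K) a (\<gamma> e (1/2))" "connected_component (- K) b (\<gamma> e (1/2))"
    "connected_component (- K) c (\<gamma> e (1/2))"
    using boundary_component abc(7-9) nD unfolding K_def by auto
  then have "connected_component (- K) a b" "connected_component (- K) b c"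
    by (meson connected_component_sym connected_component_trans)+
  moreover have "closed K"
    unfolding K_def by (simp add: closed_drawing)
  moreover have "path_image (\<gamma> e) \<inter> K = {pathstart (\<gamma> e), pathfinish (\<gamma> e)}"
    unfolding K_def by (rule edge_Int_drawing[OF assms(3)]) auto
  ultimately have "connected_component (- drawing E) a b \<or> connected_component (- drawing E) b c
      \<or> connected_component (- drawing E) a c"
    unfolding D using crosscut_two_sides[of K "\<gamma> e" a b c] arc_edge[OF assms(3)] nD D by blast
  then show False
    using sep abc by (auto simp: pairwise_def)
qed

lemma sum_card_boundary:
  assumes "finite T" "T \<inter> drawing E = {}"
    "pairwise (\<lambda>x y. \<not> connected_component (- drawing E) x y) T"
  shows "(\<Sum>z\<in>T. card (boundary z)) \<le> 2 * card E"
proof -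
  have "(\<Sum>z\<in>T. card {e\<in>E. e \<in> boundary z}) = (\<Sum>e\<in>E. card {z\<in>T. e \<in> boundary z})"
    using assms(1) finite_E by (intro sum_multicount_gen) auto
  also have "\<dots> \<le> (\<Sum>e\<in>E. 2)"
    using card_boundary_incidences assms by (intro sum_mono) auto
  finally show ?thesis
    using boundary_subset by (simp add: inf.absorb2 Int_def[symmetric] Collect_conj_eq mult.commute)
qed

text \<open>For v vertices, e edges and f separated points, 3 f \<le> 2 e and f \<ge> 2 + e - v give
  e \<le> 3 v - 6. With fewer than three edges, v \<ge> 3 suffices.\<close>

lemma card_edges_le:
  assumes "3 \<le> card V"
  shows "card E \<le> 3 * card V - 6"
proof (cases "3 \<le> card E")
  case True
  have "V \<noteq> {}" using assms by auto
  then obtain T where T: "finite T" "T \<inter> drawing E = {}"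
    "pairwise (\<lambda>x y. \<not> connected_component (- drawing E) x y) T" "2 + card E \<le> card T + card V"
    using separated_points by blast
  have "3 * card T = (\<Sum>z\<in>T. 3)" by simp
  also have "\<dots> \<le> (\<Sum>z\<in>T. card (boundary z))"
    using card_boundary True T(2) by (intro sum_mono) auto
  also have "\<dots> \<le> 2 * card E"
    by (rule sum_card_boundary[OF T(1-3)])
  finally show ?thesis using T(4) by linarith
qed (use assms in linarith)

text \<open>Two triangular faces with a common edge and different third vertices yield a 4-cycle. If
  the third vertices agree, both faces have the same boundary triangle, and a point \<open>s\<close>
  on a fourth edge is added. The crosscut \<open>e\<close> has two sides, so two of the three points
  stay connected off the triangle. This contradicts the separation of the two faces or the position
  of \<open>s\<close> on the drawing.\<close>

lemma card_triangular_boundary: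
  assumes "finite T" "T \<inter> drawing E = {}" "e \<in> E" "4 \<le> card E"
    and sep: "pairwise (\<lambda>x y. \<not> connected_component (- drawing E) x y) T"
    and no_C4: "\<And>a b c d. distinct [a, b, c, d] \<Longrightarrow> {{a, b}, {b, c}, {c, d}, {d, a}} \<subseteq> E \<Longrightarrow> False"
  shows "card {z\<in>{z\<in>T. card (boundary z) = 3}. e \<in> boundary z} \<le> 1"
proof -
  have "z = z'" if z: "z \<in> T" "card (boundary z) = 3" "e \<in> boundary z"
      and z': "z' \<in> T" "card (boundary z') = 3" "e \<in> boundary z'" for z z'
  proof (rule ccontr)
    assume "z \<noteq> z'"
    then have nc: "\<not> connected_component (- drawing E) z z'" "\<not> connected_component (- drawing E) z' z"
      using z(1) z'(1) sep by (auto simp: pairwise_def)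
    have nD: "z \<notin> drawing E" "z' \<notin> drawing E"
      using z z' assms(2) by auto
    have tri: "\<exists>a b c. e = {a, b} \<and> a \<noteq> b \<and> c \<noteq> a \<and> c \<noteq> b \<and> boundary w = {{a, b}, {b, c}, {a, c}}"
      if w: "w \<notin> drawing E" "card (boundary w) = 3" "e \<in> boundary w" for w
    proof -
      obtain a b c where abc: "a \<noteq> b" "b \<noteq> c" "a \<noteq> c" "boundary w = {{a, b}, {b, c}, {a, c}}"
        using boundary_triangle[OF w(1) assms(4) w(2)] by blast
      then consider "e = {a, b}" | "e = {b, c}" | "e = {a, c}"
        using w(3) by auto
      then show ?thesis
      proof cases
        case 1
        then show ?thesis using abc by metis
      next
        case 2
        have "boundary w = {{b, c}, {c, a}, {b, a}}" using abc(4) by (auto simp: insert_commute)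
        then show ?thesis using 2 abc(1-3) by metis
      next
        case 3
        have "boundary w = {{a, c}, {c, b}, {a, b}}" using abc(4) by (auto simp: insert_commute)
        then show ?thesis using 3 abc(1-3) by metis
      qed
    qed
    obtain a b c where abc: "e = {a, b}" "a \<noteq> b" "c \<noteq> a" "c \<noteq> b" "boundary z = {{a, b}, {b, c}, {a, c}}"
      using tri[OF nD(1) z(2,3)] by blast
    obtain a' b' c' where abc': "e = {a', b'}" "a' \<noteq> b'" "c' \<noteq> a'" "c' \<noteq> b'"
        "boundary z' = {{a', b'}, {b', c'}, {a', c'}}"
      using tri[OF nD(2) z'(2,3)] by blast
    have ends: "a' = a \<and> b' = b \<or> a' = b \<and> b' = a"
      using abc(1) abc'(1) by (auto simp: doubleton_eq_iff)
    have b': "boundary z' = {{a, b}, {b, c'}, {a, c'}}"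
      using ends abc'(5) by (auto simp: insert_commute)
    have "c = c'"
    proof (rule ccontr)
      assume "c \<noteq> c'"
      then have "distinct [a, c, b, c']"
        using abc abc' ends by auto
      moreover have "{{a, c}, {c, b}, {b, c'}, {c', a}} \<subseteq> E"
        using abc(5) b' boundary_subset[of z] boundary_subset[of z'] by (auto simp: insert_commute)
      ultimately show False by (rule no_C4)
    qed
    then have same: "boundary z' = boundary z"
      using b' abc(5) by simp
    have "boundary z \<noteq> E" using z(2) assms(4) by auto
    then obtain f where f: "f \<in> E" "f \<notin> boundary z"
      using boundary_subset by blast
    define s where "s = \<gamma> f (1/2)"
    have s: "s \<notin> drawing (boundary z)"
      unfolding s_def by (rule edge_inner_notin[OF f(1) boundary_subset f(2)]) auto
    have sE: "s \<in> drawing E"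
      using f(1) arc_interior_notin_ends(1)[OF arc_edge[OF f(1)], of "1/2"]
      by (auto simp: drawing_def curves_def s_def)
    define K where "K = drawing (boundary z - {e})"
    have bs: "boundary z - {e} \<subseteq> E" "e \<notin> boundary z - {e}"
      using boundary_subset[of z] by auto
    have D: "drawing (boundary z) = K \<union> path_image (\<gamma> e)"
      using drawing_insert[of e "boundary z - {e}"] z(3) by (simp add: K_def insert_absorb)
    have "boundary z - {e} = {{b, c}, {a, c}}"
      using abc by (auto simp: doubleton_eq_iff)
    then have "connected (- K)"
      unfolding K_def using connected_Compl_drawing[OF bs(1)] connected_Compl_curves_2 boundary_subset[of z] abc(5)
      by simp
    moreover have znb: "z \<notin> drawing (boundary z)" "z' \<notin> drawing (boundary z)"
      using nD drawing_mono[OF boundary_subset] by auto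
    ultimately have "connected_component (- K) z z'" "connected_component (- K) z' s"
      using s D by (auto simp: connected_iff_connected_component)
    moreover have "closed K"
      unfolding K_def using bs(1) by (rule closed_drawing)
    moreover have "path_image (\<gamma> e) \<inter> K = {pathstart (\<gamma> e), pathfinish (\<gamma> e)}"
      unfolding K_def by (rule edge_Int_drawing[OF assms(3) bs])
    ultimately consider "connected_component (- drawing (boundary z)) z z'" |
        "connected_component (- drawing (boundary z)) z' s" | "connected_component (- drawing (boundary z)) z s"
      unfolding D using crosscut_two_sides[of K "\<gamma> e" z z' s] arc_edge[OF assms(3)] znb s D by blast
    moreover have key: "y \<in> connected_component_set (- drawing E) w"
      if w: "connected_component (- drawing (boundary z)) w y" "w \<notin> drawing E" "boundary w = boundary z" for w y
    proof -
      obtain C where "connected C" "C \<subseteq> - drawing (boundary z)" "w \<in> C" "y \<in> C"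
        using w(1) unfolding connected_component_def by blast
      then show ?thesis
        using connected_avoiding_boundary[OF w(2), of C] w(3) by auto
    qed
    ultimately show False
    proof cases
      case 1
      then show False using key[OF 1 nD(1)] nc by simp
    next
      case 2
      then show False
        using key[OF 2 nD(2) same] sE connected_component_subset[of "- drawing E" z'] by blast
    next
      case 3
      then show False
        using key[OF 3 nD(1)] sE connected_component_subset[of "- drawing E" z] by blast
    qed
  qed
  then show ?thesis
    using assms(1) by (simp add: card_le_Suc0_iff_eq)
qed

text \<open>Triangular faces share no edges, so if t of the f faces are triangular then 3 t \<le> e.
  Each triangular face falls short of four edges by one, whence 4 f \<le> 2 e + t \<le> 7 e / 3.
  With f \<ge> 2 + e - v this is 5 e \<le> 12 (v - 2).\<close>

lemma no_C4_card_edges_le: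
  assumes "4 \<le> card E"
    and no_C4: "\<And>a b c d. distinct [a, b, c, d] \<Longrightarrow> {{a, b}, {b, c}, {c, d}, {d, a}} \<subseteq> E \<Longrightarrow> False"
  shows "5 * card E + 24 \<le> 12 * card V"
proof -
  have "V \<noteq> {}"
  proof -
    have "E \<noteq> {}" using assms(1) by auto
    then obtain e where "e \<in> E" by blast
    then show ?thesis using edge_subset[of e] card_edge[of e] by auto
  qed
  then obtain T where T: "finite T" "T \<inter> drawing E = {}"
    "pairwise (\<lambda>x y. \<not> connected_component (- drawing E) x y) T" "2 + card E \<le> card T + card V"
    using separated_points by blast
  define T3 where "T3 = {z\<in>T. card (boundary z) = 3}"
  have T3: "T3 \<subseteq> T" "finite T3" using T(1) by (auto simp: T3_def)
  have "(\<Sum>z\<in>T3. card {e\<in>E. e \<in> boundary z}) = (\<Sum>e\<in>E. card {z\<in>T3. e \<in> boundary z})"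
    using T3 finite_E by (intro sum_multicount_gen) auto
  also have "\<dots> \<le> (\<Sum>e\<in>E. 1)"
    unfolding T3_def by (intro sum_mono card_triangular_boundary[OF T(1,2) _ assms(1) T(3)] no_C4)
  finally have "(\<Sum>z\<in>T3. card {e\<in>E. e \<in> boundary z}) \<le> card E" by simp
  moreover have "(\<Sum>z\<in>T3. card {e\<in>E. e \<in> boundary z}) = (\<Sum>z\<in>T3. 3)"
  proof (rule sum.cong)
    fix z assume "z \<in> T3"
    moreover have "{e\<in>E. e \<in> boundary z} = boundary z" using boundary_subset by auto
    ultimately show "card {e\<in>E. e \<in> boundary z} = 3" by (simp add: T3_def)
  qed simp
  ultimately have 1: "3 * card T3 \<le> card E" by simp
  have "4 * card T \<le> (\<Sum>z\<in>T. card (boundary z) + (if z \<in> T3 then 1 else 0))"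
  proof -
    have "4 \<le> card (boundary z) + (if z \<in> T3 then 1 else 0)" if "z \<in> T" for z
    proof -
      have "z \<notin> drawing E" using that T(2) by blast
      then show ?thesis
        using card_boundary[of z] that assms(1) by (auto simp: T3_def)
    qed
    then have "(\<Sum>z\<in>T. 4) \<le> (\<Sum>z\<in>T. card (boundary z) + (if z \<in> T3 then 1 else 0))"
      by (rule sum_mono)
    then show ?thesis by simp
  qed
  also have "\<dots> = (\<Sum>z\<in>T. card (boundary z)) + card T3"
    using T(1) T3(1) by (simp add: sum.distrib sum.If_cases inf.absorb2)
  also have "\<dots> \<le> 2 * card E + card T3"
    using sum_card_boundary[OF T(1-3)] by simp
  finally show ?thesis using 1 T(4) by linarith
qed

end

lemma planar_card_edges_le:
  assumes "simple_graph G" "planar G" "3 \<le> card (verts G)"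
  shows "card (edges G) \<le> 3 * card (verts G) - 6"
proof -
  obtain p \<gamma> where "plane_drawing G p \<gamma>"
    using assms(2) by (auto simp: planar_def)
  then interpret plane_graph "verts G" "edges G" p \<gamma>
    using assms(1) by unfold_locales auto
  show ?thesis using card_edges_le assms(3) .
qed

lemma planar_no_C4_card_edges_le:
  assumes "simple_graph G" "planar G" "4 \<le> card (edges G)"
    and "\<And>a b c d. distinct [a, b, c, d] \<Longrightarrow> {{a, b}, {b, c}, {c, d}, {d, a}} \<subseteq> edges G \<Longrightarrow> False"
  shows "5 * card (edges G) + 24 \<le> 12 * card (verts G)"
proof -
  obtain p \<gamma> where "plane_drawing G p \<gamma>"
    using assms(2) by (auto simp: planar_def)
  then interpret plane_graph "verts G" "edges G" p \<gamma>
    using assms(1) by unfold_locales auto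
  show ?thesis by (rule no_C4_card_edges_le[OF assms(3,4)])
qed

subsection \<open>Constructing planar graphs\<close>

lemma planar_subgraph:
  assumes "planar (V, E)" "V' \<subseteq> V" "E' \<subseteq> E" "\<And>e. e \<in> E' \<Longrightarrow> e \<subseteq> V'"
  shows "planar (V', E')"
proof -
  obtain p \<gamma> where pd: "plane_drawing (V, E) p \<gamma>"
    using assms(1) by (auto simp: planar_def)
  have pd': "inj_on p V" "\<And>e. e \<in> E \<Longrightarrow> arc (\<gamma> e)"
    "\<And>e. e \<in> E \<Longrightarrow> {pathstart (\<gamma> e), pathfinish (\<gamma> e)} = p ` e"
    "\<And>e. e \<in> E \<Longrightarrow> path_image (\<gamma> e) \<inter> p ` V = p ` e"
    "\<And>e f. e \<in> E \<Longrightarrow> f \<in> E \<Longrightarrow> e \<noteq> f \<Longrightarrow> path_image (\<gamma> e) \<inter> path_image (\<gamma> f) = p ` (e \<inter> f)"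
    using pd by (simp_all add: plane_drawing_def)
  have sub: "e \<in> E" if "e \<in> E'" for e
    using that assms(3) by (rule rev_subsetD)
  have int: "path_image (\<gamma> e) \<inter> p ` V' = p ` e" if "e \<in> E'" for e
  proof -
    have "p ` e \<subseteq> p ` V'" "p ` V' \<subseteq> p ` V"
      using assms(2) assms(4)[OF that] by (simp_all add: image_mono)
    then show ?thesis
      using pd'(4)[OF sub[OF that]] by blast
  qed
  have "inj_on p V'"
    using pd'(1) assms(2) by (rule inj_on_subset)
  then have "plane_drawing (V', E') p \<gamma>"
    unfolding plane_drawing_def fst_conv snd_conv
    by (intro conjI ballI impI) (simp_all add: pd' sub int)
  then show ?thesis
    unfolding planar_def by blast
qed

lemma planar_image:
  assumes "planar (V, E)" "simple_graph (V, E)" "inj_on f V"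
  shows "planar (f ` V, (`) f ` E)"
proof -
  obtain p \<gamma> where pd: "plane_drawing (V, E) p \<gamma>"
    using assms(1) by (auto simp: planar_def)
  define g where "g = inv_into V f"
  have gf: "g (f v) = v" if "v \<in> V" for v
    using that assms(3) by (simp add: g_def)
  have EV: "e \<subseteq> V" if "e \<in> E" for e
    using assms(2) that by (auto simp: simple_graph_def)
  have gfe: "g ` f ` e = e" if "e \<in> E" for e
    using EV[OF that] gf by force
  have gV: "g ` f ` V = V"
    using gf by force
  have "plane_drawing (f ` V, (`) f ` E) (p \<circ> g) (\<lambda>e. \<gamma> (g ` e))"
    unfolding plane_drawing_def fst_conv snd_conv
  proof (intro conjI ballI impI)
    have "inj_on g (f ` V)"
      by (metis g_def inj_on_inv_into order_refl)
    moreover have "inj_on p (g ` f ` V)"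
      using pd by (simp add: plane_drawing_def gV)
    ultimately show "inj_on (p \<circ> g) (f ` V)"
      by (rule comp_inj_on)
  next
    fix e' assume "e' \<in> (`) f ` E"
    then obtain e where e: "e \<in> E" "e' = f ` e" by auto
    have 1: "g ` e' = e" using e gfe by simp
    show "arc (\<gamma> (g ` e'))"
      using pd e(1) unfolding 1 by (simp add: plane_drawing_def)
    show "{pathstart (\<gamma> (g ` e')), pathfinish (\<gamma> (g ` e'))} = (p \<circ> g) ` e'"
      using pd e(1) unfolding image_comp[symmetric] 1 by (simp add: plane_drawing_def)
    show "path_image (\<gamma> (g ` e')) \<inter> (p \<circ> g) ` f ` V = (p \<circ> g) ` e'"
      using pd e(1) unfolding image_comp[symmetric, of p g] 1 gV by (simp add: plane_drawing_def)
    fix d' assume "d' \<in> (`) f ` E" and ne: "e' \<noteq> d'"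
    then obtain d where d: "d \<in> E" "d' = f ` d" by auto
    have 2: "g ` d' = d" using d gfe by simp
    have "f ` e \<inter> f ` d = f ` (e \<inter> d)"
      using inj_on_image_Int[OF assms(3) EV[OF e(1)] EV[OF d(1)]] by simp
    moreover have "g ` f ` (e \<inter> d) = e \<inter> d"
      unfolding g_def by (rule inv_into_image_cancel[OF assms(3)]) (use EV[OF e(1)] in blast)
    ultimately have "g ` (e' \<inter> d') = e \<inter> d"
      using e(2) d(2) by simp
    moreover have "e \<noteq> d" using ne e d by auto
    ultimately show "path_image (\<gamma> (g ` e')) \<inter> path_image (\<gamma> (g ` d')) = (p \<circ> g) ` (e' \<inter> d')"
      using pd e(1) d(1) unfolding image_comp[symmetric] 1 2 by (simp add: plane_drawing_def)
  qed
  then show ?thesis by (auto simp: planar_def)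
qed

lemma plane_drawing_translation:
  assumes "plane_drawing G p \<gamma>"
  shows "plane_drawing G ((+) c \<circ> p) (\<lambda>e. (+) c \<circ> \<gamma> e)"
proof -
  have inj: "inj ((+) c)" by simp
  have int: "(+) c ` A \<inter> (+) c ` B = (+) c ` (A \<inter> B)" for A B :: "complex set"
    by (simp add: image_Int)
  have arc: "arc ((+) c \<circ> g)" if "arc g" for g :: "real \<Rightarrow> complex"
    using that by (simp add: arc_translation_eq)
  show ?thesis
    unfolding plane_drawing_def image_comp[symmetric] path_image_compose int pathstart_compose
      pathfinish_compose
  proof (intro conjI ballI impI)
    show "inj_on ((+) c \<circ> p) (verts G)"
      using assms by (intro comp_inj_on) (auto simp: plane_drawing_def)
  next
    fix e assume e: "e \<in> edges G"
    have G: "arc (\<gamma> e)" "{pathstart (\<gamma> e), pathfinish (\<gamma> e)} = p ` e" "path_image (\<gamma> e) \<inter> p ` verts G = p ` e"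
      using assms e by (simp_all add: plane_drawing_def)
    show "arc ((+) c \<circ> \<gamma> e)" using arc G(1) .
    show "{c + pathstart (\<gamma> e), c + pathfinish (\<gamma> e)} = (+) c ` p ` e"
      unfolding G(2)[symmetric] by simp
    show "(+) c ` (path_image (\<gamma> e) \<inter> p ` verts G) = (+) c ` p ` e"
      unfolding G(3) ..
    fix f assume "f \<in> edges G" "e \<noteq> f"
    then have "path_image (\<gamma> e) \<inter> path_image (\<gamma> f) = p ` (e \<inter> f)"
      using assms e by (simp add: plane_drawing_def)
    then show "(+) c ` (path_image (\<gamma> e) \<inter> path_image (\<gamma> f)) = (+) c ` p ` (e \<inter> f)"
      by simp
  qed
qed

lemma planar_Un:
  assumes 1: "planar (V1, E1)" "simple_graph (V1, E1)" and 2: "planar (V2, E2)" "simple_graph (V2, E2)"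
    and disj: "V1 \<inter> V2 = {}"
  shows "planar (V1 \<union> V2, E1 \<union> E2)"
proof -
  obtain p1 \<gamma>1 where d1: "plane_drawing (V1, E1) p1 \<gamma>1"
    using 1 by (auto simp: planar_def)
  obtain q \<delta> where d2: "plane_drawing (V2, E2) q \<delta>"
    using 2 by (auto simp: planar_def)
  interpret G1: plane_graph V1 E1 p1 \<gamma>1
    using 1 d1 by unfold_locales
  interpret G2: plane_graph V2 E2 q \<delta>
    using 2 d2 by unfold_locales
  have "bounded (G1.drawing E1)"
    unfolding G1.drawing_def G1.curves_def using G1.finite_V G1.finite_E G1.arc_edge
    by (auto simp: finite_imp_bounded arc_imp_path bounded_path_image)
  moreover have "bounded (G2.drawing E2)"
    unfolding G2.drawing_def G2.curves_def using G2.finite_V G2.finite_E G2.arc_edge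
    by (auto simp: finite_imp_bounded arc_imp_path bounded_path_image)
  ultimately have "bounded (G1.drawing E1 \<union> G2.drawing E2)" by simp
  then obtain r where r: "\<And>x. x \<in> G1.drawing E1 \<union> G2.drawing E2 \<Longrightarrow> norm x < r"
    by (metis bounded_pos_less)
  \<comment> \<open>Both drawings lie in the open disc of radius |r| around 0, so a shift by twice
    that radius makes them disjoint.\<close>
  define c where "c = complex_of_real (2 * \<bar>r\<bar>)"
  define p2 \<gamma>2 where "p2 = (+) c \<circ> q" and "\<gamma>2 = (\<lambda>e. (+) c \<circ> \<delta> e)"
  have d3: "plane_drawing (V2, E2) p2 \<gamma>2"
    unfolding p2_def \<gamma>2_def by (rule plane_drawing_translation[OF d2])
  interpret G3: plane_graph V2 E2 p2 \<gamma>2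
    using 2 d3 by unfold_locales
  have D3: "G3.drawing E2 = (+) c ` G2.drawing E2"
    unfolding G3.drawing_def G2.drawing_def G3.curves_def G2.curves_def
    by (simp add: p2_def \<gamma>2_def path_image_compose image_Un image_UN image_comp)
  have DD: "G1.drawing E1 \<inter> G3.drawing E2 = {}"
  proof -
    have False if x: "x \<in> G1.drawing E1" "y \<in> G2.drawing E2" "x = c + y" for x y
    proof -
      have "norm c = norm (x - y)" using x(3) by simp
      also have "\<dots> \<le> norm x + norm y" by (rule norm_triangle_ineq4)
      also have "\<dots> < 2 * \<bar>r\<bar>" using r[of x] r[of y] x(1,2) by simp
      finally show False by (simp add: c_def)
    qed
    then show ?thesis unfolding D3 by blast
  qed
  have sub: "p1 ` V1 \<subseteq> G1.drawing E1" "p2 ` V2 \<subseteq> G3.drawing E2"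
    by (auto simp: G1.drawing_def G3.drawing_def)
  have sub1: "path_image (\<gamma>1 e) \<subseteq> G1.drawing E1" if "e \<in> E1" for e
    using that by (auto simp: G1.drawing_def G1.curves_def)
  have sub2: "path_image (\<gamma>2 e) \<subseteq> G3.drawing E2" if "e \<in> E2" for e
    using that by (auto simp: G3.drawing_def G3.curves_def)
  \<comment> \<open>Edges are nonempty and \<open>V1\<close>, \<open>V2\<close> are disjoint, so the
    test \<open>e \<subseteq> V1\<close> tells the edges of the two graphs apart.\<close>
  define p \<gamma> where "p = (\<lambda>v. if v \<in> V1 then p1 v else p2 v)"
    and "\<gamma> = (\<lambda>e. if e \<subseteq> V1 then \<gamma>1 e else \<gamma>2 e)"
  have e1: "\<gamma> e = \<gamma>1 e" "e \<subseteq> V1" "p ` e = p1 ` e" if "e \<in> E1" for e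
  proof -
    show s: "e \<subseteq> V1" using G1.edge_subset[OF that] .
    then show "\<gamma> e = \<gamma>1 e" by (simp add: \<gamma>_def)
    show "p ` e = p1 ` e" using s by (intro image_cong) (auto simp: p_def)
  qed
  have e2: "\<gamma> e = \<gamma>2 e" "e \<subseteq> V2" "p ` e = p2 ` e" if "e \<in> E2" for e
  proof -
    show s: "e \<subseteq> V2" using G2.edge_subset[OF that] .
    have "e \<noteq> {}" using G2.card_edge[OF that] by auto
    then have "\<not> e \<subseteq> V1" using s disj by blast
    then show "\<gamma> e = \<gamma>2 e" by (simp add: \<gamma>_def)
    show "p ` e = p2 ` e" using s disj by (intro image_cong) (auto simp: p_def)
  qed
  have pV: "p ` (V1 \<union> V2) = p1 ` V1 \<union> p2 ` V2"
  proof -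
    have "p ` V1 = p1 ` V1" by (intro image_cong) (auto simp: p_def)
    moreover have "p ` V2 = p2 ` V2" using disj by (intro image_cong) (auto simp: p_def)
    ultimately show ?thesis by (simp add: image_Un)
  qed
  have "plane_drawing (V1 \<union> V2, E1 \<union> E2) p \<gamma>"
    unfolding plane_drawing_def fst_conv snd_conv
  proof (intro conjI ballI impI)
    have "inj_on p V1"
      using G1.inj_p by (rule inj_on_cong[THEN iffD1, rotated]) (simp add: p_def)
    moreover have "inj_on p V2"
      using G3.inj_p by (rule inj_on_cong[THEN iffD1, rotated]) (use disj in \<open>auto simp: p_def\<close>)
    moreover have "p ` (V1 - V2) \<inter> p ` (V2 - V1) = {}"
    proof -
      have "p ` (V1 - V2) \<subseteq> p1 ` V1" "p ` (V2 - V1) \<subseteq> p2 ` V2" by (auto simp: p_def)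
      then show ?thesis using sub DD by blast
    qed
    ultimately show "inj_on p (V1 \<union> V2)" by (simp add: inj_on_Un)
  next
    fix e assume e: "e \<in> E1 \<union> E2"
    show "arc (\<gamma> e)"
      using e e1(1) e2(1) G1.arc_edge G3.arc_edge by auto
    show "{pathstart (\<gamma> e), pathfinish (\<gamma> e)} = p ` e"
    proof (cases "e \<in> E1")
      case True
      then show ?thesis using G1.edge_ends e1 by simp
    next
      case False
      then have "e \<in> E2" using e by simp
      then show ?thesis using G3.edge_ends e2 by simp
    qed
    show "path_image (\<gamma> e) \<inter> p ` (V1 \<union> V2) = p ` e"
    proof (cases "e \<in> E1")
      case True
      have "path_image (\<gamma>1 e) \<inter> p2 ` V2 = {}" using sub1[OF True] sub(2) DD by blast
      then show ?thesis
        using G1.edge_Int_verts[OF True] by (simp add: e1[OF True] pV Int_Un_distrib)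
    next
      case False
      then have e': "e \<in> E2" using e by simp
      have "path_image (\<gamma>2 e) \<inter> p1 ` V1 = {}" using sub2[OF e'] sub(1) DD by blast
      then show ?thesis
        using G3.edge_Int_verts[OF e'] by (simp add: e2[OF e'] pV Int_Un_distrib)
    qed
    fix f assume f: "f \<in> E1 \<union> E2" and ne: "e \<noteq> f"
    have mixed: "path_image (\<gamma>1 a) \<inter> path_image (\<gamma>2 b) = {}" "a \<inter> b = {}" if "a \<in> E1" "b \<in> E2" for a b
      using sub1[OF that(1)] sub2[OF that(2)] DD e1(2)[OF that(1)] e2(2)[OF that(2)] disj by blast+
    consider "e \<in> E1" "f \<in> E1" | "e \<in> E2" "f \<in> E2" | "e \<in> E1" "f \<in> E2" | "e \<in> E2" "f \<in> E1"
      using e f by blast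
    then show "path_image (\<gamma> e) \<inter> path_image (\<gamma> f) = p ` (e \<inter> f)"
    proof cases
      case 1
      have "p ` (e \<inter> f) = p1 ` (e \<inter> f)"
        using e1(2)[OF 1(1)] by (intro image_cong) (auto simp: p_def)
      then show ?thesis using G1.edge_Int_edge[OF 1 ne] by (simp add: e1(1) 1)
    next
      case 2
      have "p ` (e \<inter> f) = p2 ` (e \<inter> f)"
        using e2(2)[OF 2(1)] disj by (intro image_cong) (auto simp: p_def)
      then show ?thesis using G3.edge_Int_edge[OF 2 ne] by (simp add: e2(1) 2)
    next
      case 3
      then show ?thesis using mixed[OF 3] by (simp add: e1(1) e2(1))
    next
      case 4
      then show ?thesis using mixed[OF 4(2,1)] by (simp add: e1(1) e2(1) Int_commute)
    qed
  qed
  then show ?thesis by (auto simp: planar_def)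
qed

section \<open>Straight-line drawings and barycentric coordinates\<close>

text \<open>The convex hull of the two ends is the segment between them, without a choice of
  direction.\<close>

definition straight_drawing :: "nat set \<Rightarrow> nat set set \<Rightarrow> (nat \<Rightarrow> complex) \<Rightarrow> bool" where
  "straight_drawing V E p \<longleftrightarrow> inj_on p V \<and> (\<forall>e\<in>E. convex hull (p ` e) \<inter> p ` V = p ` e) \<and>
    (\<forall>e\<in>E. \<forall>f\<in>E. e \<noteq> f \<longrightarrow> convex hull (p ` e) \<inter> convex hull (p ` f) = p ` (e \<inter> f))"

lemma planar_straight_drawing:
  assumes "straight_drawing V E p" "simple_graph (V, E)"
  shows "planar (V, E)"
proof -
  \<comment> \<open>Vertices are numbers here, so an edge can be directed from its smaller to its
    larger end.\<close>
  define \<gamma> where "\<gamma> = (\<lambda>e. linepath (p (Min e)) (p (Max e)))"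
  have *: "arc (\<gamma> e) \<and> {pathstart (\<gamma> e), pathfinish (\<gamma> e)} = p ` e \<and> path_image (\<gamma> e) = convex hull (p ` e)"
    if "e \<in> E" for e
  proof -
    have "card e = 2" "e \<subseteq> V" using assms(2) that by (auto simp: simple_graph_def)
    then obtain u v where uv: "e = {u, v}" "u < v"
      by (metis card_2_iff insert_commute linorder_neqE_nat)
    then have "Min e = u" "Max e = v" by auto
    moreover have "p u \<noteq> p v"
      using assms(1) \<open>e \<subseteq> V\<close> uv by (auto simp: straight_drawing_def inj_on_def)
    ultimately show ?thesis
      using uv by (auto simp: \<gamma>_def segment_convex_hull arc_linepath)
  qed
  have "plane_drawing (V, E) p \<gamma>"
    using assms(1) * by (simp add: plane_drawing_def straight_drawing_def)
  then show ?thesis by (auto simp: planar_def)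
qed

text \<open>Adding the centroid \<open>w\<close> of a triangle: in barycentric coordinates the three new triangles are the
  regions where a given coordinate is the strict minimum, and on the new segments two coordinates agree.\<close>

definition bary :: "complex \<Rightarrow> complex \<Rightarrow> complex \<Rightarrow> real \<Rightarrow> real \<Rightarrow> real \<Rightarrow> complex" where
  "bary a b c x y z = x *\<^sub>R a + y *\<^sub>R b + z *\<^sub>R c"

text \<open>Affine independence, in the form that makes barycentric coordinates unique.\<close>

definition nondegenerate :: "complex \<Rightarrow> complex \<Rightarrow> complex \<Rightarrow> bool" where
  "nondegenerate a b c \<longleftrightarrow> (\<forall>x y z. x + y + z = 0 \<and> bary a b c x y z = 0 \<longrightarrow> x = 0 \<and> y = 0 \<and> z = 0)"

definition open_triangle :: "complex \<Rightarrow> complex \<Rightarrow> complex \<Rightarrow> complex set" where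
  "open_triangle a b c = {bary a b c x y z | x y z. 0 < x \<and> 0 < y \<and> 0 < z \<and> x + y + z = 1}"

lemma bary_eqD:
  assumes "nondegenerate a b c" "bary a b c x y z = bary a b c x' y' z'" "x + y + z = 1" "x' + y' + z' = 1"
  shows "x = x'" "y = y'" "z = z'"
proof -
  have "bary a b c (x - x') (y - y') (z - z') = 0"
    using assms(2) by (simp add: bary_def algebra_simps)
  moreover have "(x - x') + (y - y') + (z - z') = 0"
    using assms(3,4) by simp
  ultimately have "x - x' = 0 \<and> y - y' = 0 \<and> z - z' = 0"
    using assms(1) unfolding nondegenerate_def by blast
  then show "x = x'" "y = y'" "z = z'" by auto
qed

locale split_triangle =
  fixes a b c w :: complex
  assumes nd: "nondegenerate a b c" and w: "w = bary a b c (1/3) (1/3) (1/3)"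
begin

lemma segment_a: "u \<in> closed_segment a w \<Longrightarrow> \<exists>x y z. u = bary a b c x y z \<and> x + y + z = 1 \<and> y = z \<and> z \<le> x \<and> 0 \<le> z"
  and segment_b: "u \<in> closed_segment b w \<Longrightarrow> \<exists>x y z. u = bary a b c x y z \<and> x + y + z = 1 \<and> x = z \<and> z \<le> y \<and> 0 \<le> z"
  and segment_c: "u \<in> closed_segment c w \<Longrightarrow> \<exists>x y z. u = bary a b c x y z \<and> x + y + z = 1 \<and> x = y \<and> y \<le> z \<and> 0 \<le> y"
proof -
  show "\<exists>x y z. u = bary a b c x y z \<and> x + y + z = 1 \<and> y = z \<and> z \<le> x \<and> 0 \<le> z" if u: "u \<in> closed_segment a w"
  proof -
    obtain s where s: "0 \<le> s" "s \<le> 1" "u = (1 - s) *\<^sub>R a + s *\<^sub>R w"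
      using u by (auto simp: in_segment)
    have "u = bary a b c (1 - s + s/3) (s/3) (s/3)"
      unfolding s(3) by (simp add: w bary_def scaleR_conv_of_real field_simps)
    then show ?thesis
      using s(1,2) by - (rule exI[of _ "1 - s + s/3"], rule exI[of _ "s/3"], rule exI[of _ "s/3"], auto)
  qed
  show "\<exists>x y z. u = bary a b c x y z \<and> x + y + z = 1 \<and> x = z \<and> z \<le> y \<and> 0 \<le> z" if u: "u \<in> closed_segment b w"
  proof -
    obtain s where s: "0 \<le> s" "s \<le> 1" "u = (1 - s) *\<^sub>R b + s *\<^sub>R w"
      using u by (auto simp: in_segment)
    have "u = bary a b c (s/3) (1 - s + s/3) (s/3)"
      unfolding s(3) by (simp add: w bary_def scaleR_conv_of_real field_simps)
    then show ?thesis
      using s(1,2) by - (rule exI[of _ "s/3"], rule exI[of _ "1 - s + s/3"], rule exI[of _ "s/3"], auto)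
  qed
  show "\<exists>x y z. u = bary a b c x y z \<and> x + y + z = 1 \<and> x = y \<and> y \<le> z \<and> 0 \<le> y" if u: "u \<in> closed_segment c w"
  proof -
    obtain s where s: "0 \<le> s" "s \<le> 1" "u = (1 - s) *\<^sub>R c + s *\<^sub>R w"
      using u by (auto simp: in_segment)
    have "u = bary a b c (s/3) (s/3) (1 - s + s/3)"
      unfolding s(3) by (simp add: w bary_def scaleR_conv_of_real field_simps)
    then show ?thesis
      using s(1,2) by - (rule exI[of _ "s/3"], rule exI[of _ "s/3"], rule exI[of _ "1 - s + s/3"], auto)
  qed
qed

lemma bary_abw: "bary a b w x y z = bary a b c (x + z/3) (y + z/3) (z/3)"
  and bary_acw: "bary a c w x y z = bary a b c (x + z/3) (z/3) (y + z/3)"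
  and bary_bcw: "bary b c w x y z = bary a b c (z/3) (x + z/3) (y + z/3)"
  by (auto simp: w bary_def algebra_simps)

lemma triangle_abw: "u \<in> open_triangle a b w \<Longrightarrow> \<exists>x y z. u = bary a b c x y z \<and> x + y + z = 1 \<and> 0 < z \<and> z < x \<and> z < y"
  and triangle_acw: "u \<in> open_triangle a c w \<Longrightarrow> \<exists>x y z. u = bary a b c x y z \<and> x + y + z = 1 \<and> 0 < y \<and> y < x \<and> y < z"
  and triangle_bcw: "u \<in> open_triangle b c w \<Longrightarrow> \<exists>x y z. u = bary a b c x y z \<and> x + y + z = 1 \<and> 0 < x \<and> x < y \<and> x < z"
proof -
  show "\<exists>x y z. u = bary a b c x y z \<and> x + y + z = 1 \<and> 0 < z \<and> z < x \<and> z < y" if u: "u \<in> open_triangle a b w"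
  proof -
    obtain x y z where "u = bary a b w x y z" "0 < x" "0 < y" "0 < z" "x + y + z = 1"
      using u by (auto simp: open_triangle_def)
    then show ?thesis unfolding bary_abw
      by - (rule exI[of _ "x + z/3"], rule exI[of _ "y + z/3"], rule exI[of _ "z/3"], auto)
  qed
  show "\<exists>x y z. u = bary a b c x y z \<and> x + y + z = 1 \<and> 0 < y \<and> y < x \<and> y < z" if u: "u \<in> open_triangle a c w"
  proof -
    obtain x y z where "u = bary a c w x y z" "0 < x" "0 < y" "0 < z" "x + y + z = 1"
      using u by (auto simp: open_triangle_def)
    then show ?thesis unfolding bary_acw
      by - (rule exI[of _ "x + z/3"], rule exI[of _ "z/3"], rule exI[of _ "y + z/3"], auto)
  qed
  show "\<exists>x y z. u = bary a b c x y z \<and> x + y + z = 1 \<and> 0 < x \<and> x < y \<and> x < z" if u: "u \<in> open_triangle b c w"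
  proof -
    obtain x y z where "u = bary b c w x y z" "0 < x" "0 < y" "0 < z" "x + y + z = 1"
      using u by (auto simp: open_triangle_def)
    then show ?thesis unfolding bary_bcw
      by - (rule exI[of _ "z/3"], rule exI[of _ "x + z/3"], rule exI[of _ "y + z/3"], auto)
  qed
qed

lemma nondegenerate_parts: "nondegenerate a b w" "nondegenerate a c w" "nondegenerate b c w"
proof -
  have *: "x = 0 \<and> y = 0 \<and> z = 0" if "x + y + z = 0" "bary a b c x y z = 0" for x y z
    using nd that unfolding nondegenerate_def by blast
  show "nondegenerate a b w"
    unfolding nondegenerate_def bary_abw
  proof (intro allI impI, elim conjE)
    fix x y z :: real assume "x + y + z = 0" "bary a b c (x + z/3) (y + z/3) (z/3) = 0"
    then show "x = 0 \<and> y = 0 \<and> z = 0" using *[of "x + z/3" "y + z/3" "z/3"] by auto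
  qed
  show "nondegenerate a c w"
    unfolding nondegenerate_def bary_acw
  proof (intro allI impI, elim conjE)
    fix x y z :: real assume "x + y + z = 0" "bary a b c (x + z/3) (z/3) (y + z/3) = 0"
    then show "x = 0 \<and> y = 0 \<and> z = 0" using *[of "x + z/3" "z/3" "y + z/3"] by auto
  qed
  show "nondegenerate b c w"
    unfolding nondegenerate_def bary_bcw
  proof (intro allI impI, elim conjE)
    fix x y z :: real assume "x + y + z = 0" "bary a b c (z/3) (x + z/3) (y + z/3) = 0"
    then show "x = 0 \<and> y = 0 \<and> z = 0" using *[of "z/3" "x + z/3" "y + z/3"] by auto
  qed
qed

lemma open_triangleI: "u = bary a b c x y z \<Longrightarrow> x + y + z = 1 \<Longrightarrow> 0 < x \<Longrightarrow> 0 < y \<Longrightarrow> 0 < z \<Longrightarrow> u \<in> open_triangle a b c"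
  by (auto simp: open_triangle_def)

lemma parts_subset:
  "open_triangle a b w \<subseteq> open_triangle a b c" "open_triangle a c w \<subseteq> open_triangle a b c"
  "open_triangle b c w \<subseteq> open_triangle a b c"
  using triangle_abw triangle_acw triangle_bcw open_triangleI by (meson order.strict_trans subsetI)+

lemma segments_subset:
  "closed_segment a w \<subseteq> insert a (open_triangle a b c)"
  "closed_segment b w \<subseteq> insert b (open_triangle a b c)"
  "closed_segment c w \<subseteq> insert c (open_triangle a b c)"
proof -
  show "closed_segment a w \<subseteq> insert a (open_triangle a b c)"
  proof
    fix u assume "u \<in> closed_segment a w"
    then obtain x y z where xyz: "u = bary a b c x y z" "x + y + z = 1" "y = z" "z \<le> x" "0 \<le> z"
      using segment_a by blast
    show "u \<in> insert a (open_triangle a b c)"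
    proof (cases "z = 0")
      case True
      then show ?thesis using xyz by (simp add: bary_def)
    next
      case False
      then show ?thesis using xyz open_triangleI[of u x y z] by auto
    qed
  qed
  show "closed_segment b w \<subseteq> insert b (open_triangle a b c)"
  proof
    fix u assume "u \<in> closed_segment b w"
    then obtain x y z where xyz: "u = bary a b c x y z" "x + y + z = 1" "x = z" "z \<le> y" "0 \<le> z"
      using segment_b by blast
    show "u \<in> insert b (open_triangle a b c)"
    proof (cases "z = 0")
      case True
      then show ?thesis using xyz by (simp add: bary_def)
    next
      case False
      then show ?thesis using xyz open_triangleI[of u x y z] by auto
    qed
  qed
  show "closed_segment c w \<subseteq> insert c (open_triangle a b c)"
  proof
    fix u assume "u \<in> closed_segment c w"
    then obtain x y z where xyz: "u = bary a b c x y z" "x + y + z = 1" "x = y" "y \<le> z" "0 \<le> y"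
      using segment_c by blast
    show "u \<in> insert c (open_triangle a b c)"
    proof (cases "y = 0")
      case True
      then show ?thesis using xyz by (simp add: bary_def)
    next
      case False
      then show ?thesis using xyz open_triangleI[of u x y z] by auto
    qed
  qed
qed

text \<open>Barycentric coordinates are unique, so disjointness of two regions reduces to
  incompatible linear conditions on the same triple.\<close>

lemma disjointI:
  assumes "\<And>u. u \<in> S \<Longrightarrow> \<exists>x y z. u = bary a b c x y z \<and> x + y + z = 1 \<and> P x y z"
    and "\<And>u. u \<in> T \<Longrightarrow> \<exists>x y z. u = bary a b c x y z \<and> x + y + z = 1 \<and> Q x y z"
    and "\<And>x y z. x + y + z = 1 \<Longrightarrow> P x y z \<Longrightarrow> Q x y z \<Longrightarrow> False"
  shows "S \<inter> T = {}"
proof -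
  have False if u: "u \<in> S" "u \<in> T" for u
  proof -
    obtain x y z where 1: "u = bary a b c x y z" "x + y + z = 1" "P x y z"
      using assms(1)[OF u(1)] by blast
    obtain x' y' z' where 2: "u = bary a b c x' y' z'" "x' + y' + z' = 1" "Q x' y' z'"
      using assms(2)[OF u(2)] by blast
    have "x = x'" "y = y'" "z = z'"
      using bary_eqD[OF nd _ 1(2) 2(2)] 1(1) 2(1) by auto
    then show False using assms(3) 1 2 by blast
  qed
  then show ?thesis by blast
qed

lemma parts_disjoint:
  "open_triangle a b w \<inter> open_triangle a c w = {}"
  "open_triangle a b w \<inter> open_triangle b c w = {}"
  "open_triangle a c w \<inter> open_triangle b c w = {}"
  by (rule disjointI[OF triangle_abw triangle_acw], assumption+, linarith)
    (rule disjointI[OF triangle_abw triangle_bcw], assumption+, linarith,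
     rule disjointI[OF triangle_acw triangle_bcw], assumption+, linarith)

lemma parts_segments_disjoint:
  "open_triangle a b w \<inter> closed_segment a w = {}" "open_triangle a b w \<inter> closed_segment b w = {}"
  "open_triangle a b w \<inter> closed_segment c w = {}"
  "open_triangle a c w \<inter> closed_segment a w = {}" "open_triangle a c w \<inter> closed_segment b w = {}"
  "open_triangle a c w \<inter> closed_segment c w = {}"
  "open_triangle b c w \<inter> closed_segment a w = {}" "open_triangle b c w \<inter> closed_segment b w = {}"
  "open_triangle b c w \<inter> closed_segment c w = {}"
  by (rule disjointI[OF triangle_abw segment_a], assumption+, linarith,
      rule disjointI[OF triangle_abw segment_b], assumption+, linarith,
      rule disjointI[OF triangle_abw segment_c], assumption+, linarith,
      rule disjointI[OF triangle_acw segment_a], assumption+, linarith,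
      rule disjointI[OF triangle_acw segment_b], assumption+, linarith,
      rule disjointI[OF triangle_acw segment_c], assumption+, linarith,
      rule disjointI[OF triangle_bcw segment_a], assumption+, linarith,
      rule disjointI[OF triangle_bcw segment_b], assumption+, linarith,
      rule disjointI[OF triangle_bcw segment_c], assumption+, linarith)

lemma segments_Int:
  "closed_segment a w \<inter> closed_segment b w = {w}"
  "closed_segment a w \<inter> closed_segment c w = {w}"
  "closed_segment b w \<inter> closed_segment c w = {w}"
proof -
  have w': "u = w" if "u = bary a b c x y z" "x + y + z = 1" "x = y" "y = z" for u x y z
  proof -
    have xyz: "x = 1/3" "y = 1/3" "z = 1/3" using that(2-4) by auto
    show ?thesis unfolding that(1) w xyz ..
  qed
  \<comment> \<open>All three coordinates agree only at \<open>w\<close>. Removing \<open>w\<close>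
    from one segment therefore makes its condition incompatible with that of the other.\<close>
  have "(closed_segment a w - {w}) \<inter> (closed_segment b w) = {}"
  proof (rule disjointI[OF _ segment_b])
    show "\<exists>x y z. u = bary a b c x y z \<and> x + y + z = 1 \<and> (y = z \<and> x \<noteq> z)" if "u \<in> closed_segment a w - {w}" for u
      using that segment_a[of u] w'[of u] by blast
  qed auto
  then show "closed_segment a w \<inter> closed_segment b w = {w}" by auto
  have "(closed_segment a w - {w}) \<inter> (closed_segment c w) = {}"
  proof (rule disjointI[OF _ segment_c])
    show "\<exists>x y z. u = bary a b c x y z \<and> x + y + z = 1 \<and> (y = z \<and> x \<noteq> z)" if "u \<in> closed_segment a w - {w}" for u
      using that segment_a[of u] w'[of u] by blast
  qed auto
  then show "closed_segment a w \<inter> closed_segment c w = {w}" by auto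
  have "(closed_segment b w - {w}) \<inter> (closed_segment c w) = {}"
  proof (rule disjointI[OF _ segment_c])
    show "\<exists>x y z. u = bary a b c x y z \<and> x + y + z = 1 \<and> (x = z \<and> y \<noteq> z)" if "u \<in> closed_segment b w - {w}" for u
      using that segment_b[of u] w'[of u] by blast
  qed auto
  then show "closed_segment b w \<inter> closed_segment c w = {w}" by auto
qed

end

section \<open>Stacked triangulations and their straight-line drawings\<close>

text \<open>\<open>stacked N E F\<close>: the triangulation with vertices \<open>{..<N}\<close> and edges \<open>E\<close> arises from a triangle by
  placing new vertices in inner faces; the current inner faces are the triples in \<open>F\<close>.\<close>

inductive stacked :: "nat \<Rightarrow> nat set set \<Rightarrow> (nat \<times> nat \<times> nat) set \<Rightarrow> bool" where
  base: "stacked 3 {{0, 1}, {0, 2}, {1, 2}} {(0, 1, 2)}"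
| step: "stacked N E F \<Longrightarrow> (i, j, k) \<in> F \<Longrightarrow>
    stacked (Suc N) (E \<union> {{i, N}, {j, N}, {k, N}}) (F - {(i, j, k)} \<union> {(i, j, N), (i, k, N), (j, k, N)})"

text \<open>A new vertex is the largest number so far and stands last in its triples, so triples
  stay sorted and \<open>N\<close> occurs in none of the old ones.\<close>

lemma stacked_triple: "stacked N E F \<Longrightarrow> (i, j, k) \<in> F \<Longrightarrow> i < j \<and> j < k \<and> k < N"
  by (induction arbitrary: i j k rule: stacked.induct) (auto, fastforce+)

text \<open>Every insertion adds one vertex and three edges, all of which contain the new vertex and
  hence are new; this preserves 3 N - 6.\<close>

lemma stacked_simple: "stacked N E F \<Longrightarrow> simple_graph ({..<N}, E) \<and> card E + 6 = 3 * N \<and> finite E"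
proof (induction rule: stacked.induct)
  case base
  show ?case by (auto simp: simple_graph_def card_insert_if doubleton_eq_iff)
next
  case (step N E F i j k)
  have ijk: "i < j" "j < k" "k < N" using stacked_triple[OF step(1,2)] by auto
  have E: "\<And>e. e \<in> E \<Longrightarrow> e \<subseteq> {..<N} \<and> card e = 2" and f: "finite E" and c: "card E + 6 = 3 * N"
    using step.IH by (auto simp: simple_graph_def)
  have "E \<inter> {{i, N}, {j, N}, {k, N}} = {}" using E by fastforce
  then have "card (E \<union> {{i, N}, {j, N}, {k, N}}) = card E + 3"
    using f ijk by (subst card_Un_disjoint) (auto simp: card_insert_if doubleton_eq_iff)
  moreover have "e \<subseteq> {..<Suc N} \<and> card e = 2" if "e \<in> E \<union> {{i, N}, {j, N}, {k, N}}" for e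
    using that ijk E[of e] by (auto simp: card_insert_if less_Suc_eq)
  ultimately show ?case
    using f c by (simp add: simple_graph_def)
qed

definition segments_drawing :: "nat set \<Rightarrow> nat set set \<Rightarrow> (nat \<Rightarrow> complex) \<Rightarrow> complex set" where
  "segments_drawing V E p = p ` V \<union> (\<Union>e\<in>E. convex hull (p ` e))"

definition triangle_at :: "(nat \<Rightarrow> complex) \<Rightarrow> nat \<times> nat \<times> nat \<Rightarrow> complex set" where
  "triangle_at p = (\<lambda>(i, j, k). open_triangle (p i) (p j) (p k))"

text \<open>A straight drawing alone is too weak for the induction. Each current face must also be
  an empty nondegenerate triangle, disjoint from the other faces: then a vertex at the centroid of
  one face, with its three segments, disturbs neither the drawing nor another face.\<close>

lemma straight_drawing_stacked:
  assumes "stacked N E F"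
  shows "\<exists>p. straight_drawing {..<N} E p \<and> (\<forall>t\<in>F. triangle_at p t \<inter> segments_drawing {..<N} E p = {}) \<and>
    (\<forall>(i, j, k)\<in>F. nondegenerate (p i) (p j) (p k)) \<and> disjoint_family_on (triangle_at p) F"
  using assms
proof (induction rule: stacked.induct)
  case base
  define p :: "nat \<Rightarrow> complex" where "p = (\<lambda>i. if i = 0 then 0 else if i = 1 then 1 else \<i>)"
  have p: "p 0 = 0" "p 1 = 1" "p 2 = \<i>" "p (Suc 0) = 1" by (auto simp: p_def)
  have V: "{..<3} = {0, 1, 2 :: nat}" by auto
  have nd: "nondegenerate 0 1 \<i>"
    by (auto simp: nondegenerate_def bary_def complex_eq_iff)
  have seg: "closed_segment 0 1 = {bary 0 1 \<i> x y 0 | x y. 0 \<le> x \<and> 0 \<le> y \<and> x + y = 1}"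
    "closed_segment 0 \<i> = {bary 0 1 \<i> x 0 z | x z. 0 \<le> x \<and> 0 \<le> z \<and> x + z = 1}"
    "closed_segment 1 \<i> = {bary 0 1 \<i> 0 y z | y z. 0 \<le> y \<and> 0 \<le> z \<and> y + z = 1}"
    unfolding segment_convex_hull convex_hull_2 bary_def by auto
  have pts: "0 = bary 0 1 \<i> 1 0 0" "1 = bary 0 1 \<i> 0 1 0" "\<i> = bary 0 1 \<i> 0 0 1"
    by (auto simp: bary_def)
  have D: "segments_drawing {..<3} {{0, 1}, {0, 2}, {1, 2}} p
      = closed_segment 0 1 \<union> closed_segment 0 \<i> \<union> closed_segment 1 \<i>"
    unfolding segments_drawing_def V by (auto simp: p segment_convex_hull[symmetric])
  have I: "closed_segment 0 1 \<inter> closed_segment 0 \<i> = {0}" "closed_segment 0 1 \<inter> closed_segment 1 \<i> = {1}"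
    "closed_segment 0 \<i> \<inter> closed_segment 1 \<i> = {\<i>}" "\<i> \<notin> closed_segment 0 1" "1 \<notin> closed_segment 0 \<i>"
    "0 \<notin> closed_segment 1 \<i>"
    unfolding seg by (auto simp: bary_def complex_eq_iff)
  have "straight_drawing {..<3} {{0, 1}, {0, 2}, {1, 2}} p"
    unfolding straight_drawing_def V
    using I by (auto simp: p segment_convex_hull[symmetric] doubleton_eq_iff Int_commute)
  moreover have "open_triangle 0 1 \<i> \<inter> (closed_segment 0 1 \<union> closed_segment 0 \<i> \<union> closed_segment 1 \<i>) = {}"
    unfolding seg open_triangle_def by (auto simp: bary_def complex_eq_iff)
  ultimately show ?case
    using nd by (intro exI[of _ p] conjI) (simp_all only: D, simp_all add: triangle_at_def p disjoint_family_on_def)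
next
  case (step N E F i j k)
  then obtain p where p: "straight_drawing {..<N} E p"
      "\<forall>t\<in>F. triangle_at p t \<inter> segments_drawing {..<N} E p = {}"
      "\<forall>(i, j, k)\<in>F. nondegenerate (p i) (p j) (p k)" "disjoint_family_on (triangle_at p) F"
    by blast
  have ijk: "i < j" "j < k" "k < N" using stacked_triple[OF step(1,2)] by auto
  have sE: "e \<subseteq> {..<N}" if "e \<in> E" for e
    using stacked_simple[OF step(1)] that by (auto simp: simple_graph_def)
  define w where "w = bary (p i) (p j) (p k) (1/3) (1/3) (1/3)"
  define p' where "p' = p(N := w)"
  interpret split_triangle "p i" "p j" "p k" w
    using p(3) step(2) by unfold_locales (auto simp: w_def)
  define D where "D = segments_drawing {..<N} E p"
  define Tr where "Tr = open_triangle (p i) (p j) (p k)"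
  have TD: "Tr \<inter> D = {}"
    using p(2) step(2) by (auto simp: triangle_at_def Tr_def D_def)
  have w_O: "w \<in> Tr"
    unfolding Tr_def by (rule open_triangleI[OF w_def]) auto
  have p': "p' v = p v" if "v < N" for v using that by (simp add: p'_def)
  have p'N: "p' N = w" by (simp add: p'_def)
  have p'e: "p' ` e = p ` e" if "e \<subseteq> {..<N}" for e
    using that p' by (intro image_cong) auto
  have VD: "p ` {..<N} \<subseteq> D" and ED: "\<And>e. e \<in> E \<Longrightarrow> convex hull (p ` e) \<subseteq> D"
    by (auto simp: D_def segments_drawing_def)
  have inj: "inj_on p {..<N}" using p(1) by (simp add: straight_drawing_def)
  have seg: "closed_segment (p a) w \<subseteq> insert (p a) Tr" "convex hull (p' ` {a, N}) = closed_segment (p a) w" "a < N"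
    if "a \<in> {i, j, k}" for a
  proof -
    show "closed_segment (p a) w \<subseteq> insert (p a) Tr" using that segments_subset unfolding Tr_def by auto
    show aN: "a < N" using that ijk by auto
    then show "convex hull (p' ` {a, N}) = closed_segment (p a) w"
      by (simp add: segment_convex_hull p'N p')
  qed
  have V': "{..<Suc N} = insert N {..<N}" by auto
  have p'V: "p' ` {..<Suc N} = insert w (p ` {..<N})"
    unfolding V' image_insert p'N by (simp add: p'e)
  \<comment> \<open>Apart from its corner \<open>p a\<close>, a new segment runs inside the empty
    triangle \<open>Tr\<close>, so it can meet a part of the old drawing only in that
    corner.\<close>
  have sO: "closed_segment (p a) w \<inter> X = {p a} \<inter> X" if "a \<in> {i, j, k}" "X \<subseteq> D" for a X
  proof -
    have "Tr \<inter> X = {}" using TD that(2) by blast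
    moreover have "p a \<in> closed_segment (p a) w" by simp
    ultimately show ?thesis using seg(1)[OF that(1)] by blast
  qed
  have new: "\<exists>a\<in>{i, j, k}. e = {a, N}" if "e \<in> {{i, N}, {j, N}, {k, N}}" for e
    using that by auto
  have old_new: "convex hull (p' ` e) \<inter> convex hull (p' ` {a, N}) = p' ` (e \<inter> {a, N})"
    if "e \<in> E" "a \<in> {i, j, k}" for e a
  proof -
    have aN: "a < N" using seg(3)[OF that(2)] .
    have eN: "N \<notin> e" using sE[OF that(1)] by auto
    have "convex hull (p' ` e) \<inter> convex hull (p' ` {a, N}) = {p a} \<inter> convex hull (p ` e)"
      unfolding seg(2)[OF that(2)] p'e[OF sE[OF that(1)]]
      using sO[OF that(2) ED[OF that(1)]] by (simp add: Int_commute)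
    also have "\<dots> = {p a} \<inter> p ` e"
    proof -
      have "convex hull (p ` e) \<inter> p ` {..<N} = p ` e"
        using p(1) that(1) by (simp add: straight_drawing_def)
      moreover have "p a \<in> p ` {..<N}" using aN by simp
      ultimately show ?thesis by blast
    qed
    also have "\<dots> = p ` (e \<inter> {a})"
      using inj_on_image_Int[OF inj, of e "{a}"] sE[OF that(1)] aN by (simp add: Int_commute)
    also have "e \<inter> {a} = e \<inter> {a, N}" using eN by auto
    also have "p ` (e \<inter> {a, N}) = p' ` (e \<inter> {a, N})"
      using sE[OF that(1)] by (intro p'e[symmetric]) auto
    finally show ?thesis .
  qed
  have new_new: "convex hull (p' ` {a, N}) \<inter> convex hull (p' ` {b, N}) = p' ` ({a, N} \<inter> {b, N})"
    if "a \<in> {i, j, k}" "b \<in> {i, j, k}" "a \<noteq> b" for a b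
  proof -
    have "closed_segment (p a) w \<inter> closed_segment (p b) w = {w}"
      using that segments_Int by (auto simp: Int_commute)
    moreover have "{a, N} \<inter> {b, N} = {N}" using that(3) seg(3) that(1,2) by auto
    ultimately show ?thesis
      unfolding seg(2)[OF that(1)] seg(2)[OF that(2)] by (simp add: p'N)
  qed
  have straight: "straight_drawing {..<Suc N} (E \<union> {{i, N}, {j, N}, {k, N}}) p'"
    unfolding straight_drawing_def
  proof (intro conjI ballI impI)
    have "w \<notin> p ` {..<N}" using w_O TD VD by blast
    moreover have "inj_on p' {..<N}" using inj by (rule inj_on_cong[THEN iffD1, rotated]) (simp add: p')
    moreover have "p' ` {..<N} = p ` {..<N}" by (rule p'e) simp
    ultimately show "inj_on p' {..<Suc N}"
      unfolding V' by (simp add: p'N)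
  next
    fix e assume e: "e \<in> E \<union> {{i, N}, {j, N}, {k, N}}"
    show "convex hull (p' ` e) \<inter> p' ` {..<Suc N} = p' ` e"
    proof (cases "e \<in> E")
      case True
      have "convex hull (p ` e) \<inter> p ` {..<N} = p ` e"
        using p(1) True by (simp add: straight_drawing_def)
      moreover have "w \<notin> convex hull (p ` e)" using w_O TD ED[OF True] by blast
      ultimately show ?thesis
        unfolding p'V p'e[OF sE[OF True]] by simp
    next
      case False
      then obtain a where a: "a \<in> {i, j, k}" "e = {a, N}" using e new by blast
      have "closed_segment (p a) w \<inter> p ` {..<N} = {p a}"
        using sO[OF a(1) VD] seg(3)[OF a(1)] by auto
      then show ?thesis
        unfolding p'V a(2) seg(2)[OF a(1)] using seg(3)[OF a(1)] by (auto simp: p'N p')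
    qed
    fix f assume f: "f \<in> E \<union> {{i, N}, {j, N}, {k, N}}" and ne: "e \<noteq> f"
    show "convex hull (p' ` e) \<inter> convex hull (p' ` f) = p' ` (e \<inter> f)"
    proof (cases "e \<in> E")
      case eE: True
      show ?thesis
      proof (cases "f \<in> E")
        case True
        have "convex hull (p ` e) \<inter> convex hull (p ` f) = p ` (e \<inter> f)"
          using p(1) eE True ne by (simp add: straight_drawing_def)
        moreover have "p' ` (e \<inter> f) = p ` (e \<inter> f)" using sE[OF eE] by (intro p'e) auto
        ultimately show ?thesis
          by (simp add: p'e sE eE True)
      next
        case False
        then obtain b where b: "b \<in> {i, j, k}" "f = {b, N}" using f new by blast
        show ?thesis unfolding b(2) by (rule old_new[OF eE b(1)])
      qed
    next
      case eE: False
      then obtain a where a: "a \<in> {i, j, k}" "e = {a, N}" using e new by blast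
      show ?thesis
      proof (cases "f \<in> E")
        case True
        show ?thesis unfolding a(2) using old_new[OF True a(1)] by (simp only: Int_commute)
      next
        case False
        then obtain b where b: "b \<in> {i, j, k}" "f = {b, N}" using f new by blast
        have "a \<noteq> b" using ne a b by auto
        then show ?thesis unfolding a(2) b(2) by (rule new_new[OF a(1) b(1)])
      qed
    qed
  qed
  have D': "segments_drawing {..<Suc N} (E \<union> {{i, N}, {j, N}, {k, N}}) p'
      = D \<union> closed_segment (p i) w \<union> closed_segment (p j) w \<union> closed_segment (p k) w"
  proof -
    have "(\<Union>e\<in>E. convex hull (p' ` e)) = (\<Union>e\<in>E. convex hull (p ` e))"
      by (intro SUP_cong) (auto simp: p'e sE)
    then show ?thesis
      unfolding segments_drawing_def p'V D_def UN_Un using seg(2)[of i] seg(2)[of j] seg(2)[of k] by auto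
  qed
  have old_t: "triangle_at p' t = triangle_at p t" if "t \<in> F" for t
  proof -
    obtain x y z where t: "t = (x, y, z)" by (cases t)
    then have "x < N" "y < N" "z < N" using stacked_triple[OF step(1)] that by fastforce+
    then show ?thesis by (simp add: t triangle_at_def p')
  qed
  have new_t: "triangle_at p' (i, j, N) = open_triangle (p i) (p j) w"
      "triangle_at p' (i, k, N) = open_triangle (p i) (p k) w"
      "triangle_at p' (j, k, N) = open_triangle (p j) (p k) w"
    using ijk by (auto simp: triangle_at_def p' p'N)
  have old_O: "triangle_at p t \<inter> Tr = {}" if "t \<in> F - {(i, j, k)}" for t
  proof -
    have "Tr = triangle_at p (i, j, k)" by (simp add: Tr_def triangle_at_def)
    then show ?thesis
      using p(4) step(2) that disjoint_family_onD[OF p(4), of t "(i, j, k)"] by simp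
  qed
  have old_D: "triangle_at p t \<inter> D = {}" if "t \<in> F" for t
    using p(2) that by (auto simp: D_def)
  let ?F = "F - {(i, j, k)} \<union> {(i, j, N), (i, k, N), (j, k, N)}"
  have sub_O: "triangle_at p' t \<subseteq> Tr" if "t \<in> {(i, j, N), (i, k, N), (j, k, N)}" for t
    using that parts_subset new_t by (auto simp: Tr_def)
  have "\<forall>t\<in>?F. triangle_at p' t \<inter> (D \<union> closed_segment (p i) w \<union> closed_segment (p j) w \<union> closed_segment (p k) w) = {}"
  proof
    fix t assume t: "t \<in> ?F"
    show "triangle_at p' t \<inter> (D \<union> closed_segment (p i) w \<union> closed_segment (p j) w \<union> closed_segment (p k) w) = {}"
    proof (cases "t \<in> F - {(i, j, k)}")
      case True
      have "p i \<in> D" "p j \<in> D" "p k \<in> D" using VD ijk by auto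
      then have "closed_segment (p i) w \<union> closed_segment (p j) w \<union> closed_segment (p k) w \<subseteq> Tr \<union> D"
        using seg(1)[of i] seg(1)[of j] seg(1)[of k] by blast
      then show ?thesis
        using True old_t[of t] old_O[OF True] old_D[of t] by blast
    next
      case False
      then have t': "t \<in> {(i, j, N), (i, k, N), (j, k, N)}" using t by blast
      have "triangle_at p' t \<inter> D = {}" using sub_O[OF t'] TD by blast
      moreover have "triangle_at p' t \<inter> closed_segment (p i) w = {}" "triangle_at p' t \<inter> closed_segment (p j) w = {}"
        "triangle_at p' t \<inter> closed_segment (p k) w = {}"
        using t' new_t parts_segments_disjoint by auto
      ultimately show ?thesis by (simp add: Int_Un_distrib)
    qed
  qed
  then have tri: "\<forall>t\<in>?F. triangle_at p' t \<inter>
      segments_drawing {..<Suc N} (E \<union> {{i, N}, {j, N}, {k, N}}) p' = {}"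
    by (simp only: D')
  have nondeg: "\<forall>(x, y, z)\<in>?F. nondegenerate (p' x) (p' y) (p' z)"
  proof -
    have "nondegenerate (p' x) (p' y) (p' z)" if "(x, y, z) \<in> ?F" for x y z
    proof (cases "(x, y, z) \<in> F")
      case True
      then have "x < N" "y < N" "z < N" using stacked_triple[OF step(1) True] by auto
      then show ?thesis using p(3) True by (auto simp: p')
    next
      case False
      then show ?thesis
        using that ijk nondegenerate_parts by (auto simp: p' p'N)
    qed
    then show ?thesis by blast
  qed
  have disj: "disjoint_family_on (triangle_at p') ?F"
    unfolding disjoint_family_on_def
  proof (intro ballI impI)
    fix s t assume st: "s \<in> ?F" "t \<in> ?F" "s \<noteq> t"
    consider "s \<in> F - {(i, j, k)}" "t \<in> F - {(i, j, k)}"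
      | "s \<in> F - {(i, j, k)}" "t \<in> {(i, j, N), (i, k, N), (j, k, N)}"
      | "t \<in> F - {(i, j, k)}" "s \<in> {(i, j, N), (i, k, N), (j, k, N)}"
      | "s \<in> {(i, j, N), (i, k, N), (j, k, N)}" "t \<in> {(i, j, N), (i, k, N), (j, k, N)}"
      using st by blast
    then show "triangle_at p' s \<inter> triangle_at p' t = {}"
    proof cases
      case 1
      then show ?thesis using p(4) st(3) old_t[of s] old_t[of t] by (auto simp: disjoint_family_on_def)
    next
      case 2
      then show ?thesis using old_t[of s] old_O[of s] sub_O[of t] by blast
    next
      case 3
      then show ?thesis using old_t[of t] old_O[of t] sub_O[of s] by blast
    next
      case 4
      then show ?thesis using st(3) new_t parts_disjoint by (auto simp: Int_commute)
    qed
  qed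
  show ?case
    by (intro exI[of _ p'] conjI straight tri nondeg disj)
qed

lemma planar_stacked:
  assumes "stacked N E F"
  shows "planar ({..<N}, E)"
proof -
  obtain p where "straight_drawing {..<N} E p"
    using straight_drawing_stacked[OF assms] by (elim exE conjE)
  then show ?thesis
    using stacked_simple[OF assms] planar_straight_drawing by simp
qed

subsection \<open>Dense planar graphs without two disjoint cycles\<close>

text \<open>An index map makes rotations explicit, and an embedding of \<open>cycle k\<close> is
  such a map directly.\<close>

definition is_cycle :: "'a set set \<Rightarrow> nat \<Rightarrow> (nat \<Rightarrow> 'a) \<Rightarrow> bool" where
  "is_cycle E k c \<longleftrightarrow> inj_on c {..<k} \<and> (\<forall>i<k. {c i, c (Suc i mod k)} \<in> E)"

definition two_disjoint_cycles :: "'a set set \<Rightarrow> nat \<Rightarrow> bool" where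
  "two_disjoint_cycles E k \<longleftrightarrow> (\<exists>c d. is_cycle E k c \<and> is_cycle E k d \<and> c ` {..<k} \<inter> d ` {..<k} = {})"

lemma is_cycle_mono: "is_cycle E k c \<Longrightarrow> E \<subseteq> E' \<Longrightarrow> is_cycle E' k c"
  by (auto simp: is_cycle_def)

lemma card_is_cycle: "is_cycle E k c \<Longrightarrow> card (c ` {..<k}) = k"
  by (simp add: is_cycle_def card_image)

lemma add_mod_image: "0 < k \<Longrightarrow> (\<lambda>i. (i + m) mod k) ` {..<k} = {..<k :: nat}"
proof -
  assume k: "0 < k"
  have le: "i = j" if "i \<le> j" "j < k" "(j + m) mod k = (i + m) mod k" for i j
  proof -
    have "k dvd (j + m) - (i + m)"
      using that(3) mod_eq_dvd_iff_nat[of "i + m" "j + m" k] that(1) by simp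
    then have "k dvd j - i" by simp
    then have "j - i = 0" using dvd_imp_le[of k "j - i"] that(2) by linarith
    then show ?thesis using that(1) by simp
  qed
  have "i = j" if "i < k" "j < k" "(i + m) mod k = (j + m) mod k" for i j
  proof (cases "i \<le> j")
    case True
    show ?thesis by (rule le[OF True that(2) that(3)[symmetric]])
  next
    case False
    then have "j \<le> i" by simp
    then show ?thesis using le[OF _ that(1,3)] by simp
  qed
  then have "inj_on (\<lambda>i. (i + m) mod k) {..<k}"
    unfolding inj_on_def by blast
  moreover have "(\<lambda>i. (i + m) mod k) ` {..<k} \<subseteq> {..<k}"
    using k by auto
  ultimately show ?thesis
    by (intro endo_inj_surj) auto
qed

text \<open>Allows any chosen vertex of a cycle to get index 0.\<close>

lemma is_cycle_rotate:
  assumes "is_cycle E k c" "0 < k"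
  shows "is_cycle E k (\<lambda>i. c ((i + m) mod k))" "(\<lambda>i. c ((i + m) mod k)) ` {..<k} = c ` {..<k}"
proof -
  have im: "(\<lambda>i. (i + m) mod k) ` {..<k} = {..<k}"
    by (rule add_mod_image[OF assms(2)])
  show im': "(\<lambda>i. c ((i + m) mod k)) ` {..<k} = c ` {..<k}"
    using image_image[of c "\<lambda>i. (i + m) mod k" "{..<k}"] im by simp
  have "inj_on (\<lambda>i. c ((i + m) mod k)) {..<k}"
    using im' card_is_cycle[OF assms(1)] by (intro eq_card_imp_inj_on) auto
  moreover have "{c ((i + m) mod k), c ((Suc i mod k + m) mod k)} \<in> E" for i
  proof -
    have "(Suc i mod k + m) mod k = Suc ((i + m) mod k) mod k"
      by (simp add: mod_simps)
    then show ?thesis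
      using assms by (simp add: is_cycle_def)
  qed
  ultimately show "is_cycle E k (\<lambda>i. c ((i + m) mod k))"
    by (simp add: is_cycle_def)
qed

text \<open>The cycle as a permutation of its vertices, for counting arguments. The last property
  says that the two neighbours of a vertex on the cycle differ, which needs
  \<open>3 \<le> k\<close>.\<close>

lemma is_cycle_successor:
  assumes "is_cycle E k c" "3 \<le> k"
  obtains s where "bij_betw s (c ` {..<k}) (c ` {..<k})"
    "\<And>v. v \<in> c ` {..<k} \<Longrightarrow> {v, s v} \<in> E" "\<And>v. v \<in> c ` {..<k} \<Longrightarrow> s (s v) \<noteq> v"
proof -
  have inj: "inj_on c {..<k}" and E: "\<And>i. i < k \<Longrightarrow> {c i, c (Suc i mod k)} \<in> E"
    using assms(1) by (auto simp: is_cycle_def)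
  define s where "s = (\<lambda>v. c (Suc (inv_into {..<k} c v) mod k))"
  have s: "s (c i) = c (Suc i mod k)" if "i < k" for i
    using inj that by (simp add: s_def)
  have "(\<lambda>i. Suc i mod k) ` {..<k} = {..<k}"
    using add_mod_image[of k 1] assms(2) by simp
  then have "c ` {..<k} = (\<lambda>i. c (Suc i mod k)) ` {..<k}"
    using image_image[of c "\<lambda>i. Suc i mod k" "{..<k}"] by simp
  moreover have "s ` c ` {..<k} = (\<lambda>i. c (Suc i mod k)) ` {..<k}"
    unfolding image_image using s by (intro image_cong) auto
  ultimately have "s ` c ` {..<k} = c ` {..<k}"
    by simp
  then have "bij_betw s (c ` {..<k}) (c ` {..<k})"
    by (simp add: bij_betw_def eq_card_imp_inj_on)
  moreover have "{v, s v} \<in> E" if "v \<in> c ` {..<k}" for v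
    using that E s by auto
  moreover have "s (s v) \<noteq> v" if v: "v \<in> c ` {..<k}" for v
  proof -
    obtain i where i: "i < k" "v = c i" using v by auto
    have "Suc (Suc i mod k) mod k \<noteq> i" "Suc (Suc i mod k) mod k < k" "Suc i mod k < k"
      using assms(2) i(1) by (auto simp: mod_Suc)
    then show ?thesis
      using i s inj by (auto simp: inj_on_def)
  qed
  ultimately show thesis using that by blast
qed

section \<open>The double fan and its cuts\<close>

lemma card_multiples_le: "0 < d \<Longrightarrow> card {m \<in> {1..n}. d dvd m} \<le> n div (d::nat)"
proof -
  assume d: "0 < d"
  have "{m \<in> {1..n}. d dvd m} \<subseteq> (\<lambda>q. d * q) ` {1..n div d}"
  proof
    fix m assume "m \<in> {m \<in> {1..n}. d dvd m}"
    then obtain q where q: "m = d * q" "1 \<le> m" "m \<le> n" by auto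
    then have "q \<le> n div d" "1 \<le> q"
      using d by (auto simp: less_eq_div_iff_mult_less_eq mult.commute Suc_le_eq)
    then show "m \<in> (\<lambda>q. d * q) ` {1..n div d}" using q by auto
  qed
  then have "card {m \<in> {1..n}. d dvd m} \<le> card ((\<lambda>q. d * q) ` {1..n div d})"
    by (intro card_mono) auto
  also have "\<dots> \<le> n div d"
    using card_image_le[of "{1..n div d}" "\<lambda>q. d * q"] by simp
  finally show ?thesis .
qed

text \<open>\<open>double_fan N\<close> is the join of the edge \<open>{0, 1}\<close> and the path \<open>2, \<dots>, N - 1\<close>;
  \<open>cut_double_fan d N\<close> cuts this path into segments of \<open>d\<close> vertices.\<close>

definition double_fan :: "nat \<Rightarrow> nat set set" where
  "double_fan N = {{0, 1}} \<union> {{i, j} | i j. i < 2 \<and> 2 \<le> j \<and> j < N} \<union> {{j, Suc j} | j. 2 \<le> j \<and> Suc j < N}"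

definition cut_double_fan :: "nat \<Rightarrow> nat \<Rightarrow> nat set set" where
  "cut_double_fan d N = double_fan N - {{j, Suc j} | j. 2 \<le> j \<and> Suc j < N \<and> d dvd j - 1}"

lemma double_fanI:
  "{0, 1} \<in> double_fan N" "i < 2 \<Longrightarrow> 2 \<le> j \<Longrightarrow> j < N \<Longrightarrow> {i, j} \<in> double_fan N"
  "2 \<le> j \<Longrightarrow> Suc j < N \<Longrightarrow> {j, Suc j} \<in> double_fan N"
  unfolding double_fan_def by blast+

text \<open>Each new path vertex \<open>N\<close> goes into the face of 0, 1 and
  \<open>N - 1\<close>, which creates the face of 0, 1 and \<open>N\<close> for the next
  one.\<close>

lemma stacked_double_fan: "3 \<le> N \<Longrightarrow> \<exists>F. stacked N (double_fan N) F \<and> (0, 1, N - 1) \<in> F"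
proof (induction N rule: dec_induct)
  case base
  have "double_fan 3 = {{0, 1}, {0, 2}, {1, 2}}"
  proof
    show "double_fan 3 \<subseteq> {{0, 1}, {0, 2}, {1, 2}}"
      by (auto simp: double_fan_def less_Suc_eq numeral_eq_Suc)
    show "{{0, 1}, {0, 2}, {1, 2}} \<subseteq> double_fan 3"
      using double_fanI(1)[of 3] double_fanI(2)[of 0 2 3] double_fanI(2)[of 1 2 3] by simp
  qed
  then show ?case using stacked.base by auto
next
  case (step N)
  then obtain F where F: "stacked N (double_fan N) F" "(0, 1, N - 1) \<in> F" by blast
  have "double_fan (Suc N) = double_fan N \<union> {{0, N}, {1, N}, {N - 1, N}}"
  proof
    show "double_fan (Suc N) \<subseteq> double_fan N \<union> {{0, N}, {1, N}, {N - 1, N}}"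
    proof
      fix e assume "e \<in> double_fan (Suc N)"
      then consider "e = {0, 1}" | i j where "e = {i, j}" "i < 2" "2 \<le> j" "j < Suc N"
        | j where "e = {j, Suc j}" "2 \<le> j" "Suc j < Suc N"
        unfolding double_fan_def by blast
      then show "e \<in> double_fan N \<union> {{0, N}, {1, N}, {N - 1, N}}"
      proof cases
        case 1
        then show ?thesis using double_fanI(1) by blast
      next
        case 2
        then show ?thesis using double_fanI(2)[of i j N] by (cases "j = N"; cases "i = 0") auto
      next
        case 3
        then show ?thesis using double_fanI(3)[of j N] by (cases "Suc j = N") auto
      qed
    qed
    have "double_fan N \<subseteq> double_fan (Suc N)"
      unfolding double_fan_def by (intro Un_mono Collect_mono impI) (auto intro: less_SucI)
    then show "double_fan N \<union> {{0, N}, {1, N}, {N - 1, N}} \<subseteq> double_fan (Suc N)"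
      using double_fanI(2)[of 0 N "Suc N"] double_fanI(2)[of 1 N "Suc N"] double_fanI(3)[of "N - 1" "Suc N"] step(1)
      by simp
  qed
  then show ?case
    using stacked.step[OF F] by auto
qed

lemma card_cut_double_fan:
  assumes "3 \<le> N" "0 < d"
  shows "3 * N \<le> card (cut_double_fan d N) + (N - 3) div d + 6"
proof -
  define B where "B = {{j, Suc j} | j. 2 \<le> j \<and> Suc j < N \<and> d dvd j - 1}"
  obtain F where "stacked N (double_fan N) F" using stacked_double_fan[OF assms(1)] by blast
  then have c: "card (double_fan N) + 6 = 3 * N" using stacked_simple by blast
  \<comment> \<open>The path edges are numbered by \<open>m = j - 1\<close>, running from 1 to
    \<open>N - 3\<close>; the cut ones are the multiples of \<open>d\<close>.\<close>
  have "B \<subseteq> (\<lambda>m. {Suc m, Suc (Suc m)}) ` {m \<in> {1..N - 3}. d dvd m}"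
  proof
    fix e assume "e \<in> B"
    then obtain j where j: "e = {j, Suc j}" "2 \<le> j" "Suc j < N" "d dvd j - 1" by (auto simp: B_def)
    then have "e = (\<lambda>m. {Suc m, Suc (Suc m)}) (j - 1)" "j - 1 \<in> {m \<in> {1..N - 3}. d dvd m}" by auto
    then show "e \<in> (\<lambda>m. {Suc m, Suc (Suc m)}) ` {m \<in> {1..N - 3}. d dvd m}" by blast
  qed
  then have fB: "finite B" and "card B \<le> card ((\<lambda>m. {Suc m, Suc (Suc m)}) ` {m \<in> {1..N - 3}. d dvd m})"
    by (auto intro: finite_subset card_mono)
  moreover have "card ((\<lambda>m. {Suc m, Suc (Suc m)}) ` {m \<in> {1..N - 3}. d dvd m}) \<le> card {m \<in> {1..N - 3}. d dvd m}"
    by (rule card_image_le) simp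
  ultimately have "card B \<le> (N - 3) div d"
    using card_multiples_le[OF assms(2), of "N - 3"] by linarith
  moreover have "card (double_fan N) - card B \<le> card (double_fan N - B)"
    using fB by (rule diff_card_le_card_Diff)
  ultimately show ?thesis
    using c unfolding cut_double_fan_def B_def[symmetric] by linarith
qed

text \<open>The path starts at 2, so \<open>(j - 2) div d\<close> is the number of the segment that
  contains \<open>j\<close>. It changes from \<open>j\<close> to \<open>Suc j\<close> exactly when
  \<open>d\<close> divides \<open>j - 1\<close>, and those edges are cut.\<close>

lemma cut_double_fan_path_edge:
  assumes "{x, y} \<in> cut_double_fan d N" "2 \<le> x" "2 \<le> y"
  shows "(x - 2) div d = (y - 2) div d"
proof -
  have *: "(j - 2) div d = (Suc j - 2) div d" if "\<not> d dvd j - 1" "2 \<le> j" for j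
  proof -
    have "Suc j - 2 = Suc (j - 2)" "j - 1 = Suc (j - 2)" using that(2) by auto
    then show ?thesis using that(1) by (simp add: div_Suc dvd_eq_mod_eq_0)
  qed
  have "{x, y} \<in> double_fan N" using assms(1) by (simp add: cut_double_fan_def)
  then obtain j where j: "{x, y} = {j, Suc j}" "2 \<le> j" "Suc j < N"
    using assms(2,3) by (auto simp: double_fan_def doubleton_eq_iff)
  then have "\<not> d dvd j - 1"
    using assms(1) unfolding cut_double_fan_def by blast
  then show ?thesis using *[OF _ j(2)] j(1) by (auto simp: doubleton_eq_iff)
qed

text \<open>Rotate a cycle that misses \<open>a\<close> so that \<open>b\<close>, if it occurs, gets
  index 0. The vertices at the other \<open>k - 1\<close> indices are consecutive path vertices, so
  they lie in a single segment, which has only \<open>k - 2\<close> places. The assumption on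
  \<open>{a, b}\<close> covers both hubs at once.\<close>

lemma cut_double_fan_cycle:
  assumes c: "is_cycle (cut_double_fan (k - 2) N) k c" and k: "3 \<le> k" and ab: "{a, b} = {0, 1}"
  shows "a \<in> c ` {..<k}"
proof (rule ccontr)
  let ?E = "cut_double_fan (k - 2) N"
  assume a: "a \<notin> c ` {..<k}"
  have "\<exists>c'. is_cycle ?E k c' \<and> a \<notin> c' ` {..<k} \<and> (\<forall>i. 1 \<le> i \<and> i < k \<longrightarrow> c' i \<noteq> b)"
  proof (cases "b \<in> c ` {..<k}")
    case True
    then obtain m where m: "m < k" "b = c m" by auto
    define c' where "c' = (\<lambda>i. c ((i + m) mod k))"
    have c': "is_cycle ?E k c'" "c' ` {..<k} = c ` {..<k}"
      unfolding c'_def using is_cycle_rotate[OF c] k by auto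
    have "c' 0 = b" using m by (simp add: c'_def)
    moreover have "inj_on c' {..<k}" using c' by (simp add: is_cycle_def)
    ultimately have "c' i \<noteq> b" if "1 \<le> i" "i < k" for i
      using that inj_onD[of c' "{..<k}" i 0] by auto
    then show ?thesis using c' a by blast
  next
    case False
    then show ?thesis using c a by (intro exI[of _ c]) auto
  qed
  then obtain c' where c': "is_cycle ?E k c'" "a \<notin> c' ` {..<k}" "\<And>i. 1 \<le> i \<Longrightarrow> i < k \<Longrightarrow> c' i \<noteq> b"
    by blast
  have ge2: "2 \<le> c' i" if "1 \<le> i" "i < k" for i
  proof -
    have "c' i \<noteq> a" "c' i \<noteq> b" using c'(2,3) that by auto
    then have "c' i \<notin> {0, 1}" using ab by blast
    then show ?thesis by auto
  qed
  define \<beta> where "\<beta> = (c' 1 - 2) div (k - 2)"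
  have same: "(c' i - 2) div (k - 2) = \<beta>" if "1 \<le> i" "i < k" for i
    using that
  proof (induction i rule: dec_induct)
    case (step i)
    have "Suc i mod k = Suc i" "i < k" using step by auto
    then have "{c' i, c' (Suc i)} \<in> ?E"
      using c'(1) unfolding is_cycle_def by metis
    then have "(c' i - 2) div (k - 2) = (c' (Suc i) - 2) div (k - 2)"
      using step ge2 by (intro cut_double_fan_path_edge) auto
    then show ?case using step by simp
  qed (simp add: \<beta>_def)
  have "c' ` {1..<k} \<subseteq> {2 + \<beta> * (k - 2)..<2 + \<beta> * (k - 2) + (k - 2)}"
  proof
    fix x assume "x \<in> c' ` {1..<k}"
    then have x: "2 \<le> x" "(x - 2) div (k - 2) = \<beta>" using ge2 same by auto
    have "x - 2 = \<beta> * (k - 2) + (x - 2) mod (k - 2)" using x(2) by (metis div_mult_mod_eq)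
    moreover have "(x - 2) mod (k - 2) < k - 2" using k by simp
    ultimately show "x \<in> {2 + \<beta> * (k - 2)..<2 + \<beta> * (k - 2) + (k - 2)}" using x(1) by auto
  qed
  then have "card (c' ` {1..<k}) \<le> k - 2"
    using card_mono[of "{2 + \<beta> * (k - 2)..<2 + \<beta> * (k - 2) + (k - 2)}" "c' ` {1..<k}"] by simp
  moreover have "inj_on c' {1..<k}"
    using c'(1) unfolding is_cycle_def by (auto intro: inj_on_subset)
  ultimately show False
    using k by (simp add: card_image)
qed

lemma planar_two_cycle_free:
  assumes "3 \<le> k" "3 \<le> N"
  obtains E where "simple_graph ({..<N}, E)" "planar ({..<N}, E)" "\<not> two_disjoint_cycles E k"
    "3 * N \<le> card E + (N - 3) div (k - 2) + 6"
proof -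
  let ?E = "cut_double_fan (k - 2) N"
  obtain F where F: "stacked N (double_fan N) F" using stacked_double_fan[OF assms(2)] by blast
  have s: "simple_graph ({..<N}, double_fan N)" and p: "planar ({..<N}, double_fan N)"
    using stacked_simple[OF F] planar_stacked[OF F] by auto
  have sub: "?E \<subseteq> double_fan N" by (auto simp: cut_double_fan_def)
  have s': "simple_graph ({..<N}, ?E)"
    using s sub by (auto simp: simple_graph_def)
  have "planar ({..<N}, ?E)"
    by (rule planar_subgraph[OF p order_refl sub]) (use s' in \<open>simp add: simple_graph_def\<close>)
  moreover have "\<not> two_disjoint_cycles ?E k"
    using cut_double_fan_cycle[OF _ assms(1), of N _ 0 1] unfolding two_disjoint_cycles_def by blast
  ultimately show thesis
    using that s' card_cut_double_fan[of N "k - 2"] assms by auto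
qed

section \<open>Triangulations on 2k vertices for k at least 5\<close>

text \<open>The stacked triangulations below contain five independent vertices \<open>0, 6, 7, 8, 9\<close> whose
  neighbours lie in \<open>{1, \<dots>, 5}\<close>.\<close>

lemma stacked_independent_10:
  "\<exists>E F. stacked 10 E F \<and> (2, 3, 4) \<in> F \<and> (\<forall>a\<in>{0, 6, 7, 8, 9}. \<forall>x. {a, x} \<in> E \<longrightarrow> x \<in> {1..5})"
proof -
  \<comment> \<open>The vertices 1 to 5 span the complete graph without the edge 35, a triangulation
    with the faces 123, 134, 234, 125, 145 and 245. The vertex 0 belongs to 123, and 6, 7, 8, 9 go
    into 125, 145, 245, 134. The face 234 stays free for all further vertices.\<close>
  note s3 = stacked.step[OF stacked.base, of 0 1 2, simplified]
  note s4 = stacked.step[OF s3, of 1 2 3, simplified]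
  note s5 = stacked.step[OF s4, of 1 2 4, simplified]
  note s6 = stacked.step[OF s5, of 1 2 5, simplified]
  note s7 = stacked.step[OF s6, of 1 4 5, simplified]
  note s8 = stacked.step[OF s7, of 2 4 5, simplified]
  note s9 = stacked.step[OF s8, of 1 3 4, simplified]
  show ?thesis
    by (rule exI, rule exI, rule conjI, rule s9) (auto simp: doubleton_eq_iff)
qed

text \<open>The vertex 10 goes into the face 234, and each later one into the face of 2, 3 and its
  predecessor. So the five independent vertices get no new neighbours, and 11 is the only later
  neighbour of 10.\<close>

lemma stacked_independent:
  assumes "10 \<le> N"
  obtains E F where "stacked N E F"
    "\<And>a x. a \<in> {0, 6, 7, 8, 9} \<Longrightarrow> {a, x} \<in> E \<Longrightarrow> x \<in> {1..5}"
    "\<And>x. {10, x} \<in> E \<Longrightarrow> x \<in> {2, 3, 4, 11}"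
proof -
  \<comment> \<open>The induction starts at 11 because only then is the newest vertex in a face with
    2 and 3: the vertex 9 was put into 134.\<close>
  have from_11: "\<exists>E F. stacked N E F \<and> (2, 3, N - 1) \<in> F \<and>
      (\<forall>a\<in>{0, 6, 7, 8, 9}. \<forall>x. {a, x} \<in> E \<longrightarrow> x \<in> {1..5}) \<and> (\<forall>x. {10, x} \<in> E \<longrightarrow> x \<in> {2, 3, 4, 11})"
    if "11 \<le> N" for N
    using that
  proof (induction N rule: dec_induct)
    case base
    obtain E F where EF: "stacked 10 E F" "(2, 3, 4) \<in> F"
      "\<forall>a\<in>{0, 6, 7, 8, 9}. \<forall>x. {a, x} \<in> E \<longrightarrow> x \<in> {1..5}"
      using stacked_independent_10 by (elim exE conjE) (rule that)
    have E10: "{10, x} \<notin> E" for x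
    proof
      assume "{10, x} \<in> E"
      then have "{10, x} \<subseteq> {..<10::nat}"
        using stacked_simple[OF EF(1)] unfolding simple_graph_def by fastforce
      then show False by simp
    qed
    have s: "stacked 11 (E \<union> {{2, 10}, {3, 10}, {4, 10}})
        (F - {(2, 3, 4)} \<union> {(2, 3, 10), (2, 4, 10), (3, 4, 10)})"
      using stacked.step[OF EF(1,2)] by simp
    have P1: "x \<in> {1..5}" if "a \<in> {0, 6, 7, 8, 9}" "{a, x} \<in> E \<union> {{2, 10}, {3, 10}, {4, 10}}" for a x
    proof (cases "{a, x} \<in> E")
      case True
      show ?thesis by (rule EF(3)[rule_format, OF that(1) True])
    next
      case False
      then show ?thesis using that by (auto simp: doubleton_eq_iff)
    qed
    have P2: "x \<in> {2, 3, 4, 11}" if "{10, x} \<in> E \<union> {{2, 10}, {3, 10}, {4, 10}}" for x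
      using that E10[of x] by (auto simp: doubleton_eq_iff)
    let ?E = "E \<union> {{2, 10}, {3, 10}, {4, 10}}"
    let ?F = "F - {(2, 3, 4)} \<union> {(2, 3, 10), (2, 4, 10), (3, 4, 10)}"
    have m: "(2, 3, 11 - 1) \<in> ?F" by simp
    show ?case
      by (rule exI[of _ ?E], rule exI[of _ ?F], intro conjI ballI allI impI, rule s, rule m,
          erule (1) P1, erule P2)
  next
    case (step N)
    then obtain E F where EF: "stacked N E F" "(2, 3, N - 1) \<in> F"
      "\<forall>a\<in>{0, 6, 7, 8, 9}. \<forall>x. {a, x} \<in> E \<longrightarrow> x \<in> {1..5}"
      "\<forall>x. {10, x} \<in> E \<longrightarrow> x \<in> {2, 3, 4, 11}"
      by (elim exE conjE) (rule that)
    let ?E = "E \<union> {{2, N}, {3, N}, {N - 1, N}}"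
    have P1: "x \<in> {1..5}" if "a \<in> {0, 6, 7, 8, 9}" "{a, x} \<in> ?E" for a x
    proof (cases "{a, x} \<in> E")
      case True
      show ?thesis by (rule EF(3)[rule_format, OF that(1) True])
    next
      case False
      then show ?thesis using that step(1) by (auto simp: doubleton_eq_iff)
    qed
    have P2: "x \<in> {2, 3, 4, 11}" if "{10, x} \<in> ?E" for x
    proof (cases "{10, x} \<in> E")
      case True
      show ?thesis by (rule EF(4)[rule_format, OF True])
    next
      case False
      then show ?thesis using that step(1) by (auto simp: doubleton_eq_iff)
    qed
    let ?F = "F - {(2, 3, N - 1)} \<union> {(2, 3, N), (2, N - 1, N), (3, N - 1, N)}"
    have s: "stacked (Suc N) ?E ?F" by (rule stacked.step[OF EF(1,2)])
    have m: "(2, 3, Suc N - 1) \<in> ?F" by simp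
    show ?case
      by (rule exI[of _ ?E], rule exI[of _ ?F], intro conjI ballI allI impI, rule s, rule m,
          erule (1) P1, erule P2)
  qed
  show thesis
  proof (cases "N = 10")
    case True
    obtain E F where EF0: "stacked 10 E F" "(2, 3, 4) \<in> F"
      "\<forall>a\<in>{0, 6, 7, 8, 9}. \<forall>x. {a, x} \<in> E \<longrightarrow> x \<in> {1..5}"
      using stacked_independent_10 by (elim exE conjE) (rule that)
    note EF = EF0(1,3)
    have "{10, x} \<notin> E" for x
    proof
      assume "{10, x} \<in> E"
      then have "{10, x} \<subseteq> {..<10::nat}"
        using stacked_simple[OF EF(1)] unfolding simple_graph_def by fastforce
      then show False by simp
    qed
    then have P2: "x \<in> {2, 3, 4, 11}" if "{10, x} \<in> E" for x
      using that by metis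
    show thesis
      by (rule that[OF _ EF(2)[rule_format] P2]) (use EF(1) True in simp)
  next
    case False
    then have "11 \<le> N" using assms by simp
    obtain E F where EF: "stacked N E F" "\<forall>a\<in>{0, 6, 7, 8, 9}. \<forall>x. {a, x} \<in> E \<longrightarrow> x \<in> {1..5}"
      "\<forall>x. {10, x} \<in> E \<longrightarrow> x \<in> {2, 3, 4, 11}"
      using from_11[OF \<open>11 \<le> N\<close>] by (elim exE conjE) (rule that)
    show thesis
      by (rule that[OF EF(1) EF(2)[rule_format] EF(3)[rule_format]])
  qed
qed

lemma two_factor_successor:
  assumes "is_cycle E k c" "is_cycle E k d" "c ` {..<k} \<inter> d ` {..<k} = {}" "3 \<le> k"
  obtains s where "bij_betw s (c ` {..<k}) (c ` {..<k})" "bij_betw s (d ` {..<k}) (d ` {..<k})"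
    "\<And>v. v \<in> c ` {..<k} \<union> d ` {..<k} \<Longrightarrow> {v, s v} \<in> E"
    "\<And>v. v \<in> c ` {..<k} \<union> d ` {..<k} \<Longrightarrow> s (s v) \<noteq> v"
proof -
  let ?C = "c ` {..<k}" and ?D = "d ` {..<k}"
  obtain s1 where s1: "bij_betw s1 ?C ?C" "\<And>v. v \<in> ?C \<Longrightarrow> {v, s1 v} \<in> E" "\<And>v. v \<in> ?C \<Longrightarrow> s1 (s1 v) \<noteq> v"
    using is_cycle_successor[OF assms(1,4)] by blast
  obtain s2 where s2: "bij_betw s2 ?D ?D" "\<And>v. v \<in> ?D \<Longrightarrow> {v, s2 v} \<in> E" "\<And>v. v \<in> ?D \<Longrightarrow> s2 (s2 v) \<noteq> v"
    using is_cycle_successor[OF assms(2,4)] by blast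
  define s where "s = (\<lambda>v. if v \<in> ?C then s1 v else s2 v)"
  have sC: "s v = s1 v" if "v \<in> ?C" for v using that by (simp add: s_def)
  have sD: "s v = s2 v" if "v \<in> ?D" for v
  proof -
    have "v \<notin> ?C" using that assms(3) by blast
    then show ?thesis by (simp add: s_def)
  qed
  have inC: "s1 v \<in> ?C" if "v \<in> ?C" for v using bij_betwE[OF s1(1)] that by blast
  have inD: "s2 v \<in> ?D" if "v \<in> ?D" for v using bij_betwE[OF s2(1)] that by blast
  show thesis
  proof (rule that[of s])
    show "bij_betw s ?C ?C" using s1(1) sC bij_betw_cong by metis
    show "bij_betw s ?D ?D" using s2(1) sD bij_betw_cong by metis
    fix v assume v: "v \<in> ?C \<union> ?D"
    show "{v, s v} \<in> E" using v sC sD s1(2) s2(2) by fastforce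
    show "s (s v) \<noteq> v"
    proof (cases "v \<in> ?C")
      case True
      then show ?thesis using sC inC s1(3) by simp
    next
      case False
      then have "v \<in> ?D" using v by blast
      then show ?thesis using sD inD s2(3) by simp
    qed
  qed
qed

text \<open>Two disjoint \<open>k\<close>-cycles would be a 2-factor. Following it in either direction maps the
  five independent vertices onto \<open>{1, \<dots>, 5}\<close>. For \<open>k = 5\<close> both cycles would then alternate
  between the two sets, and for \<open>k \<ge> 6\<close> both neighbours of \<open>10\<close> on its cycle would be \<open>11\<close>.\<close>

lemma no_two_cycles_independent:
  fixes E :: "nat set set"
  assumes k: "5 \<le> k" and E: "simple_graph ({..<2 * k}, E)"
    and A: "\<And>a x. a \<in> {0, 6, 7, 8, 9} \<Longrightarrow> {a, x} \<in> E \<Longrightarrow> x \<in> {1..5}"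
    and ten: "\<And>x. {10, x} \<in> E \<Longrightarrow> x \<in> {2, 3, 4, 11}"
  shows "\<not> two_disjoint_cycles E k"
proof
  assume "two_disjoint_cycles E k"
  then obtain c d where cd: "is_cycle E k c" "is_cycle E k d" "c ` {..<k} \<inter> d ` {..<k} = {}"
    by (auto simp: two_disjoint_cycles_def)
  define C D where "C = c ` {..<k}" and "D = d ` {..<k}"
  define A' S' where "A' = {0, 6, 7, 8, 9 :: nat}" and "S' = {1..5 :: nat}"
  have k3: "3 \<le> k" using k by simp
  obtain s where s: "bij_betw s C C" "bij_betw s D D" "\<And>v. v \<in> C \<union> D \<Longrightarrow> {v, s v} \<in> E"
    "\<And>v. v \<in> C \<union> D \<Longrightarrow> s (s v) \<noteq> v"
    using two_factor_successor[OF cd k3] unfolding C_def D_def by blast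
  have edge: "e \<subseteq> {..<2 * k}" if "e \<in> E" for e
    using E that by (simp add: simple_graph_def)
  have CD: "C \<inter> D = {}" using cd(3) by (simp add: C_def D_def)
  have fin: "finite C" "finite D" "card C = k" "card D = k"
    using card_is_cycle[OF cd(1)] card_is_cycle[OF cd(2)] by (auto simp: C_def D_def)
  have sub: "C \<union> D \<subseteq> {..<2 * k}"
    using s(3) edge by blast
  have all: "C \<union> D = {..<2 * k}"
    by (rule card_subset_eq[OF _ sub]) (use fin CD in \<open>auto simp: card_Un_disjoint\<close>)
  have bij: "bij_betw s (C \<union> D) (C \<union> D)"
    by (rule bij_betw_combine[OF s(1,2) CD])
  then have inj: "inj_on s (C \<union> D)" and img: "s ` (C \<union> D) = C \<union> D"
    by (auto simp: bij_betw_def)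
  have A'V: "A' \<subseteq> C \<union> D" and S'V: "S' \<subseteq> C \<union> D"
    unfolding all A'_def S'_def using k by auto
  have sA: "s a \<in> S'" if "a \<in> A'" for a
    using A[of a "s a"] s(3)[of a] that A'V unfolding A'_def S'_def by blast
  have cards: "card A' = 5" "card S' = 5" "finite A'" "finite S'"
    by (auto simp: A'_def S'_def)
  have "inj_on s A'" using inj A'V by (rule inj_on_subset)
  then have sA_eq: "s ` A' = S'"
    using sA cards by (intro card_subset_eq) (auto simp: card_image)
  have disj: "A' \<inter> S' = {}" by (auto simp: A'_def S'_def)
  show False
  proof (cases "k = 5")
    case True
    have V: "C \<union> D = A' \<union> S'"
      unfolding all True by (auto simp: A'_def S'_def)
    \<comment> \<open>On each cycle the successor map injects the members of \<open>A'\<close> into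
      those of \<open>S'\<close>. Both sets have five members in total, so the two numbers agree on
      each cycle, and a cycle on 5 vertices would have an even number of them.\<close>
    have le: "card (X \<inter> A') \<le> card (X \<inter> S')" if "bij_betw s X X" "finite X" "X \<subseteq> C \<union> D" for X
    proof (rule card_inj_on_le)
      show "inj_on s (X \<inter> A')" using inj that(3) by (auto intro: inj_on_subset)
      show "s ` (X \<inter> A') \<subseteq> X \<inter> S'" using sA bij_betwE[OF that(1)] by blast
    qed (use that in simp)
    have split: "card X = card (X \<inter> A') + card (X \<inter> S')" if "finite X" "X \<subseteq> A' \<union> S'" for X
    proof -
      have "X = X \<inter> A' \<union> X \<inter> S'" using that by blast
      moreover have "(X \<inter> A') \<inter> (X \<inter> S') = {}" using disj by blast
      ultimately show ?thesis using that(1) by (metis card_Un_disjoint finite_Int)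
    qed
    have tot: "card (C \<inter> Y) + card (D \<inter> Y) = card Y" if "Y \<subseteq> C \<union> D" for Y
    proof -
      have "Y = C \<inter> Y \<union> D \<inter> Y" using that by blast
      moreover have "(C \<inter> Y) \<inter> (D \<inter> Y) = {}" using CD by blast
      ultimately show ?thesis using fin(1,2) by (metis card_Un_disjoint finite_Int)
    qed
    have "card (C \<inter> A') \<le> card (C \<inter> S')" "card (D \<inter> A') \<le> card (D \<inter> S')"
      using le s(1,2) fin by auto
    moreover have "card (C \<inter> A') + card (D \<inter> A') = 5" "card (C \<inter> S') + card (D \<inter> S') = 5"
      using tot[OF A'V] tot[OF S'V] cards by auto
    moreover have "card (C \<inter> A') + card (C \<inter> S') = 5"
      using split[of C] V fin True by auto
    ultimately show False by presburger
  next
    case False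
    then have "10 \<in> C \<union> D" "10 \<notin> A'" "10 \<notin> S'" using k by (auto simp: all A'_def S'_def)
    have "s 10 \<notin> S'"
    proof
      assume "s 10 \<in> S'"
      then obtain a where "a \<in> A'" "s 10 = s a" using sA_eq by auto
      then have "10 = a" using inj_onD[OF inj, of 10 a] \<open>10 \<in> C \<union> D\<close> A'V by blast
      then show False using \<open>a \<in> A'\<close> \<open>10 \<notin> A'\<close> by simp
    qed
    moreover have "s 10 \<in> {2, 3, 4, 11}" using ten s(3)[OF \<open>10 \<in> C \<union> D\<close>] by blast
    ultimately have s10: "s 10 = 11" by (auto simp: S'_def)
    obtain v where v: "v \<in> C \<union> D" "s v = 10" using img \<open>10 \<in> C \<union> D\<close> by (metis imageE)
    have "v \<notin> S'"
    proof
      \<comment> \<open>\<open>t\<close> gives the predecessor on the cycle. By the same counting,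
        the predecessors of \<open>A'\<close> exhaust \<open>S'\<close>, so that of 10 lies
        elsewhere.\<close>
      define t where "t = inv_into (C \<union> D) s"
      have t: "t x \<in> C \<union> D" "s (t x) = x" if "x \<in> C \<union> D" for x
        using that img unfolding t_def by (metis inv_into_into, metis f_inv_into_f)
      have "t a \<in> S'" if a: "a \<in> A'" for a
      proof -
        have "a \<in> C \<union> D" using a A'V by blast
        then have "{t a, a} \<in> E" using s(3)[of "t a"] t[of a] by simp
        then have "{a, t a} \<in> E" by (simp add: insert_commute)
        then show ?thesis using A[of a "t a"] a unfolding A'_def S'_def by simp
      qed
      moreover have "inj_on t A'"
      proof (rule inj_onI)
        fix x y assume xy: "x \<in> A'" "y \<in> A'" "t x = t y"
        then have xy': "x \<in> C \<union> D" "y \<in> C \<union> D" using A'V by blast+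
        show "x = y" using t(2)[OF xy'(1)] t(2)[OF xy'(2)] unfolding xy(3) by metis
      qed
      ultimately have "t ` A' \<subseteq> S'" "card (t ` A') = card S'"
        using cards by (blast, simp add: card_image)
      then have tA: "t ` A' = S'"
        using cards(4) by (intro card_subset_eq)
      assume "v \<in> S'"
      then obtain a where a: "a \<in> A'" "v = t a" using tA by blast
      then have "a \<in> C \<union> D" using A'V by blast
      then have "a = 10" using t(2)[of a] a(2) v(2) by simp
      then show False using a \<open>10 \<notin> A'\<close> by simp
    qed
    moreover have "v \<in> {2, 3, 4, 11}"
      using ten[of v] s(3)[OF v(1)] v(2) by (simp add: insert_commute)
    ultimately have "v = 11" by (auto simp: S'_def)
    then show False using s(4)[OF \<open>10 \<in> C \<union> D\<close>] s10 v(2) by simp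
  qed
qed

lemma planar_triangulation_two_cycle_free:
  assumes "5 \<le> k"
  obtains E where "simple_graph ({..<2 * k}, E)" "planar ({..<2 * k}, E)" "\<not> two_disjoint_cycles E k"
    "card E + 6 = 6 * k"
proof -
  have "10 \<le> 2 * k" using assms by simp
  then show thesis
  proof (rule stacked_independent)
    fix E F assume E: "stacked (2 * k) E F"
      "\<And>a x. a \<in> {0, 6, 7, 8, 9} \<Longrightarrow> {a, x} \<in> E \<Longrightarrow> x \<in> {1..5}"
      "\<And>x. {10, x} \<in> E \<Longrightarrow> x \<in> {2, 3, 4, 11}"
    have E': "simple_graph ({..<2 * k}, E)" "card E + 6 = 6 * k"
      using stacked_simple[OF E(1)] by auto
    show thesis
      by (rule that[OF E'(1) planar_stacked[OF E(1)] no_two_cycles_independent[OF assms E'(1) E(2,3)] E'(2)])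
  qed
qed

subsection \<open>Replacing graphs without a cycle and a cycle with a pendant edge\<close>

lemma contains_iff_embedding:
  assumes "simple_graph H"
  shows "contains G H \<longleftrightarrow>
    (\<exists>f. inj_on f (verts H) \<and> f ` verts H \<subseteq> verts G \<and> (\<forall>e\<in>edges H. f ` e \<in> edges G))"
proof
  assume "contains G H"
  then obtain H' where H': "subgraph H' G" and iso: "isomorphic H' H"
    unfolding contains_def by blast
  obtain g where g: "bij_betw g (verts H') (verts H)" "edges H = (\<lambda>e. g ` e) ` edges H'"
    using iso unfolding isomorphic_def by blast
  define f where "f = inv_into (verts H') g"
  have f: "bij_betw f (verts H) (verts H')"
    unfolding f_def by (rule bij_betw_inv_into[OF g(1)])
  have "f ` e \<in> edges G" if "e \<in> edges H" for e
  proof -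
    have "e \<in> (\<lambda>e. g ` e) ` edges H'" using that unfolding g(2) .
    then obtain e' where e': "e' \<in> edges H'" "e = g ` e'"
      by (elim imageE) (rule that)
    have "e' \<subseteq> verts H'" using H' e'(1) unfolding subgraph_def simple_graph_def by blast
    then have "f ` e = e'"
      unfolding f_def e'(2) using g(1) by (intro inv_into_image_cancel) (auto simp: bij_betw_def)
    then show ?thesis using e'(1) H' unfolding subgraph_def by blast
  qed
  moreover have "inj_on f (verts H)" "f ` verts H = verts H'"
    using f by (simp_all add: bij_betw_def)
  moreover have "verts H' \<subseteq> verts G"
    using H' by (simp add: subgraph_def)
  ultimately show "\<exists>f. inj_on f (verts H) \<and> f ` verts H \<subseteq> verts G \<and> (\<forall>e\<in>edges H. f ` e \<in> edges G)"
    by (intro exI[of _ f]) simp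
next
  assume "\<exists>f. inj_on f (verts H) \<and> f ` verts H \<subseteq> verts G \<and> (\<forall>e\<in>edges H. f ` e \<in> edges G)"
  then obtain f where f: "inj_on f (verts H)" "f ` verts H \<subseteq> verts G" "\<And>e. e \<in> edges H \<Longrightarrow> f ` e \<in> edges G"
    by blast
  have sub: "e \<subseteq> verts H" "card e = 2" if "e \<in> edges H" for e
    using assms that by (auto simp: simple_graph_def)
  define H' where "H' = (f ` verts H, (\<lambda>e. f ` e) ` edges H)"
  have "card (f ` e) = 2" if "e \<in> edges H" for e
    using sub[OF that] inj_on_subset[OF f(1) sub(1)[OF that]] by (simp add: card_image)
  then have "simple_graph H'"
    using assms sub(1) by (auto simp: H'_def simple_graph_def)
  then have "subgraph H' G"
    using f(2,3) by (auto simp: subgraph_def H'_def)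
  moreover have "isomorphic H' H"
    unfolding isomorphic_def
  proof (intro exI[of _ "inv_into (verts H) f"] conjI)
    show "bij_betw (inv_into (verts H) f) (verts H') (verts H)"
      unfolding H'_def fst_conv by (rule bij_betw_inv_into) (use f(1) in \<open>simp add: bij_betw_def\<close>)
    have "inv_into (verts H) f ` f ` e = e" if "e \<in> edges H" for e
      by (rule inv_into_image_cancel[OF f(1) sub(1)[OF that]])
    then show "edges H = (\<lambda>e. inv_into (verts H) f ` e) ` edges H'"
      unfolding H'_def snd_conv image_image by simp
  qed
  ultimately show "contains G H" unfolding contains_def by blast
qed

lemma simple_graph_disjoint_union:
  assumes "simple_graph G" "simple_graph H"
  shows "simple_graph (disjoint_union G H)"
proof -
  have G: "e \<subseteq> verts G \<and> card e = 2" if "e \<in> edges G" for e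
    using assms(1) that by (simp add: simple_graph_def)
  have H: "e \<subseteq> verts H \<and> card e = 2" if "e \<in> edges H" for e
    using assms(2) that by (simp add: simple_graph_def)
  show ?thesis
    unfolding simple_graph_def disjoint_union_def fst_conv snd_conv
  proof (intro conjI[of "finite _"] ballI)
    show "finite (Inl ` verts G \<union> Inr ` verts H)"
      using assms by (simp add: simple_graph_def)
    fix e :: "('a + 'b) set" assume "e \<in> (\<lambda>e. Inl ` e) ` edges G \<union> (\<lambda>e. Inr ` e) ` edges H"
    then show "e \<subseteq> Inl ` verts G \<union> Inr ` verts H \<and> card e = 2"
    proof (elim UnE imageE)
      fix f assume "e = Inl ` f" "f \<in> edges G"
      then show ?thesis using G[of f] by (simp add: card_image image_mono le_supI1 del: image_subset_iff)
    next
      fix f assume "e = Inr ` f" "f \<in> edges H"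
      then show ?thesis using H[of f] by (simp add: card_image image_mono le_supI2 del: image_subset_iff)
    qed
  qed
qed

lemma contains_two_cycles:
  assumes "3 \<le> k" "contains G (disjoint_union (cycle k) (cycle k))"
  shows "two_disjoint_cycles (edges G) k"
proof -
  have s: "simple_graph (disjoint_union (cycle k) (cycle k))"
    using assms(1) by (intro simple_graph_disjoint_union simple_graph_cycle)
  obtain f where f: "inj_on f (verts (disjoint_union (cycle k) (cycle k)))"
      "\<And>e. e \<in> edges (disjoint_union (cycle k) (cycle k)) \<Longrightarrow> f ` e \<in> edges G"
    using assms(2) unfolding contains_iff_embedding[OF s] by (elim exE conjE) (metis that)
  have V: "verts (disjoint_union (cycle k) (cycle k)) = Inl ` {..<k} \<union> Inr ` {..<k}"
    by (simp add: disjoint_union_def cycle_def)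
  have "{f (Inl i), f (Inl (Suc i mod k))} \<in> edges G" "{f (Inr i), f (Inr (Suc i mod k))} \<in> edges G" if "i < k" for i
  proof -
    have "{i, Suc i mod k} \<in> edges (cycle k)" using that by (auto simp: cycle_def)
    then have "Inl ` {i, Suc i mod k} \<in> edges (disjoint_union (cycle k) (cycle k))"
      "Inr ` {i, Suc i mod k} \<in> edges (disjoint_union (cycle k) (cycle k))"
      unfolding disjoint_union_def snd_conv by blast+
    then have "f ` Inl ` {i, Suc i mod k} \<in> edges G" "f ` Inr ` {i, Suc i mod k} \<in> edges G"
      using f(2) by blast+
    then show "{f (Inl i), f (Inl (Suc i mod k))} \<in> edges G" "{f (Inr i), f (Inr (Suc i mod k))} \<in> edges G"
      by simp_all
  qed
  moreover have "inj_on (\<lambda>i. f (Inl i)) {..<k}" "inj_on (\<lambda>i. f (Inr i)) {..<k}"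
    using f(1) unfolding V inj_on_def by auto
  ultimately have "is_cycle (edges G) k (\<lambda>i. f (Inl i))" "is_cycle (edges G) k (\<lambda>i. f (Inr i))"
    by (auto simp: is_cycle_def)
  moreover have "f (Inl i) \<noteq> f (Inr j)" if "i < k" "j < k" for i j
    using inj_onD[OF f(1), of "Inl i" "Inr j"] that unfolding V by blast
  then have "(\<lambda>i. f (Inl i)) ` {..<k} \<inter> (\<lambda>i. f (Inr i)) ` {..<k} = {}"
    by auto
  ultimately show ?thesis
    unfolding two_disjoint_cycles_def by blast
qed

lemma contains_cycle_plus_imp_contains_cycles:
  assumes "3 \<le> k" "contains G (disjoint_union (cycle k) (cycle_plus k))"
  shows "contains G (disjoint_union (cycle k) (cycle k))"
proof -
  have s: "simple_graph (disjoint_union (cycle k) (cycle k))" "simple_graph (disjoint_union (cycle k) (cycle_plus k))"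
    using assms(1) by (auto intro: simple_graph_disjoint_union simple_graph_cycle simple_graph_cycle_plus)
  have sub: "verts (disjoint_union (cycle k) (cycle k)) \<subseteq> verts (disjoint_union (cycle k) (cycle_plus k))"
    "edges (disjoint_union (cycle k) (cycle k)) \<subseteq> edges (disjoint_union (cycle k) (cycle_plus k))"
    by (auto simp: disjoint_union_def cycle_plus_def)
  obtain f where f: "inj_on f (verts (disjoint_union (cycle k) (cycle_plus k)))"
      "f ` verts (disjoint_union (cycle k) (cycle_plus k)) \<subseteq> verts G"
      "\<forall>e\<in>edges (disjoint_union (cycle k) (cycle_plus k)). f ` e \<in> edges G"
    using assms(2) unfolding contains_iff_embedding[OF s(2)] by (elim exE conjE) (rule that)
  show ?thesis
    unfolding contains_iff_embedding[OF s(1)]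
  proof (intro exI[of _ f] conjI ballI)
    show "inj_on f (verts (disjoint_union (cycle k) (cycle k)))" using f(1) sub(1) by (rule inj_on_subset)
    show "f ` verts (disjoint_union (cycle k) (cycle k)) \<subseteq> verts G" using f(2) sub(1) by blast
    show "f ` e \<in> edges G" if "e \<in> edges (disjoint_union (cycle k) (cycle k))" for e
      using f(3) sub(2) that by blast
  qed
qed

text \<open>A pendant edge at \<open>d 0\<close> covers every case, since the cycle may be rotated
  beforehand.\<close>

lemma contains_cycle_plusI:
  assumes "3 \<le> k" "simple_graph G" "is_cycle (edges G) k c" "is_cycle (edges G) k d"
    "c ` {..<k} \<inter> d ` {..<k} = {}" "{d 0, w} \<in> edges G" "w \<notin> c ` {..<k}" "w \<notin> d ` {..<k}"
  shows "contains G (disjoint_union (cycle k) (cycle_plus k))"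
proof -
  have s: "simple_graph (disjoint_union (cycle k) (cycle_plus k))"
    using assms(1) by (auto intro: simple_graph_disjoint_union simple_graph_cycle simple_graph_cycle_plus)
  \<comment> \<open>The index \<open>k\<close>, just beyond those of the cycle, is the pendant
    vertex of \<open>cycle_plus k\<close>.\<close>
  define f where "f = case_sum c (d(k := w))"
  have V: "verts (disjoint_union (cycle k) (cycle_plus k)) = Inl ` {..<k} \<union> Inr ` {..<k} \<union> {Inr k}"
    by (auto simp: disjoint_union_def cycle_def cycle_plus_def)
  have fl: "f (Inl i) = c i" for i by (simp add: f_def)
  have fr: "f (Inr i) = d i" if "i < k" for i using that by (simp add: f_def)
  have fk: "f (Inr k) = w" by (simp add: f_def)
  have edge: "e \<subseteq> verts G" if "e \<in> edges G" for e
    using assms(2) that by (simp add: simple_graph_def)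
  have inV: "c i \<in> verts G" "d i \<in> verts G" if "i < k" for i
    using that assms(3,4) edge unfolding is_cycle_def by blast+
  have w: "w \<in> verts G" using edge[OF assms(6)] by simp
  have injc: "inj_on c {..<k}" and injd: "inj_on d {..<k}" using assms(3,4) by (simp_all add: is_cycle_def)
  have "inj_on f (Inl ` {..<k})" using injc by (auto simp: inj_on_def fl)
  moreover have "inj_on f (Inr ` {..<k})" using injd by (auto simp: inj_on_def fr)
  moreover have "f ` Inl ` {..<k} = c ` {..<k}" "f ` Inr ` {..<k} = d ` {..<k}"
    unfolding image_image by (simp_all add: fl fr)
  moreover have "Inl ` {..<k} - Inr ` {..<k} = Inl ` {..<k}" "Inr ` {..<k} - Inl ` {..<k} = Inr ` {..<k}"
    by auto
  ultimately have "inj_on f (Inl ` {..<k} \<union> Inr ` {..<k})"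
    using assms(5) unfolding inj_on_Un by simp
  moreover have "f (Inr k) \<notin> f ` (Inl ` {..<k} \<union> Inr ` {..<k})"
    unfolding fk image_Un using \<open>f ` Inl ` {..<k} = c ` {..<k}\<close> \<open>f ` Inr ` {..<k} = d ` {..<k}\<close> assms(7,8) by simp
  ultimately have "inj_on f (verts (disjoint_union (cycle k) (cycle_plus k)))"
    unfolding V by (auto simp: inj_on_insert)
  moreover have "f ` verts (disjoint_union (cycle k) (cycle_plus k)) \<subseteq> verts G"
    unfolding V using inV w by (auto simp: fl fr fk)
  moreover have "f ` e \<in> edges G" if e: "e \<in> edges (disjoint_union (cycle k) (cycle_plus k))" for e
  proof -
    consider i where "i < k" "e = {Inl i, Inl (Suc i mod k)}" | i where "i < k" "e = {Inr i, Inr (Suc i mod k)}"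
      | "e = {Inr 0, Inr k}"
      using e by (auto simp: disjoint_union_def cycle_def cycle_plus_def)
    then show ?thesis
    proof cases
      case 1
      then show ?thesis using assms(3) by (simp add: fl is_cycle_def)
    next
      case 2
      have "Suc i mod k < k" using assms(1) by simp
      then show ?thesis using 2 assms(4) by (simp add: fr is_cycle_def)
    next
      case 3
      then show ?thesis using assms(1,6) by (simp add: fr fk)
    qed
  qed
  ultimately show ?thesis
    unfolding contains_iff_embedding[OF s] by blast
qed

text \<open>Rotated to start in \<open>S\<close>, the cycle can be followed edge by edge without
  leaving \<open>S\<close>.\<close>

lemma is_cycle_subset_closed:
  assumes c: "is_cycle E k c" and closed: "\<And>e. e \<in> E \<Longrightarrow> e \<inter> S \<noteq> {} \<Longrightarrow> e \<subseteq> S"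
    and meets: "c ` {..<k} \<inter> S \<noteq> {}"
  shows "c ` {..<k} \<subseteq> S"
proof -
  obtain m where m: "m < k" "c m \<in> S" using meets by auto
  define c' where "c' = (\<lambda>i. c ((i + m) mod k))"
  have c': "is_cycle E k c'" "c' ` {..<k} = c ` {..<k}"
    unfolding c'_def using is_cycle_rotate[OF c] m by auto
  have "c' i \<in> S" if "i < k" for i
    using that
  proof (induction i)
    case 0
    then show ?case using m by (simp add: c'_def)
  next
    case (Suc i)
    then have "{c' i, c' (Suc i)} \<in> E" using c'(1) unfolding is_cycle_def by (metis Suc_lessD mod_less)
    then have "{c' i, c' (Suc i)} \<subseteq> S" using closed[of "{c' i, c' (Suc i)}"] Suc by simp
    then show ?case by simp
  qed
  then have "c' ` {..<k} \<subseteq> S" by auto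
  then show ?thesis unfolding c'(2) .
qed

lemma is_cycle_Un:
  assumes "is_cycle (E1 \<union> E2) k c" "0 < k" "\<And>e. e \<in> E1 \<Longrightarrow> e \<subseteq> V1" "\<And>e. e \<in> E2 \<Longrightarrow> e \<subseteq> V2" "V1 \<inter> V2 = {}"
  shows "is_cycle E1 k c \<or> is_cycle E2 k c"
proof -
  have edge: "{c i, c (Suc i mod k)} \<in> E1 \<union> E2" if "i < k" for i
    using assms(1) that by (simp add: is_cycle_def)
  have inj: "inj_on c {..<k}" using assms(1) by (simp add: is_cycle_def)
  \<comment> \<open>Stated for an arbitrary ordered pair of edge sets, so that either part can play
    the first role.\<close>
  have one: "is_cycle F1 k c" if F: "F1 \<union> F2 = E1 \<union> E2" "\<And>e. e \<in> F1 \<Longrightarrow> e \<subseteq> W1" "\<And>e. e \<in> F2 \<Longrightarrow> e \<subseteq> W2"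
      "W1 \<inter> W2 = {}" "c 0 \<in> W1" for F1 F2 W1 W2
  proof -
    have "c ` {..<k} \<subseteq> W1"
    proof (rule is_cycle_subset_closed[OF assms(1)])
      show "e \<subseteq> W1" if e: "e \<in> E1 \<union> E2" "e \<inter> W1 \<noteq> {}" for e
      proof (cases "e \<in> F1")
        case False
        then have "e \<subseteq> W2" using F(1,3) e(1) by (metis UnE)
        then show ?thesis using F(4) e(2) by blast
      qed (use F(2) in simp)
      show "c ` {..<k} \<inter> W1 \<noteq> {}" using F(5) assms(2) by blast
    qed
    then have cW: "c i \<in> W1" if "i < k" for i using that by auto
    have "{c i, c (Suc i mod k)} \<in> F1" if "i < k" for i
    proof (rule ccontr)
      assume "{c i, c (Suc i mod k)} \<notin> F1"
      then have "{c i, c (Suc i mod k)} \<in> F2" using edge[OF that] F(1) by (metis UnE)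
      then have "c i \<in> W2" using F(3) by (metis insert_subset)
      then show False using cW[OF that] F(4) by blast
    qed
    then show ?thesis using inj by (simp add: is_cycle_def)
  qed
  have "c 0 \<in> V1 \<or> c 0 \<in> V2"
    using edge[OF assms(2)] assms(3,4) by (metis UnE insert_subset)
  then show ?thesis
  proof
    assume "c 0 \<in> V1"
    then show ?thesis using one[OF refl assms(3-5)] by simp
  next
    assume "c 0 \<in> V2"
    moreover have "E2 \<union> E1 = E1 \<union> E2" "V2 \<inter> V1 = {}" using assms(5) by auto
    ultimately show ?thesis using one[OF _ assms(4,3)] by simp
  qed
qed

text \<open>A \<open>k\<close>-cycle of the disjoint union lies in one of the parts, and
  \<open>F\<close> has none; two disjoint ones would both lie in \<open>E\<close>.\<close>

lemma two_cycle_free_disjoint_union: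
  fixes W :: "nat set"
  assumes "0 < k" and E: "simple_graph ({..<N}, E)" "planar ({..<N}, E)" "\<not> two_disjoint_cycles E k"
    and F: "simple_graph (W, F)" "planar (W, F)" "\<nexists>c. is_cycle F k c"
  shows "\<exists>G :: nat graph. simple_graph G \<and> planar G \<and> card (verts G) = N + card W \<and>
    card (edges G) = card E + card F \<and> \<not> two_disjoint_cycles (edges G) k"
proof -
  \<comment> \<open>The numbers in \<open>W\<close> may overlap with \<open>{..<N}\<close>; adding
    \<open>N\<close> moves them out of the way.\<close>
  define F' W' where "F' = (`) ((+) N) ` F" and "W' = (+) N ` W"
  have inj: "inj_on ((+) N) X" for X by simp
  have "F \<subseteq> Pow W" "E \<subseteq> Pow {..<N}" and fW: "finite W"
    using E(1) F(1) by (auto simp: simple_graph_def)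
  then have finF: "finite F" "finite W" and finE: "finite E"
    by (meson finite_Pow_iff finite_lessThan finite_subset)+
  have eW: "e \<subseteq> W'" "card e = 2" if "e \<in> F'" for e
    using that F(1) unfolding F'_def W'_def simple_graph_def by (auto simp: card_image)
  have eN: "e \<subseteq> {..<N}" "card e = 2" if "e \<in> E" for e
    using that E(1) by (auto simp: simple_graph_def)
  have disj: "{..<N} \<inter> W' = {}" by (auto simp: W'_def)
  have sF': "simple_graph (W', F')"
    using eW finF by (simp add: simple_graph_def W'_def)
  have pF': "planar (W', F')"
    unfolding W'_def F'_def by (rule planar_image[OF F(2,1) inj])
  have EF: "E \<inter> F' = {}"
  proof -
    have "e \<noteq> {}" if "e \<in> E" for e using eN(2)[OF that] by auto
    then show ?thesis using eN(1) eW(1) disj by blast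
  qed
  have "inj_on ((`) ((+) N)) F" by (rule inj_onI) (simp only: inj_image_eq_iff[OF inj])
  then have cF': "card F' = card F" "finite F'"
    unfolding F'_def using finF by (simp_all add: card_image)
  define G where "G = ({..<N} \<union> W', E \<union> F')"
  have "simple_graph G"
    using E(1) sF' by (auto simp: G_def simple_graph_def)
  moreover have "planar G"
    unfolding G_def by (rule planar_Un[OF E(2,1) pF' sF' disj])
  moreover have "card (verts G) = N + card W"
    using disj finF unfolding G_def by (simp add: card_Un_disjoint W'_def card_image)
  moreover have "card (edges G) = card E + card F"
    using EF cF' finE unfolding G_def by (simp add: card_Un_disjoint)
  moreover have noF': "\<not> is_cycle F' k c" for c
  proof
    assume c: "is_cycle F' k c"
    have ge: "N \<le> c i" if "i < k" for i
    proof -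
      have "c i \<in> W'" using c eW(1) that unfolding is_cycle_def by blast
      then show ?thesis by (auto simp: W'_def)
    qed
    have "is_cycle F k (\<lambda>i. c i - N)"
      unfolding is_cycle_def
    proof (intro conjI allI impI)
      show "inj_on (\<lambda>i. c i - N) {..<k}"
      proof (rule inj_onI)
        fix i j assume ij: "i \<in> {..<k}" "j \<in> {..<k}" "c i - N = c j - N"
        then have "c i = c j" using ge[of i] ge[of j] by simp
        then show "i = j" using c ij(1,2) by (auto simp: is_cycle_def inj_on_def)
      qed
      fix i assume i: "i < k"
      then have i': "Suc i mod k < k" by simp
      obtain e where e: "e \<in> F" "{c i, c (Suc i mod k)} = (+) N ` e"
        using c i unfolding is_cycle_def F'_def by blast
      have "(+) N ` {c i - N, c (Suc i mod k) - N} = {c i, c (Suc i mod k)}"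
        using ge[OF i] ge[OF i'] by simp
      then have "(+) N ` {c i - N, c (Suc i mod k) - N} = (+) N ` e" using e(2) by simp
      then have "{c i - N, c (Suc i mod k) - N} = e" by (simp only: inj_image_eq_iff[OF inj])
      then show "{c i - N, c (Suc i mod k) - N} \<in> F" using e(1) by simp
    qed
    then show False using F(3) by blast
  qed
  moreover have "is_cycle E k c" if "is_cycle (E \<union> F') k c" for c
    using is_cycle_Un[OF that assms(1) eN(1) eW(1) disj] noF' by blast
  then have "\<not> two_disjoint_cycles (edges G) k"
    using E(3) unfolding two_disjoint_cycles_def G_def snd_conv by blast
  ultimately show ?thesis by blast
qed

section \<open>Unions of components and the two cases of the replacement\<close>

text \<open>Captures unions of components without speaking of paths. Intersections of such sets will
  isolate single cycles.\<close>

definition closed_under :: "'a set set \<Rightarrow> 'a set \<Rightarrow> bool" where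
  "closed_under E S \<longleftrightarrow> (\<forall>e\<in>E. e \<inter> S \<noteq> {} \<longrightarrow> e \<subseteq> S)"

lemma closed_under_Int: "closed_under E S \<Longrightarrow> closed_under E T \<Longrightarrow> closed_under E (S \<inter> T)"
  unfolding closed_under_def by blast

lemma closed_under_Union: "(\<And>S. S \<in> \<Z> \<Longrightarrow> closed_under E S) \<Longrightarrow> closed_under E (\<Union>\<Z>)"
  unfolding closed_under_def by blast

lemma is_cycle_verts:
  assumes "simple_graph (V, E)" "is_cycle E k c"
  shows "c ` {..<k} \<subseteq> V"
proof
  fix x assume "x \<in> c ` {..<k}"
  then obtain i where "i < k" "x = c i" by auto
  then have "{x, c (Suc i mod k)} \<in> E" using assms(2) by (simp add: is_cycle_def)
  then show "x \<in> V" using assms(1) by (auto simp: simple_graph_def)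
qed

lemma induced_planar:
  assumes "simple_graph (V, E)" "planar (V, E)" "S \<subseteq> V"
  shows "simple_graph (S, {e \<in> E. e \<subseteq> S})" "planar (S, {e \<in> E. e \<subseteq> S})"
proof -
  show "simple_graph (S, {e \<in> E. e \<subseteq> S})"
    using assms(1,3) by (auto simp: simple_graph_def intro: finite_subset)
  show "planar (S, {e \<in> E. e \<subseteq> S})"
    by (rule planar_subgraph[OF assms(2,3)]) auto
qed

lemma edges_split_closed:
  assumes "simple_graph (V, E)" "closed_under E S" "S \<subseteq> V"
  shows "card E = card {e \<in> E. e \<subseteq> S} + card {e \<in> E. e \<subseteq> V - S}"
proof -
  have E: "e \<subseteq> V" "e \<noteq> {}" if "e \<in> E" for e
    using assms(1) that by (auto simp: simple_graph_def)
  have "E \<subseteq> Pow V" using E by blast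
  then have fin: "finite E"
    using assms(1) by (auto simp: simple_graph_def intro: finite_subset)
  have "E = {e \<in> E. e \<subseteq> S} \<union> {e \<in> E. e \<subseteq> V - S}"
    using assms(2) E(1) unfolding closed_under_def by blast
  moreover have "{e \<in> E. e \<subseteq> S} \<inter> {e \<in> E. e \<subseteq> V - S} = {}"
    using E(2) by blast
  ultimately show ?thesis
    using fin card_Un_disjoint[of "{e \<in> E. e \<subseteq> S}" "{e \<in> E. e \<subseteq> V - S}"] by simp
qed

text \<open>An edge leaving a pair of disjoint cycles would be a pendant edge at one of them.\<close>

lemma disjoint_cycles_closed:
  assumes "3 \<le> k" "simple_graph (V, E)" "\<not> contains (V, E) (disjoint_union (cycle k) (cycle_plus k))"
    and c: "is_cycle E k c" and d: "is_cycle E k d" and disj: "c ` {..<k} \<inter> d ` {..<k} = {}"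
  shows "closed_under E (c ` {..<k} \<union> d ` {..<k})"
proof -
  \<comment> \<open>The cycles are generalised because the edge may leave from either of the
    two.\<close>
  have no: False if c: "is_cycle E k c" and d: "is_cycle E k d" and disj: "c ` {..<k} \<inter> d ` {..<k} = {}"
    and e: "{v, w} \<in> E" "v \<in> d ` {..<k}" "w \<notin> c ` {..<k}" "w \<notin> d ` {..<k}" for c d v w
  proof -
    obtain m where m: "m < k" "v = d m" using e(2) by auto
    define d' where "d' = (\<lambda>i. d ((i + m) mod k))"
    have d': "is_cycle E k d'" "d' ` {..<k} = d ` {..<k}"
      unfolding d'_def using is_cycle_rotate[OF d] m by auto
    have "d' 0 = v" using m by (simp add: d'_def)
    then have "contains (V, E) (disjoint_union (cycle k) (cycle_plus k))"
      using contains_cycle_plusI[OF assms(1,2), of c d' w] c d' disj e by simp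
    then show False using assms(3) by contradiction
  qed
  show ?thesis
    unfolding closed_under_def
  proof (intro ballI impI subsetI, rule ccontr)
    fix e w assume e: "e \<in> E" "e \<inter> (c ` {..<k} \<union> d ` {..<k}) \<noteq> {}" "w \<in> e" "w \<notin> c ` {..<k} \<union> d ` {..<k}"
    then obtain v where v: "v \<in> e" "v \<in> c ` {..<k} \<union> d ` {..<k}" by blast
    have "card e = 2" using assms(2) e(1) by (simp add: simple_graph_def)
    moreover have "v \<noteq> w" using v(2) e(4) by metis
    ultimately have "e = {v, w}" using v(1) e(3) by (metis card_2_iff insertE singletonD insert_commute)
    then have "{v, w} \<in> E" using e(1) by simp
    moreover have "w \<notin> c ` {..<k}" "w \<notin> d ` {..<k}" using e(4) by simp_all
    moreover have "d ` {..<k} \<inter> c ` {..<k} = {}" using disj by (simp add: Int_commute)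
    ultimately show False
      using v(2) no[OF c d disj] no[OF d c] by (metis UnE)
  qed
qed

lemma is_cycle_subset_closed_under:
  assumes "is_cycle E k c" "closed_under E S" "c ` {..<k} \<inter> S \<noteq> {}"
  shows "c ` {..<k} \<subseteq> S"
  by (rule is_cycle_subset_closed[OF assms(1) _ assms(3)]) (use assms(2) in \<open>simp add: closed_under_def\<close>)

lemma is_cycle_4I:
  assumes "distinct [a, b, c, d]" "{{a, b}, {b, c}, {c, d}, {d, a}} \<subseteq> E"
  shows "is_cycle E 4 (\<lambda>i. [a, b, c, d] ! i)"
proof -
  have "inj_on (\<lambda>i. [a, b, c, d] ! i) {..<4}"
    using assms(1) by (intro inj_on_nth) auto
  moreover have "{[a, b, c, d] ! i, [a, b, c, d] ! (Suc i mod 4)} \<in> E" if "i < 4" for i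
  proof -
    have "i = 0 \<or> i = 1 \<or> i = 2 \<or> i = 3" using that by linarith
    then consider "i = 0" | "i = 1" | "i = 2" | "i = 3" by blast
    then show ?thesis using assms(2) by cases simp_all
  qed
  ultimately show ?thesis by (simp add: is_cycle_def)
qed

lemma no_cycle_outside:
  fixes V :: "nat set"
  assumes V: "simple_graph (V, E)" "planar (V, E)" and k: "4 \<le> k" "2 * k < card V"
    and X: "X \<subseteq> V" "card X = 2 * k" "closed_under E X"
    and no: "\<nexists>c. is_cycle {e \<in> E. e \<subseteq> V - X} k c"
  shows "\<exists>G :: nat graph. simple_graph G \<and> planar G \<and> card (verts G) = card V \<and> card E \<le> card (edges G) \<and>
    \<not> two_disjoint_cycles (edges G) k"
proof -
  have fV: "finite V" using V(1) by (simp add: simple_graph_def)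
  then have fX: "finite X" using X(1) finite_subset by blast
  let ?F = "{e \<in> E. e \<subseteq> V - X}"
  have F: "simple_graph (V - X, ?F)" "planar (V - X, ?F)"
    using induced_planar[OF V, of "V - X"] by auto
  have cE: "card E = card {e \<in> E. e \<subseteq> X} + card ?F"
    by (rule edges_split_closed[OF V(1) X(3,1)])
  have "card {e \<in> E. e \<subseteq> X} \<le> 3 * card X - 6"
    using planar_card_edges_le[OF induced_planar[OF V X(1)]] k X(2) by simp
  then have cX: "card {e \<in> E. e \<subseteq> X} + 6 \<le> 6 * k" using X(2) k by linarith
  have cV: "card V = 2 * k + card (V - X)"
    using card_Diff_subset[OF fX X(1)] X(2) k(2) by simp
  show ?thesis
  proof (cases "5 \<le> k")
    case True
    obtain H where H: "simple_graph ({..<2 * k}, H)" "planar ({..<2 * k}, H)"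
        "\<not> two_disjoint_cycles H k" "card H + 6 = 6 * k"
      by (rule planar_triangulation_two_cycle_free[OF True])
    have k0: "0 < k" using k by simp
    obtain G :: "nat graph" where G: "simple_graph G" "planar G" "card (verts G) = 2 * k + card (V - X)"
        "card (edges G) = card H + card ?F" "\<not> two_disjoint_cycles (edges G) k"
      using two_cycle_free_disjoint_union[OF k0 H(1-3) F no] by (elim exE conjE) (rule that)
    then show ?thesis
      using cV cE cX H(4) by (intro exI[of _ G]) simp
  next
    case False
    then have k4: "k = 4" using k(1) by simp
    have "3 \<le> k" "3 \<le> card V" using k by simp_all
    then obtain H where H: "simple_graph ({..<card V}, H)" "planar ({..<card V}, H)" "\<not> two_disjoint_cycles H k"
        "3 * card V \<le> card H + (card V - 3) div (k - 2) + 6"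
      by (rule planar_two_cycle_free)
    \<comment> \<open>The estimate for graphs without 4-cycles applies only from four edges
      on.\<close>
    have bound: "card ?F \<le> 3 \<or> 5 * card ?F + 24 \<le> 12 * card (V - X)"
    proof (cases "4 \<le> card ?F")
      case True
      have no_C4: "False" if "distinct [a, b, c, d]" "{{a, b}, {b, c}, {c, d}, {d, a}} \<subseteq> ?F" for a b c d
        using is_cycle_4I[OF that] no k4 by metis
      have "5 * card (edges (V - X, ?F)) + 24 \<le> 12 * card (verts (V - X, ?F))"
        by (rule planar_no_C4_card_edges_le[OF F]; unfold snd_conv) (fact True, fact no_C4)
      then show ?thesis by simp
    qed simp
    \<comment> \<open>For a single outer vertex there is no slack: the lower bound for
      \<open>card H\<close> is then 18, the same as the upper bound for the edges inside
      \<open>X\<close>, so the bound by 3 would not do.\<close>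
    have small: "card ?F = 0" if one: "card (V - X) = 1"
    proof -
      obtain v where v: "V - X = {v}" using one by (rule card_1_singletonE)
      have "e \<notin> ?F" for e
      proof
        assume e: "e \<in> ?F"
        then have "e \<subseteq> V - X" by simp
        then have "e \<subseteq> {v}" unfolding v .
        then have "card e \<le> card {v}" by (intro card_mono) simp_all
        moreover have "card e = 2" using F(1) e unfolding simple_graph_def snd_conv by metis
        ultimately show False by simp
      qed
      then have "?F = {}" by (metis ex_in_conv)
      then show ?thesis by (simp only: card.empty)
    qed
    have r: "card (V - X) \<ge> 1" using cV k(2) by linarith
    have "2 * ((card V - 3) div 2) \<le> card V - 3" by simp
    moreover have "3 * card V \<le> card H + (card V - 3) div 2 + 6"
      using H(4) k4 by simp
    moreover have "card V = 8 + card (V - X)" using cV k4 by simp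
    \<comment> \<open>With r outer vertices, twice the number of edges of \<open>H\<close> is at
      least 6 (8 + r) - 12 - (5 + r). The growth by 5/2 per vertex beats the 12/5 of the outer
      part.\<close>
    ultimately have h: "31 + 5 * card (V - X) \<le> 2 * card H" by linarith
    have "18 + card ?F \<le> card H"
    proof (cases "card (V - X) = 1")
      case True
      then show ?thesis using h small by linarith
    next
      case False
      then show ?thesis using h r bound by linarith
    qed
    then have "card E \<le> card H"
      using cE cX k4 by linarith
    then show ?thesis
      using H(1-3) by (intro exI[of _ "({..<card V}, H)"]) simp
  qed
qed

text \<open>A third cycle makes single cycles closed: \<open>C\<close> is the intersection of the
  closed sets \<open>C \<union> D\<close> and \<open>C \<union> Q\<close>. Any other cycle either
  meets \<open>C\<close> or \<open>D\<close> and then fills it, or is disjoint from both and is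
  isolated in the same way. So the vertex sets of cycles are pairwise disjoint or equal. If there
  are t of them, their union carries at most 3 t k - 6 t edges.\<close>

lemma three_disjoint_cycles:
  fixes V :: "nat set"
  assumes V: "simple_graph (V, E)" "planar (V, E)" "\<not> contains (V, E) (disjoint_union (cycle k) (cycle_plus k))"
    and k: "4 \<le> k"
    and c: "is_cycle E k c" and d: "is_cycle E k d" and q: "is_cycle E k q"
    and disj: "c ` {..<k} \<inter> d ` {..<k} = {}" "c ` {..<k} \<inter> q ` {..<k} = {}" "d ` {..<k} \<inter> q ` {..<k} = {}"
  shows "\<exists>G :: nat graph. simple_graph G \<and> planar G \<and> card (verts G) = card V \<and> card E \<le> card (edges G) \<and>
    \<not> two_disjoint_cycles (edges G) k"
proof -
  have k3: "3 \<le> k" using k by simp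
  define \<Z> where "\<Z> = {z ` {..<k} | z. is_cycle E k z}"
  define C D Q where "C = c ` {..<k}" and "D = d ` {..<k}" and "Q = q ` {..<k}"
  note cl = disjoint_cycles_closed[OF k3 V(1,3)]
  have fV: "finite V" using V(1) by (simp add: simple_graph_def)
  have "closed_under E ((C \<union> D) \<inter> (C \<union> Q))" "closed_under E ((C \<union> D) \<inter> (D \<union> Q))"
    unfolding C_def D_def Q_def using cl[OF c d disj(1)] cl[OF c q disj(2)] cl[OF d q disj(3)]
    by (auto intro: closed_under_Int)
  moreover have "(C \<union> D) \<inter> (C \<union> Q) = C" "(C \<union> D) \<inter> (D \<union> Q) = D"
    using disj unfolding C_def D_def Q_def by auto
  ultimately have clC: "closed_under E C" and clD: "closed_under E D" by simp_all
  have CZ: "C \<in> \<Z>" "D \<in> \<Z>" using c d by (auto simp: \<Z>_def C_def D_def)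
  have Zk: "card Z = k" "Z \<subseteq> V" "finite Z" if Z: "Z \<in> \<Z>" for Z
  proof -
    obtain z where z: "is_cycle E k z" "Z = z ` {..<k}" using Z by (auto simp: \<Z>_def)
    show "card Z = k" "Z \<subseteq> V" "finite Z"
      using card_is_cycle[OF z(1)] is_cycle_verts[OF V(1) z(1)] z(2) by auto
  qed
  have eq: "Z = S" if Z: "Z \<in> \<Z>" "closed_under E S" "Z \<inter> S \<noteq> {}" "card S = k" "finite S" for Z S
  proof -
    obtain z where z: "is_cycle E k z" "Z = z ` {..<k}" using Z by (auto simp: \<Z>_def)
    have "Z \<subseteq> S" using is_cycle_subset_closed_under[OF z(1) Z(2)] Z(3) z(2) by simp
    then show ?thesis using Zk(1)[OF Z(1)] Z(4,5) by (simp add: card_subset_eq)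
  qed
  have clZ: "closed_under E Z" if Z: "Z \<in> \<Z>" for Z
  proof (cases "Z \<inter> C = {} \<and> Z \<inter> D = {}")
    case True
    obtain z where z: "is_cycle E k z" "Z = z ` {..<k}" using Z by (auto simp: \<Z>_def)
    have "closed_under E (Z \<union> C)" "closed_under E (Z \<union> D)"
      using cl[OF z(1) c] cl[OF z(1) d] True z(2) unfolding C_def D_def by simp_all
    then have "closed_under E ((Z \<union> C) \<inter> (Z \<union> D))" by (rule closed_under_Int)
    moreover have "(Z \<union> C) \<inter> (Z \<union> D) = Z" using disj(1) unfolding C_def D_def by auto
    ultimately show ?thesis by simp
  next
    case False
    then show ?thesis
      using eq[OF Z clC] eq[OF Z clD] clC clD Zk[OF CZ(1)] Zk[OF CZ(2)] by metis
  qed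
  define W where "W = \<Union>\<Z>"
  define t where "t = card \<Z>"
  have "\<Z> \<subseteq> Pow V" using Zk(2) by blast
  then have fZ: "finite \<Z>" using fV by (meson finite_Pow_iff finite_subset)
  have WV: "W \<subseteq> V" using Zk(2) by (auto simp: W_def)
  have clW: "closed_under E W" unfolding W_def using clZ by (rule closed_under_Union)
  have "pairwise disjnt \<Z>"
  proof (rule pairwiseI)
    fix Z Z' assume Z: "Z \<in> \<Z>" "Z' \<in> \<Z>" "Z \<noteq> Z'"
    then show "disjnt Z Z'"
      using eq[OF Z(1) clZ[OF Z(2)] _ Zk(1,3)[OF Z(2)]] unfolding disjnt_def by metis
  qed
  then have "card W = sum card \<Z>"
    unfolding W_def using Zk(3) by (intro card_Union_disjoint) simp_all
  also have "\<dots> = (\<Sum>Z\<in>\<Z>. k)" using Zk(1) by (intro sum.cong) simp_all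
  finally have cW: "card W = t * k" by (simp add: t_def)
  have "C \<noteq> D" using disj(1) card_is_cycle[OF c] k by (auto simp: C_def D_def)
  then have "card {C, D} \<le> t" unfolding t_def using CZ fZ by (intro card_mono) auto
  then have t2: "2 \<le> t" using \<open>C \<noteq> D\<close> by simp
  have "{e \<in> E. e \<subseteq> W} \<subseteq> (\<Union>Z\<in>\<Z>. {e \<in> E. e \<subseteq> Z})"
  proof
    fix e assume e: "e \<in> {e \<in> E. e \<subseteq> W}"
    then have "card e = 2" using V(1) by (simp add: simple_graph_def)
    then obtain v where v: "v \<in> e" by fastforce
    then obtain Z where Z: "Z \<in> \<Z>" "v \<in> Z" using e by (auto simp: W_def)
    then have "e \<subseteq> Z" using clZ[OF Z(1)] v e unfolding closed_under_def by blast
    then show "e \<in> (\<Union>Z\<in>\<Z>. {e \<in> E. e \<subseteq> Z})" using e Z(1) by blast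
  qed
  moreover have fE: "finite {e \<in> E. e \<subseteq> Z}" for Z
  proof -
    have "{e \<in> E. e \<subseteq> Z} \<subseteq> Pow V" using V(1) by (auto simp: simple_graph_def)
    then show ?thesis using fV by (meson finite_Pow_iff finite_subset)
  qed
  ultimately have "card {e \<in> E. e \<subseteq> W} \<le> card (\<Union>Z\<in>\<Z>. {e \<in> E. e \<subseteq> Z})"
    using fZ by (intro card_mono) auto
  also have "\<dots> \<le> (\<Sum>Z\<in>\<Z>. card {e \<in> E. e \<subseteq> Z})" by (rule card_UN_le[OF fZ])
  also have "\<dots> \<le> (\<Sum>Z\<in>\<Z>. 3 * k - 6)"
  proof (rule sum_mono)
    fix Z assume Z: "Z \<in> \<Z>"
    show "card {e \<in> E. e \<subseteq> Z} \<le> 3 * k - 6"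
      using planar_card_edges_le[OF induced_planar[OF V(1,2) Zk(2)[OF Z]]] Zk(1)[OF Z] k3 by simp
  qed
  finally have eW: "card {e \<in> E. e \<subseteq> W} \<le> t * (3 * k - 6)" by (simp add: t_def)
  let ?F = "{e \<in> E. e \<subseteq> V - W}"
  have F: "simple_graph (V - W, ?F)" "planar (V - W, ?F)"
    using induced_planar[OF V(1,2), of "V - W"] by auto
  have no: "\<nexists>z. is_cycle ?F k z"
  proof
    assume "\<exists>z. is_cycle ?F k z"
    then obtain z where z: "is_cycle ?F k z" by blast
    then have "is_cycle E k z" by (rule is_cycle_mono) auto
    then have "z ` {..<k} \<subseteq> W" by (auto simp: W_def \<Z>_def)
    moreover have "z ` {..<k} \<subseteq> V - W" by (rule is_cycle_verts[OF F(1) z])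
    moreover have "z 0 \<in> z ` {..<k}" using k by simp
    ultimately show False by blast
  qed
  have "3 \<le> t * k" using t2 k mult_le_mono[of 2 t 4 k] by simp
  with k3 obtain H where H: "simple_graph ({..<t * k}, H)" "planar ({..<t * k}, H)" "\<not> two_disjoint_cycles H k"
      "3 * (t * k) \<le> card H + (t * k - 3) div (k - 2) + 6"
    by (rule planar_two_cycle_free)
  have k0: "0 < k" using k by simp
  obtain G :: "nat graph" where G: "simple_graph G" "planar G" "card (verts G) = t * k + card (V - W)"
    "card (edges G) = card H + card ?F" "\<not> two_disjoint_cycles (edges G) k"
    using two_cycle_free_disjoint_union[OF k0 H(1-3) F no] by (elim exE conjE) (rule that)
  \<comment> \<open>This rests on t k \<le> 2 t (k - 2), that is, on
    \<open>k \<ge> 4\<close>.\<close>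
  have "(t * k - 3) div (k - 2) \<le> 2 * t"
  proof -
    have "t * 4 \<le> t * k" using k by simp
    moreover have "2 * t * (k - 2) + 4 * t = 2 * (t * k)"
    proof -
      define j where "j = k - 2"
      then have "k = j + 2" using k by simp
      then show ?thesis by (simp add: algebra_simps)
    qed
    ultimately have "t * k - 3 \<le> 2 * t * (k - 2)" by linarith
    then have "(t * k - 3) div (k - 2) \<le> (2 * t * (k - 2)) div (k - 2)" by (rule div_le_mono)
    then show ?thesis using k by simp
  qed
  moreover have "t * (3 * k - 6) + 6 * t = 3 * (t * k)"
  proof -
    have "3 * k - 6 + 6 = 3 * k" using k by simp
    then have "t * (3 * k - 6 + 6) = t * (3 * k)" by simp
    then show ?thesis by (simp add: algebra_simps)
  qed
  \<comment> \<open>After cancelling 3 t k the comparison is 6 + 2 t \<le> 6 t, true for t \<ge>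
    2.\<close>
  ultimately have "card {e \<in> E. e \<subseteq> W} \<le> card H" using H(4) eW t2 by linarith
  then have "card E \<le> card (edges G)"
    using edges_split_closed[OF V(1) clW WV] G(4) by simp
  moreover have "card (verts G) = card V"
    using G(3) cW card_Diff_subset[OF finite_subset[OF WV fV] WV] card_mono[OF fV WV] by simp
  ultimately show ?thesis using G(1,2,5) by blast
qed

lemma replace_two_cycles:
  fixes G :: "nat graph"
  assumes "2 * k + 1 \<le> card (verts G)" "4 \<le> k" "simple_graph G" "planar G"
    "\<not> contains G (disjoint_union (cycle k) (cycle_plus k))"
  shows "\<exists>G' :: nat graph. simple_graph G' \<and> planar G' \<and> card (verts G') = card (verts G) \<and>
    card (edges G) \<le> card (edges G') \<and> \<not> contains G' (disjoint_union (cycle k) (cycle k))"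
proof -
  have k3: "3 \<le> k" using assms(2) by simp
  obtain V E where VE: "G = (V, E)" by (cases G)
  have V: "simple_graph (V, E)" "planar (V, E)" "\<not> contains (V, E) (disjoint_union (cycle k) (cycle_plus k))"
    and n: "2 * k < card V"
    using assms VE by simp_all
  have "\<exists>G :: nat graph. simple_graph G \<and> planar G \<and> card (verts G) = card V \<and> card E \<le> card (edges G) \<and>
    \<not> two_disjoint_cycles (edges G) k"
  proof (cases "two_disjoint_cycles E k")
    case False
    then show ?thesis using V by (intro exI[of _ "(V, E)"]) simp
  next
    case True
    then obtain c d where cd: "is_cycle E k c" "is_cycle E k d" "c ` {..<k} \<inter> d ` {..<k} = {}"
      unfolding two_disjoint_cycles_def by blast
    define X where "X = c ` {..<k} \<union> d ` {..<k}"
    have X: "closed_under E X" "X \<subseteq> V" "card X = 2 * k"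
    proof -
      show "closed_under E X" unfolding X_def by (rule disjoint_cycles_closed[OF k3 V(1,3) cd])
      show "X \<subseteq> V" unfolding X_def using is_cycle_verts[OF V(1)] cd(1,2) by simp
      show "card X = 2 * k"
        unfolding X_def using cd(3) card_is_cycle[OF cd(1)] card_is_cycle[OF cd(2)] by (simp add: card_Un_disjoint)
    qed
    show ?thesis
    proof (cases "\<exists>q. is_cycle {e \<in> E. e \<subseteq> V - X} k q")
      case False
      then show ?thesis using no_cycle_outside[OF V(1,2) assms(2) n X(2,3,1)] by blast
    next
      case True
      then obtain q where q: "is_cycle {e \<in> E. e \<subseteq> V - X} k q" by blast
      have "q ` {..<k} \<subseteq> V - X"
        by (rule is_cycle_verts[OF _ q]) (use induced_planar(1)[OF V(1,2), of "V - X"] in auto)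
      then have "c ` {..<k} \<inter> q ` {..<k} = {}" "d ` {..<k} \<inter> q ` {..<k} = {}"
        unfolding X_def by blast+
      moreover have "is_cycle E k q" using q by (rule is_cycle_mono) auto
      ultimately show ?thesis
        using three_disjoint_cycles[OF V assms(2) cd(1,2) _ cd(3)] by blast
    qed
  qed
  then obtain G' :: "nat graph" where G': "simple_graph G'" "planar G'" "card (verts G') = card V"
      "card E \<le> card (edges G')" "\<not> two_disjoint_cycles (edges G') k"
    by (elim exE conjE) (rule that)
  moreover have "\<not> contains G' (disjoint_union (cycle k) (cycle k))"
    using contains_two_cycles[OF k3] G'(5) by metis
  ultimately show ?thesis
    unfolding VE fst_conv snd_conv by (intro exI[of _ G'] conjI)
qed

theorem theorem4p3:
  fixes n k :: nat
  assumes "n \<ge> 2 * k + 1" and "k \<ge> 4"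
  shows "ex_planar n (disjoint_union (cycle k) (cycle_plus k)) =
         ex_planar n (disjoint_union (cycle k) (cycle k))"
proof -
  let ?P = "disjoint_union (cycle k) (cycle_plus k)" and ?C = "disjoint_union (cycle k) (cycle k)"
  have k3: "3 \<le> k" using assms(2) by simp
  have ne: "planar_edge_numbers n ?C \<noteq> {}"
    using k3 by (intro planar_edge_numbers_nonempty) (auto simp: disjoint_union_def cycle_def intro!: exI[of _ 0])
  have sub: "planar_edge_numbers n ?C \<subseteq> planar_edge_numbers n ?P"
    unfolding planar_edge_numbers_def
    using contains_cycle_plus_imp_contains_cycles[OF k3] by blast
  \<comment> \<open>The maximum is attained, so there is an extremal graph to which the replacement
    can be applied.\<close>
  have "Max (planar_edge_numbers n ?P) \<in> planar_edge_numbers n ?P"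
    using ne sub by (intro Max_in finite_planar_edge_numbers) blast
  then obtain G :: "nat graph" where G: "Max (planar_edge_numbers n ?P) = card (edges G)"
      "simple_graph G" "planar G" "card (verts G) = n" "\<not> contains G ?P"
    unfolding planar_edge_numbers_def by blast
  obtain G' :: "nat graph" where G': "simple_graph G'" "planar G'" "card (verts G') = n"
      "card (edges G) \<le> card (edges G')" "\<not> contains G' ?C"
    using replace_two_cycles[of k G] assms G by auto
  have "card (edges G') \<in> planar_edge_numbers n ?C"
    unfolding planar_edge_numbers_def using G'(1-3,5) by blast
  then have "card (edges G') \<le> Max (planar_edge_numbers n ?C)"
    by (intro Max_ge finite_planar_edge_numbers)
  then have "Max (planar_edge_numbers n ?P) \<le> Max (planar_edge_numbers n ?C)"
    using G(1) G'(4) by simp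
  moreover have "Max (planar_edge_numbers n ?C) \<le> Max (planar_edge_numbers n ?P)"
    by (intro Max_mono sub ne finite_planar_edge_numbers)
  ultimately show ?thesis by (simp add: ex_planar_def)
qed

end
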